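(* For each integer $n\ge 2$, there exist a compact metrizable Hausdorff space $X$ and a strongly regular uniform algebra $B$ on $X$ such that $B$ has a Gleason part $P$ that has exactly $n$ elements, $B$ has bounded relative units at every point of $X\setminus P$, and there are no nonzero bounded point derivations on $B$.
   Context: A uniform algebra on a compact Hausdorff space $X$ is a subalgebra of $C(X)$ (continuous complex-valued functions, supremum norm) that is closed, contains the constant functions, and separates the points of $X$. The maximal ideal space $\mathfrak{M}_B$ is the set of nonzero multiplicative linear functionals on $B$ with the Gelfand (weak-* ) topology; points of $X$ are identified with the corresponding point evaluations, so $X\subset\mathfrak{M}_B$, and $\hat f$ denotes the Gelfand transform of $f$. For $\phi\in\mathfrak{M}_B$ set $M_\phi=\{f\in B:\hat f(\phi)=0\}$ and $J_\phi=\{f\in B:\hat f^{-1}(0)\text{ contains a neighborhood of }\phi\text{ in }\mathfrak{M}_B\}$. $B$ is strongly regular at $x\in X$ if $J_x$ is dense in $M_x$, and strongly regular if it is strongly regular at every point of $X$. (It is known that a strongly regular uniform algebra is normal and hence $X=\mathfrak{M}_B$.) $B$ has bounded relative units at $x\in X$ if there is a constant $C>0$ such that for each compact $K\subset X\setminus\{x\}$ there is $f\in J_x$ with $f|K=1$ and $\|f\|\le C$. For $\phi\in\mathfrak{M}_B$, a point derivation on $B$ at $\phi$ is a linear functional $\psi$ on $B$ with $\psi(fg)=\psi(f)\phi(g)+\phi(f)\psi(g)$ for all $f,g\in B$; it is bounded if it is continuous. "No nonzero bounded point derivations on $B$" means none at any $\phi\in\mathfrak{M}_B$. The Gleason parts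 for $B$ are the equivalence classes in $\mathfrak{M}_B$ under the equivalence relation $\phi\sim\psi$ if and only if $\|\phi-\psi\|<2$ (norm of the dual space $B^*$). *)

theory Defs
  imports "HOL-Analysis.Analysis"
begin

text \<open>
  Spaces are abstract topologies. Following the convention of the library's space
  \<^const>\<open>cfunspace\<close> of bounded continuous functions, an element of \<open>C(X)\<close> is a function that is
  \<^const>\<open>extensional\<close> on \<^term>\<open>topspace X\<close>, so that two elements are equal iff they agree on \<open>X\<close>,
  and pointwise operations are restricted to \<^term>\<open>topspace X\<close>.
\<close>

text \<open>For compact \<open>X\<close> the boundedness built into \<^const>\<open>cfunspace\<close> is automatic, and its metric
  is the one given by the supremum norm.\<close>

definition C_metric :: "'a topology \<Rightarrow> ('a \<Rightarrow> complex) metric" where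
  "C_metric X = cfunspace X euclidean_metric"

definition C_space :: "'a topology \<Rightarrow> ('a \<Rightarrow> complex) set" where
  "C_space X = mspace (C_metric X)"

definition C_topology :: "'a topology \<Rightarrow> ('a \<Rightarrow> complex) topology" where
  "C_topology X = mtopology_of (C_metric X)"

definition sup_norm :: "'a topology \<Rightarrow> ('a \<Rightarrow> complex) \<Rightarrow> real" where
  "sup_norm X f = (SUP x\<in>topspace X. cmod (f x))"

definition uniform_algebra :: "'a topology \<Rightarrow> ('a \<Rightarrow> complex) set \<Rightarrow> bool" where
  "uniform_algebra X B \<longleftrightarrow>
     B \<subseteq> C_space X \<and>
     (\<forall>f\<in>B. \<forall>g\<in>B. (\<lambda>x\<in>topspace X. f x + g x) \<in> B) \<and>
     (\<forall>f\<in>B. \<forall>g\<in>B. (\<lambda>x\<in>topspace X. f x * g x) \<in> B) \<and>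
     (\<forall>c. \<forall>f\<in>B. (\<lambda>x\<in>topspace X. c * f x) \<in> B) \<and>
     closedin (C_topology X) B \<and>
     (\<forall>c. (\<lambda>x\<in>topspace X. c) \<in> B) \<and>
     (\<forall>x\<in>topspace X. \<forall>y\<in>topspace X. x \<noteq> y \<longrightarrow> (\<exists>f\<in>B. f x \<noteq> f y))"

definition linear_functional ::
    "'a topology \<Rightarrow> ('a \<Rightarrow> complex) set \<Rightarrow> (('a \<Rightarrow> complex) \<Rightarrow> complex) \<Rightarrow> bool" where
  "linear_functional X B \<psi> \<longleftrightarrow>
     (\<forall>f\<in>B. \<forall>g\<in>B. \<psi> (\<lambda>x\<in>topspace X. f x + g x) = \<psi> f + \<psi> g) \<and>
     (\<forall>c. \<forall>f\<in>B. \<psi> (\<lambda>x\<in>topspace X. c * f x) = c * \<psi> f)"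

text \<open>Functionals in the maximal ideal space are made extensional on \<open>B\<close>, so that they are
  determined by their values on \<open>B\<close>; in particular cardinalities of sets of them are meaningful.
  The Gelfand transform of \<open>f\<close> is the map \<open>\<phi> \<mapsto> \<phi> f\<close>.\<close>

definition max_ideal_space ::
    "'a topology \<Rightarrow> ('a \<Rightarrow> complex) set \<Rightarrow> (('a \<Rightarrow> complex) \<Rightarrow> complex) set" where
  "max_ideal_space X B =
     {\<phi> \<in> extensional B. linear_functional X B \<phi> \<and>
        (\<forall>f\<in>B. \<forall>g\<in>B. \<phi> (\<lambda>x\<in>topspace X. f x * g x) = \<phi> f * \<phi> g) \<and>
        (\<exists>f\<in>B. \<phi> f \<noteq> 0)}"

text \<open>The weak-* topology, i.e. that of pointwise convergence on \<open>B\<close>.\<close>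

definition gelfand_topology ::
    "'a topology \<Rightarrow> ('a \<Rightarrow> complex) set \<Rightarrow> (('a \<Rightarrow> complex) \<Rightarrow> complex) topology" where
  "gelfand_topology X B =
     subtopology (product_topology (\<lambda>_. euclidean) B) (max_ideal_space X B)"

definition point_eval :: "('a \<Rightarrow> complex) set \<Rightarrow> 'a \<Rightarrow> ('a \<Rightarrow> complex) \<Rightarrow> complex" where
  "point_eval B x = (\<lambda>f\<in>B. f x)"

definition M_ideal ::
    "('a \<Rightarrow> complex) set \<Rightarrow> (('a \<Rightarrow> complex) \<Rightarrow> complex) \<Rightarrow> ('a \<Rightarrow> complex) set" where
  "M_ideal B \<phi> = {f \<in> B. \<phi> f = 0}"

definition J_ideal ::
    "'a topology \<Rightarrow> ('a \<Rightarrow> complex) set \<Rightarrow> (('a \<Rightarrow> complex) \<Rightarrow> complex) \<Rightarrow> ('a \<Rightarrow> complex) set" where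
  "J_ideal X B \<phi> =
     {f \<in> B. \<exists>U. openin (gelfand_topology X B) U \<and> \<phi> \<in> U \<and> (\<forall>\<psi>\<in>U. \<psi> f = 0)}"

definition strongly_regular_at :: "'a topology \<Rightarrow> ('a \<Rightarrow> complex) set \<Rightarrow> 'a \<Rightarrow> bool" where
  "strongly_regular_at X B x \<longleftrightarrow>
     M_ideal B (point_eval B x) \<subseteq> C_topology X closure_of J_ideal X B (point_eval B x)"

definition strongly_regular :: "'a topology \<Rightarrow> ('a \<Rightarrow> complex) set \<Rightarrow> bool" where
  "strongly_regular X B \<longleftrightarrow> (\<forall>x\<in>topspace X. strongly_regular_at X B x)"

definition bounded_relative_units_at :: "'a topology \<Rightarrow> ('a \<Rightarrow> complex) set \<Rightarrow> 'a \<Rightarrow> bool" where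
  "bounded_relative_units_at X B x \<longleftrightarrow>
     (\<exists>C>0. \<forall>K. compactin X K \<and> K \<subseteq> topspace X - {x} \<longrightarrow>
        (\<exists>f\<in>J_ideal X B (point_eval B x). (\<forall>y\<in>K. f y = 1) \<and> sup_norm X f \<le> C))"

definition point_derivation ::
    "'a topology \<Rightarrow> ('a \<Rightarrow> complex) set \<Rightarrow> (('a \<Rightarrow> complex) \<Rightarrow> complex) \<Rightarrow>
     (('a \<Rightarrow> complex) \<Rightarrow> complex) \<Rightarrow> bool" where
  "point_derivation X B \<phi> \<psi> \<longleftrightarrow> linear_functional X B \<psi> \<and>
     (\<forall>f\<in>B. \<forall>g\<in>B. \<psi> (\<lambda>x\<in>topspace X. f x * g x) = \<psi> f * \<phi> g + \<phi> f * \<psi> g)"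

definition bounded_point_derivation ::
    "'a topology \<Rightarrow> ('a \<Rightarrow> complex) set \<Rightarrow> (('a \<Rightarrow> complex) \<Rightarrow> complex) \<Rightarrow>
     (('a \<Rightarrow> complex) \<Rightarrow> complex) \<Rightarrow> bool" where
  "bounded_point_derivation X B \<phi> \<psi> \<longleftrightarrow> point_derivation X B \<phi> \<psi> \<and>
     continuous_map (subtopology (C_topology X) B) euclidean \<psi>"

text \<open>The supremum is over a bounded set for bounded functionals, such as differences of
  elements of the maximal ideal space.\<close>

definition dual_norm ::
    "'a topology \<Rightarrow> ('a \<Rightarrow> complex) set \<Rightarrow> (('a \<Rightarrow> complex) \<Rightarrow> complex) \<Rightarrow> real" where
  "dual_norm X B \<psi> = (SUP f\<in>{f \<in> B. sup_norm X f \<le> 1}. cmod (\<psi> f))"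

definition gleason_rel ::
    "'a topology \<Rightarrow> ('a \<Rightarrow> complex) set \<Rightarrow>
     ((('a \<Rightarrow> complex) \<Rightarrow> complex) \<times> (('a \<Rightarrow> complex) \<Rightarrow> complex)) set" where
  "gleason_rel X B =
     {(\<phi>, \<psi>). \<phi> \<in> max_ideal_space X B \<and> \<psi> \<in> max_ideal_space X B \<and>
               dual_norm X B (\<lambda>f. \<phi> f - \<psi> f) < 2}"

definition gleason_parts ::
    "'a topology \<Rightarrow> ('a \<Rightarrow> complex) set \<Rightarrow> (('a \<Rightarrow> complex) \<Rightarrow> complex) set set" where
  "gleason_parts X B = max_ideal_space X B // gleason_rel X B"

text \<open>Every compact metrizable space embeds in the Hilbert cube, hence is homeomorphic to some
  topology whose carrier consists of complex sequences. Existence of a compact metrizable space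
  may therefore be stated over the following type.\<close>

type_synonym seq_space = "(nat \<Rightarrow> complex) topology"

end

theory Submission
  imports Defs "HOL-Complex_Analysis.Residue_Theorem"
begin

text \<open>
  The algebra is a one-step root extension of a planar algebra of Swiss cheese type. Let \<open>F\<close> be
  \<open>n\<close> points near \<open>0\<close>. From a disc \<open>{\<bar>z\<bar> \<le> 3}\<close> remove, for countably many
  circles \<open>\<bar>z - c\<bar> = r\<close>, small neighbourhoods of \<open>N\<close> equidistant points, and let \<open>A\<close> be
  generated on the remaining compact set \<open>K\<close> by \<open>z\<close> and the functions
  \<open>1 / (1 - ((z - c)/r)^N)\<close>, which are nearly \<open>1\<close> inside and nearly \<open>0\<close> outside the circle.
  Infinite products of these, as in Koerner's construction of McKissick's algebra, yield for each
  of countably many annuli a function in \<open>A\<close> that is exactly \<open>1\<close> inside and exactly \<open>0\<close> outside.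
  Annuli shrinking to the points of \<open>F\<close> fast enough make \<open>A\<close> strongly regular at \<open>F\<close>. If the
  removed discs have small total size relative to their distance from \<open>F\<close>, Cauchy's formula still
  gives \<open>\<bar>f x - f y\<bar> \<le> \<parallel>f\<parallel>\<close> for \<open>x, y \<in> F\<close>, so \<open>F\<close> lies in a single Gleason part.

  Now adjoin to \<open>A\<close> an \<open>N\<close>-th root of \<open>h\<close>, for every \<open>N\<close> and every \<open>h\<close> in a countable family
  of functions in \<open>A\<close> that vanish near \<open>F\<close> and are \<open>1\<close> near a point off \<open>F\<close>. Points of \<open>F\<close> have
  one preimage, and averaging over the roots carries the estimate at \<open>F\<close> over to the extension. Off
  \<open>F\<close>, the roots give functions of norm at most \<open>1 + \<epsilon>\<close> that are \<open>1\<close> near a point and vanish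
  outside a given neighbourhood: this gives bounded relative units and one-point Gleason parts there.
\<close>

section \<open>The algebra generated by a set of functions and its uniform closure\<close>

text \<open>Two demands compete. Evaluations at points of \<open>F\<close> must stay at dual
  distance below 2, which rules out bumps of norm arbitrarily close to 1 separating them; everywhere
  else exactly such bumps are wanted. Hence only functions vanishing near \<open>F\<close> receive
  roots. Three facts make the planar part work. The \<open>N\<close> discs covering the holes on a
  circle of radius \<open>r\<close> have radius \<open>8 * \<delta> * r / N\<close>, so their radii
  sum to a quantity free of \<open>N\<close>, and \<open>N\<close> may be as large as the infinite
  products require. The bound \<open>C\<close> of a cutoff depends on the relative hole size only
  and is unchanged by rescaling: at a point \<open>x\<close> of \<open>F\<close> the scale
  \<open>s\<close> is chosen after \<open>C\<close>, with \<open>s * C\<close> small, and then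
  \<open>z - x\<close> is uniformly close to a function vanishing near \<open>x\<close>, however
  large \<open>C\<close> is. Finally, Cauchy's formula asks only for radii that are summably small
  relative to their distance from \<open>F\<close>, a condition that is scale invariant too. The
  covering discs may overlap, so they are merged before integrating along their boundaries. Strong
  regularity also disposes of bounded point derivations, since a derivation kills functions
  vanishing near its point.\<close>

inductive_set alg :: "('a \<Rightarrow> complex) set \<Rightarrow> ('a \<Rightarrow> complex) set" for G where
  const: "(\<lambda>_. c) \<in> alg G"
| add: "f \<in> alg G \<Longrightarrow> g \<in> alg G \<Longrightarrow> (\<lambda>x. f x + g x) \<in> alg G"
| gen_mult: "s \<in> G \<Longrightarrow> f \<in> alg G \<Longrightarrow> (\<lambda>x. s x * f x) \<in> alg G"

lemma alg_cmult: "f \<in> alg G \<Longrightarrow> (\<lambda>x. c * f x) \<in> alg G"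
proof (induction rule: alg.induct)
  case (const d)
  show ?case by (rule alg.const)
next
  case (add f g)
  then show ?case by (auto simp: distrib_left intro: alg.add)
next
  case (gen_mult s f)
  then show ?case using alg.gen_mult[of s G "\<lambda>x. c * f x"] by (simp add: mult.left_commute)
qed

text \<open>The rule \<open>gen_mult\<close> multiplies by one generator at a time and still yields
  all products. The one-sided rule lets inductions peel off a single generator, which
  \<open>average_step\<close> needs to count the powers of one coordinate.\<close>

lemma alg_mult: "f \<in> alg G \<Longrightarrow> g \<in> alg G \<Longrightarrow> (\<lambda>x. f x * g x) \<in> alg G"
proof (induction rule: alg.induct)
  case (const d)
  then show ?case by (rule alg_cmult)
next
  case (add f1 f2)
  then show ?case by (auto simp: distrib_right intro: alg.add)
next
  case (gen_mult s f)
  then show ?case using alg.gen_mult[of s G "\<lambda>x. f x * g x"] by (simp add: mult.assoc)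
qed

lemma alg_gen: "s \<in> G \<Longrightarrow> s \<in> alg G"
  using alg.gen_mult[OF _ alg.const[of 1]] by fastforce

lemma alg_power: "f \<in> alg G \<Longrightarrow> (\<lambda>x. f x ^ k) \<in> alg G"
  by (induction k) (auto intro: alg.const alg_mult)

lemma alg_sum: "(\<And>i. i \<in> I \<Longrightarrow> f i \<in> alg G) \<Longrightarrow> (\<lambda>x. \<Sum>i\<in>I. f i x) \<in> alg G"
  by (induction I rule: infinite_finite_induct) (auto intro: alg.const alg.add)

lemma alg_prod: "(\<And>i. i \<in> I \<Longrightarrow> f i \<in> alg G) \<Longrightarrow> (\<lambda>x. \<Prod>i\<in>I. f i x) \<in> alg G"
  by (induction I rule: infinite_finite_induct) (auto intro: alg.const alg_mult)

lemma alg_mono: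
  assumes "G \<subseteq> H"
  shows "alg G \<subseteq> alg H"
proof
  fix f assume "f \<in> alg G"
  then show "f \<in> alg H"
    using assms by (induction rule: alg.induct) (auto intro: alg.intros)
qed

lemma alg_finite_gens:
  assumes "f \<in> alg G"
  shows "\<exists>G'. finite G' \<and> G' \<subseteq> G \<and> f \<in> alg G'"
  using assms
proof (induction rule: alg.induct)
  case (const c)
  then show ?case by (intro exI[of _ "{}"]) (auto intro: alg.const)
next
  case (add f g)
  then obtain G1 G2 where "finite G1" "G1 \<subseteq> G" "f \<in> alg G1" "finite G2" "G2 \<subseteq> G" "g \<in> alg G2"
    by blast
  then show ?case
    using alg_mono[of G1 "G1 \<union> G2"] alg_mono[of G2 "G1 \<union> G2"]
    by (intro exI[of _ "G1 \<union> G2"]) (auto intro!: alg.add)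
next
  case (gen_mult s f)
  then obtain G1 where "finite G1" "G1 \<subseteq> G" "f \<in> alg G1" by blast
  then show ?case
    using gen_mult.hyps alg_mono[of G1 "insert s G1"]
    by (intro exI[of _ "insert s G1"]) (auto intro!: alg.gen_mult)
qed

lemma alg_compose:
  assumes "f \<in> alg G"
  shows "(\<lambda>x. f (T x)) \<in> alg ((\<lambda>g x. g (T x)) ` G)"
  using assms by (induction rule: alg.induct) (auto intro: alg.intros)

lemma alg_continuous_on:
  assumes "f \<in> alg G" and "\<And>s. s \<in> G \<Longrightarrow> continuous_on S s"
  shows "continuous_on S f"
  using assms by (induction rule: alg.induct) (auto intro: continuous_intros)

text \<open>Bounds on the generators, rather than compactness, are what products need; the cutoffs
  for a normalised annulus are built on arbitrary sets.\<close>

definition bounded_gens :: "'a set \<Rightarrow> ('a \<Rightarrow> complex) set \<Rightarrow> bool" where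
  "bounded_gens S G \<longleftrightarrow> (\<forall>s\<in>G. \<exists>C. \<forall>x\<in>S. cmod (s x) \<le> C)"

lemma alg_bounded:
  assumes "f \<in> alg G" "bounded_gens S G"
  shows "\<exists>C>0. \<forall>x\<in>S. cmod (f x) \<le> C"
  using assms(1)
proof (induction rule: alg.induct)
  case (const c)
  show ?case by (intro exI[of _ "cmod c + 1"]) (auto simp: add_nonneg_pos)
next
  case (add f g)
  then obtain C D where "C > 0" "D > 0" "\<forall>x\<in>S. cmod (f x) \<le> C" "\<forall>x\<in>S. cmod (g x) \<le> D" by blast
  then show ?case by (intro exI[of _ "C + D"]) (auto intro: norm_triangle_mono)
next
  case (gen_mult s f)
  then obtain C D where *: "C > 0" "\<forall>x\<in>S. cmod (f x) \<le> C" "\<forall>x\<in>S. cmod (s x) \<le> D"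
    using assms(2) unfolding bounded_gens_def by blast
  then have "cmod (s x * f x) \<le> (\<bar>D\<bar> + 1) * C" if "x \<in> S" for x
    using that unfolding norm_mult by (intro mult_mono) force+
  then show ?case
    using * by (intro exI[of _ "(\<bar>D\<bar> + 1) * C"]) (auto intro: mult_pos_pos)
qed

text \<open>Values outside \<open>S\<close> are left free, so functions can be combined without
  restricting them; extensionality enters only with the final algebra \<open>B\<close>.\<close>

definition ualg :: "'a set \<Rightarrow> ('a \<Rightarrow> complex) set \<Rightarrow> ('a \<Rightarrow> complex) set" where
  "ualg S G = {f. \<forall>e>0. \<exists>g\<in>alg G. \<forall>x\<in>S. cmod (f x - g x) < e}"

lemma ualgI: "(\<And>e. e > 0 \<Longrightarrow> \<exists>g\<in>alg G. \<forall>x\<in>S. cmod (f x - g x) < e) \<Longrightarrow> f \<in> ualg S G"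
  unfolding ualg_def by blast

lemma ualgD: "f \<in> ualg S G \<Longrightarrow> e > 0 \<Longrightarrow> \<exists>g\<in>alg G. \<forall>x\<in>S. cmod (f x - g x) < e"
  unfolding ualg_def by blast

lemma alg_imp_ualg: "f \<in> alg G \<Longrightarrow> f \<in> ualg S G"
  by (rule ualgI) force

lemma ualg_const: "(\<lambda>_. c) \<in> ualg S G"
  by (intro alg_imp_ualg alg.const)

lemma ualg_gen: "s \<in> G \<Longrightarrow> s \<in> ualg S G"
  by (intro alg_imp_ualg alg_gen)

lemma ualg_cong:
  assumes "f \<in> ualg S G" "\<And>x. x \<in> S \<Longrightarrow> f x = g x"
  shows "g \<in> ualg S G"
  using assms unfolding ualg_def by simp

lemma ualg_closed:
  assumes "\<And>e. e > 0 \<Longrightarrow> \<exists>g\<in>ualg S G. \<forall>x\<in>S. cmod (f x - g x) < e"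
  shows "f \<in> ualg S G"
proof (rule ualgI)
  fix e :: real assume "e > 0"
  then obtain g where g: "g \<in> ualg S G" "\<forall>x\<in>S. cmod (f x - g x) < e / 2"
    using assms[of "e / 2"] by auto
  obtain h where h: "h \<in> alg G" "\<forall>x\<in>S. cmod (g x - h x) < e / 2"
    using ualgD[OF g(1), of "e / 2"] \<open>e > 0\<close> by auto
  have "cmod (f x - h x) < e" if "x \<in> S" for x
    using norm_diff_triangle_less[of "f x" "g x" "e / 2" "h x" "e / 2"] g(2) h(2) that by simp
  then show "\<exists>g\<in>alg G. \<forall>x\<in>S. cmod (f x - g x) < e"
    using h(1) by blast
qed

lemma ualg_limit:
  assumes "\<And>k. f k \<in> ualg S G" "uniform_limit S f l sequentially"
  shows "l \<in> ualg S G"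
proof (rule ualg_closed)
  fix e :: real assume "e > 0"
  then obtain k where "\<forall>x\<in>S. dist (f k x) (l x) < e"
    using uniform_limitD[OF assms(2)] eventually_happens' sequentially_bot by blast
  then show "\<exists>g\<in>ualg S G. \<forall>x\<in>S. cmod (l x - g x) < e"
    by (intro bexI[of _ "f k"] assms(1)) (simp add: dist_norm norm_minus_commute)
qed

lemma ualg_mono:
  assumes "G \<subseteq> H"
  shows "ualg S G \<subseteq> ualg S H"
  using alg_mono[OF assms] unfolding ualg_def by blast

lemma ualg_add:
  assumes "f \<in> ualg S G" "g \<in> ualg S G"
  shows "(\<lambda>x. f x + g x) \<in> ualg S G"
proof (rule ualgI)
  fix e :: real assume "e > 0"
  then obtain f' g' where *: "f' \<in> alg G" "\<forall>x\<in>S. cmod (f x - f' x) < e / 2"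
     "g' \<in> alg G" "\<forall>x\<in>S. cmod (g x - g' x) < e / 2"
    using ualgD[OF assms(1), of "e / 2"] ualgD[OF assms(2), of "e / 2"] by auto
  have "cmod ((f x + g x) - (f' x + g' x)) < e" if "x \<in> S" for x
    using norm_diff_triangle_ineq[of "f x" "g x" "f' x" "g' x"] *(2,4) that by fastforce
  then show "\<exists>h\<in>alg G. \<forall>x\<in>S. cmod (f x + g x - h x) < e"
    by (intro bexI[OF _ alg.add[OF *(1,3)]]) auto
qed

lemma ualg_bounded:
  assumes "f \<in> ualg S G" "bounded_gens S G"
  shows "\<exists>C>0. \<forall>x\<in>S. cmod (f x) \<le> C"
proof -
  obtain g where g: "g \<in> alg G" "\<forall>x\<in>S. cmod (f x - g x) < 1"
    using ualgD[OF assms(1), of 1] by auto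
  obtain C where C: "C > 0" "\<forall>x\<in>S. cmod (g x) \<le> C"
    using alg_bounded[OF g(1) assms(2)] by blast
  have "cmod (f x) \<le> C + 1" if "x \<in> S" for x
    using norm_triangle_ineq[of "f x - g x" "g x"] g(2) C(2) that by fastforce
  then show ?thesis using C(1) by (intro exI[of _ "C + 1"]) auto
qed

lemma ualg_mult:
  assumes "f \<in> ualg S G" "g \<in> ualg S G" "bounded_gens S G"
  shows "(\<lambda>x. f x * g x) \<in> ualg S G"
proof (rule ualgI)
  fix e :: real assume "e > 0"
  obtain C where C: "C > 0" "\<forall>x\<in>S. cmod (f x) \<le> C" using ualg_bounded[OF assms(1,3)] by blast
  obtain g' where g': "g' \<in> alg G" "\<forall>x\<in>S. cmod (g x - g' x) < e / (2 * C)"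
    using ualgD[OF assms(2), of "e / (2 * C)"] \<open>e > 0\<close> C by auto
  obtain D where D: "D > 0" "\<forall>x\<in>S. cmod (g' x) \<le> D" using alg_bounded[OF g'(1) assms(3)] by blast
  obtain f' where f': "f' \<in> alg G" "\<forall>x\<in>S. cmod (f x - f' x) < e / (2 * D)"
    using ualgD[OF assms(1), of "e / (2 * D)"] \<open>e > 0\<close> D by auto
  have "cmod (f x * g x - f' x * g' x) < e" if "x \<in> S" for x
  proof -
    have "f x * g x - f' x * g' x = f x * (g x - g' x) + (f x - f' x) * g' x"
      by (simp add: algebra_simps)
    then have "cmod (f x * g x - f' x * g' x) \<le> cmod (f x) * cmod (g x - g' x) + cmod (f x - f' x) * cmod (g' x)"
      by (metis norm_mult norm_triangle_ineq)
    also have "cmod (f x) * cmod (g x - g' x) \<le> C * cmod (g x - g' x)"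
      using C that by (intro mult_right_mono) auto
    also have "cmod (f x - f' x) * cmod (g' x) \<le> cmod (f x - f' x) * D"
      using D that by (intro mult_left_mono) auto
    also have "C * cmod (g x - g' x) < C * (e / (2 * C))"
      using C(1) g'(2) that by (intro mult_strict_left_mono) auto
    also have "cmod (f x - f' x) * D < (e / (2 * D)) * D"
      using D(1) f'(2) that by (intro mult_strict_right_mono) auto
    finally show ?thesis using C(1) D(1) by (simp add: field_simps)
  qed
  then show "\<exists>h\<in>alg G. \<forall>x\<in>S. cmod (f x * g x - h x) < e"
    by (intro bexI[OF _ alg_mult[OF f'(1) g'(1)]]) auto
qed

lemma ualg_cmult: "f \<in> ualg S G \<Longrightarrow> bounded_gens S G \<Longrightarrow> (\<lambda>x. c * f x) \<in> ualg S G"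
  by (rule ualg_mult[OF ualg_const])

lemma ualg_diff:
  assumes "f \<in> ualg S G" "g \<in> ualg S G" "bounded_gens S G"
  shows "(\<lambda>x. f x - g x) \<in> ualg S G"
  using ualg_add[OF assms(1) ualg_cmult[OF assms(2,3), of "- 1"]] by simp

lemma ualg_power: "f \<in> ualg S G \<Longrightarrow> bounded_gens S G \<Longrightarrow> (\<lambda>x. f x ^ k) \<in> ualg S G"
  by (induction k) (auto intro: ualg_const ualg_mult)

lemma ualg_sum: "(\<And>i. i \<in> I \<Longrightarrow> f i \<in> ualg S G) \<Longrightarrow> (\<lambda>x. \<Sum>i\<in>I. f i x) \<in> ualg S G"
  by (induction I rule: infinite_finite_induct) (auto intro: ualg_const ualg_add)

lemma ualg_prod:
  "(\<And>i. i \<in> I \<Longrightarrow> f i \<in> ualg S G) \<Longrightarrow> bounded_gens S G \<Longrightarrow> (\<lambda>x. \<Prod>i\<in>I. f i x) \<in> ualg S G"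
  by (induction I rule: infinite_finite_induct) (auto intro: ualg_const ualg_mult)

lemma ualg_continuous_on:
  assumes "f \<in> ualg S G" and "\<And>s. s \<in> G \<Longrightarrow> continuous_on S s"
  shows "continuous_on S f"
proof -
  have "\<exists>g\<in>alg G. \<forall>x\<in>S. cmod (f x - g x) < 1 / Suc k" for k
    by (rule ualgD[OF assms(1)]) simp
  then obtain g where g: "\<And>k. g k \<in> alg G" "\<And>k x. x \<in> S \<Longrightarrow> cmod (f x - g k x) < 1 / Suc k"
    by metis
  have "uniform_limit S g f sequentially"
  proof (rule uniform_limitI)
    fix e :: real assume "e > 0"
    then obtain N where "1 / Suc N < e" using nat_approx_posE by metis
    then have "\<forall>x\<in>S. dist (g k x) (f x) < e" if "k \<ge> N" for k
    proof -
      have "1 / real (Suc k) \<le> 1 / Suc N" using that by (simp add: frac_le)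
      then show ?thesis
        using g(2)[of _ k] \<open>1 / Suc N < e\<close> by (force simp: dist_norm norm_minus_commute)
    qed
    then show "\<forall>\<^sub>F k in sequentially. \<forall>x\<in>S. dist (g k x) (f x) < e"
      unfolding eventually_sequentially by blast
  qed
  then show ?thesis by (rule uniform_limit_theorem[rotated])
       (auto intro!: always_eventually alg_continuous_on[OF g(1) assms(2)])
qed

text \<open>Transports a cutoff for the normalised annulus to an annulus of any centre and
  scale.\<close>

lemma ualg_compose:
  assumes "f \<in> ualg (T ` S) G"
  shows "(\<lambda>x. f (T x)) \<in> ualg S ((\<lambda>g x. g (T x)) ` G)"
proof (rule ualgI)
  fix e :: real assume "e > 0"
  then obtain g where "g \<in> alg G" "\<forall>x\<in>T ` S. cmod (f x - g x) < e"
    using ualgD[OF assms] by blast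
  then show "\<exists>g\<in>alg ((\<lambda>g x. g (T x)) ` G). \<forall>x\<in>S. cmod (f (T x) - g x) < e"
    using alg_compose by (intro bexI[of _ "\<lambda>x. g (T x)"]) auto
qed

text \<open>Neumann series: the partial sums of powers of \<open>f\<close> converge uniformly by the
  Weierstrass test.\<close>

lemma ualg_inverse_one_minus:
  assumes f: "f \<in> ualg S G" and bg: "bounded_gens S G"
    and q: "q < 1" "\<And>x. x \<in> S \<Longrightarrow> cmod (f x) \<le> q"
  shows "(\<lambda>x. inverse (1 - f x)) \<in> ualg S G"
proof (rule ualg_limit)
  show "(\<lambda>x. \<Sum>i<k. f x ^ i) \<in> ualg S G" for k
    by (intro ualg_sum ualg_power f bg)
  have "uniform_limit S (\<lambda>n x. \<Sum>i<n. f x ^ i) (\<lambda>x. suminf (\<lambda>i. f x ^ i)) sequentially"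
  proof (cases "S = {}")
    case False
    then have "0 \<le> q" using q(2) norm_ge_zero order_trans by blast
    then show ?thesis
      using q by (intro Weierstrass_m_test[where M = "\<lambda>i. q ^ i"])
         (auto simp: norm_power intro!: power_mono summable_geometric)
  qed auto
  then show "uniform_limit S (\<lambda>k x. \<Sum>i<k. f x ^ i) (\<lambda>x. inverse (1 - f x)) sequentially"
    by (rule uniform_limit_cong'[THEN iffD1, rotated 2])
       (use q in \<open>force simp: suminf_geometric inverse_eq_divide order_le_less_trans\<close>)+
qed

section \<open>Merging discs and the variation of a holomorphic function outside small discs\<close>

text \<open>Write \<open>u ^ N = exp s\<close> with \<open>cmod s < 2 * \<delta>\<close> and put
  \<open>t = s / N\<close>. Then \<open>\<xi> = u / exp t\<close> is a root of unity and
  \<open>u - \<xi> = \<xi> * (exp t - 1)\<close> has modulus at most \<open>3 * cmod t\<close>. The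
  division by \<open>N\<close> is the point: the \<open>N\<close> discs covering
  \<open>cmod (1 - u ^ N) < \<delta>\<close> have total radius \<open>8 * \<delta>\<close> for every
  \<open>N\<close>.\<close>

lemma near_root_of_unity:
  fixes u :: complex
  assumes "N \<ge> 1" "\<delta> \<le> 1/2" "cmod (1 - u ^ N) < \<delta>"
  obtains \<xi> where "\<xi> ^ N = 1" "cmod (u - \<xi>) < 8 * \<delta> / N"
proof -
  have d: "\<delta> > 0" using assms(3) norm_ge_zero[of "1 - u ^ N"] by linarith
  have nz: "u \<noteq> 0"
    using assms by (auto simp: power_0_left split: if_splits)
  define s where "s = Ln (u ^ N)"
  have s: "exp s = u ^ N" unfolding s_def using nz by simp
  have "cmod (u ^ N - 1) < \<delta>" using assms(3) by (simp add: norm_minus_commute)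
  then have "cmod s \<le> 2 * cmod (u ^ N - 1)"
    using norm_Ln_le[of "u ^ N - 1"] assms(2) unfolding s_def by simp
  then have sle: "cmod s < 2 * \<delta>" using \<open>cmod (u ^ N - 1) < \<delta>\<close> by linarith
  define t where "t = s / of_nat N"
  have tN: "cmod t = cmod s / N" unfolding t_def by (simp add: norm_divide)
  also have "\<dots> \<le> cmod s / 1" using assms(1) by (intro divide_left_mono) auto
  finally have t1: "cmod t \<le> 1" using sle assms(2) by linarith
  define \<xi> where "\<xi> = u / exp t"
  have "exp t ^ N = exp s" unfolding t_def using assms(1)
    by (metis exp_divide_power_eq not_one_le_zero zero_less_iff_neq_zero)
  then have "\<xi> ^ N = 1" unfolding \<xi>_def using s nz by (simp add: power_divide)
  then have "cmod \<xi> = 1" using assms(1) by (metis norm_one norm_power norm_ge_zero power_eq_1_iff not_one_le_zero)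
  have "u - \<xi> = \<xi> * (exp t - 1)" unfolding \<xi>_def by (simp add: field_simps)
  then have "cmod (u - \<xi>) = cmod (exp t - 1)" using \<open>cmod \<xi> = 1\<close> by (simp add: norm_mult)
  also have "\<dots> \<le> exp (cmod t) * cmod t"
    using Taylor_exp[of t 0] abs_Re_le_cmod[of t]
    by (simp add: order_trans[OF _ mult_right_mono])
  also have "exp (cmod t) \<le> 3"
    using t1 exp_le exp_le_cancel_iff[of "cmod t" 1] by linarith
  finally have "cmod (u - \<xi>) \<le> 3 * cmod t" by (simp add: mult_right_mono)
  also have "\<dots> \<le> 3 * (2 * \<delta> / N)"
    using sle tN assms(1) by (intro mult_left_mono) (auto intro: divide_right_mono)
  also have "\<dots> < 8 * \<delta> / N" using d assms(1) by (simp add: divide_simps)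
  finally show ?thesis using that \<open>\<xi> ^ N = 1\<close> by blast
qed

lemma merge_two_cballs:
  fixes p q :: "'a::real_normed_vector"
  assumes "A > 0" "B > 0" "cball p A \<inter> cball q B \<noteq> {}"
  shows "\<exists>c. cball p A \<union> cball q B \<subseteq> cball c (A + B)"
proof -
  obtain z where z: "dist p z \<le> A" "dist q z \<le> B" using assms(3) by auto
  have pq: "norm (q - p) \<le> A + B"
    using dist_triangle[of p q z] z by (simp add: dist_norm norm_minus_commute)
  \<comment> \<open>This centre is at most \<open>B\<close> away from \<open>p\<close> and at most
    \<open>A\<close> away from \<open>q\<close>.\<close>
  define c where "c = p + (B / (A + B)) *\<^sub>R (q - p)"
  have "dist c p = B / (A + B) * norm (q - p)"
    unfolding c_def dist_norm using assms by simp
  also have "\<dots> \<le> B / (A + B) * (A + B)"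
    using pq assms by (intro mult_left_mono) auto
  finally have 1: "dist c p \<le> B" using assms by simp
  have "q - c = (1 - B / (A + B)) *\<^sub>R (q - p)"
    unfolding c_def by (simp add: algebra_simps)
  also have "1 - B / (A + B) = A / (A + B)" using assms by (simp add: field_simps)
  finally have "dist q c = A / (A + B) * norm (q - p)"
    unfolding dist_norm using assms by simp
  also have "\<dots> \<le> A / (A + B) * (A + B)"
    using pq assms by (intro mult_left_mono) auto
  finally have 2: "dist c q \<le> A" using assms by (simp add: dist_commute)
  have "cball p A \<union> cball q B \<subseteq> cball c (A + B)"
  proof
    fix z assume "z \<in> cball p A \<union> cball q B"
    then show "z \<in> cball c (A + B)"
      using 1 2 dist_triangle[of c z p] dist_triangle[of c z q] by auto
  qed
  then show ?thesis ..
qed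

text \<open>Among the partitions whose blocks fit into a disc of radius the sum of the radii in the block,
  one with fewest blocks has disjoint discs, as two intersecting discs could be merged.\<close>

lemma merge_cballs:
  fixes a :: "'i \<Rightarrow> 'a::real_normed_vector" and \<rho> :: "'i \<Rightarrow> real"
  assumes "finite I" "\<And>i. i \<in> I \<Longrightarrow> \<rho> i > 0"
  obtains P p where "partition_on I P"
    "\<And>S. S \<in> P \<Longrightarrow> (\<Union>i\<in>S. cball (a i) (\<rho> i)) \<subseteq> cball (p S) (sum \<rho> S)"
    "\<And>S T. S \<in> P \<Longrightarrow> T \<in> P \<Longrightarrow> S \<noteq> T \<Longrightarrow> cball (p S) (sum \<rho> S) \<inter> cball (p T) (sum \<rho> T) = {}"
proof -
  define good where "good P \<longleftrightarrow> partition_on I P \<and>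
    (\<forall>S\<in>P. \<exists>c. (\<Union>i\<in>S. cball (a i) (\<rho> i)) \<subseteq> cball c (sum \<rho> S))" for P
  have "good ((\<lambda>i. {i}) ` I)"
    unfolding good_def using partition_on_singletons by auto
  then obtain P where P: "good P" and least: "\<And>Q. good Q \<Longrightarrow> card P \<le> card Q"
    using ex_has_least_nat[of good _ card] by blast
  have part: "partition_on I P" using P good_def by blast
  have finP: "finite P" using finite_elements[OF assms(1) part] .
  have finS: "finite S" if "S \<in> P" for S
    using partition_onD1[OF part] that assms(1) by (meson Union_upper finite_subset)
  have pos: "sum \<rho> S > 0" if "S \<in> P" for S
    using partition_onD1[OF part] partition_onD3[OF part] that assms(2) finS
    by (intro sum_pos) auto
  obtain p where p: "\<And>S. S \<in> P \<Longrightarrow> (\<Union>i\<in>S. cball (a i) (\<rho> i)) \<subseteq> cball (p S) (sum \<rho> S)"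
    using P unfolding good_def by metis
  have disj: "cball (p S) (sum \<rho> S) \<inter> cball (p T) (sum \<rho> T) = {}" if ST: "S \<in> P" "T \<in> P" "S \<noteq> T" for S T
  proof (rule ccontr)
    assume "cball (p S) (sum \<rho> S) \<inter> cball (p T) (sum \<rho> T) \<noteq> {}"
    then obtain c where c: "cball (p S) (sum \<rho> S) \<union> cball (p T) (sum \<rho> T) \<subseteq> cball c (sum \<rho> S + sum \<rho> T)"
      using merge_two_cballs[OF pos[OF ST(1)] pos[OF ST(2)]] by blast
    have dST: "S \<inter> T = {}"
      using partition_onD2[OF part] ST by (auto simp: pairwise_def disjnt_def)
    then have sumST: "sum \<rho> (S \<union> T) = sum \<rho> S + sum \<rho> T"
      using finS ST by (intro sum.union_disjoint) auto
    let ?Q = "insert (S \<union> T) (P - {S, T})"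
    have nin: "S \<union> T \<notin> P - {S, T}"
    proof
      assume st: "S \<union> T \<in> P - {S, T}"
      then have "disjnt (S \<union> T) S"
        using pairwiseD(1)[OF partition_onD2[OF part], of "S \<union> T" S] ST(1) by simp
      then have "S = {}" by (auto simp: disjnt_def)
      then show False using ST partition_onD3[OF part] by blast
    qed
    have "partition_on I ?Q"
    proof (rule partition_onI)
      show "\<Union> ?Q = I" using partition_onD1[OF part] ST by auto
      show "disjnt X Y" if XY: "X \<in> ?Q" "Y \<in> ?Q" "X \<noteq> Y" for X Y
      proof -
        have *: "disjnt X Y" if "X \<in> P" "Y \<in> P" "X \<noteq> Y" for X Y
          using pairwiseD(1)[OF partition_onD2[OF part] that] .
        have **: "disjnt (S \<union> T) Y" if "Y \<in> P - {S, T}" for Y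
          using that ST *[of S Y] *[of T Y] unfolding disjnt_Un1 by blast
        consider "X = S \<union> T" "Y \<in> P - {S, T}" | "Y = S \<union> T" "X \<in> P - {S, T}" | "X \<in> P" "Y \<in> P"
          using XY by blast
        then show ?thesis
        proof cases
          case 1
          then show ?thesis using ** by blast
        next
          case 2
          then show ?thesis using ** disjnt_sym by blast
        next
          case 3
          then show ?thesis using * \<open>X \<noteq> Y\<close> by blast
        qed
      qed
      show "{} \<notin> ?Q" using partition_onD3[OF part] ST by auto
    qed
    moreover have "\<exists>c. (\<Union>i\<in>X. cball (a i) (\<rho> i)) \<subseteq> cball c (sum \<rho> X)" if "X \<in> ?Q" for X
    proof (cases "X = S \<union> T")
      case True
      then show ?thesis using c p[OF ST(1)] p[OF ST(2)] sumST
        by (intro exI[of _ c]) (simp add: UN_Un, blast)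
    next
      case False
      then show ?thesis using that p by blast
    qed
    ultimately have "good ?Q" unfolding good_def by blast
    then have "card P \<le> card ?Q" by (rule least)
    also have "\<dots> = Suc (card (P - {S, T}))" using nin finP by simp
    also have "card (P - {S, T}) = card P - 2"
      using ST finP by (subst card_Diff_subset) auto
    finally have "card P \<le> Suc (card P - 2)" .
    moreover have "card {S, T} \<le> card P" using ST finP by (intro card_mono) auto
    ultimately show False using ST(3) by simp
  qed
  show ?thesis using that[OF part p disj] .
qed

text \<open>Closed intervals of total length below \<open>b - a\<close> cannot cover
  \<open>{a..b}\<close>. Applied to the radial shadows of the merged discs, it supplies an outer
  circle that misses them.\<close>

lemma radius_avoiding_intervals:
  fixes l u :: "'i \<Rightarrow> real"
  assumes "finite P" "\<And>S. S \<in> P \<Longrightarrow> l S \<le> u S" "(\<Sum>S\<in>P. u S - l S) < b - a"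
  shows "\<exists>R\<in>{a..b}. \<forall>S\<in>P. R < l S \<or> u S < R"
proof (rule ccontr)
  assume neg: "\<not> ?thesis"
  have sub: "{a..b} \<subseteq> (\<Union>S\<in>P. {l S..u S})"
  proof
    fix R assume "R \<in> {a..b}"
    then obtain S where "S \<in> P" "\<not> (R < l S \<or> u S < R)" using neg by blast
    then show "R \<in> (\<Union>S\<in>P. {l S..u S})" by (auto simp: not_less)
  qed
  have "0 \<le> (\<Sum>S\<in>P. u S - l S)" by (intro sum_nonneg) (simp add: assms(2))
  then have ab: "a \<le> b" using assms(3) by linarith
  have "measure lborel {a..b} \<le> measure lborel (\<Union>S\<in>P. {l S..u S})"
    by (intro measure_mono_fmeasurable[OF sub] fmeasurable_compact compact_UN assms(1)) auto
  also have "\<dots> \<le> (\<Sum>S\<in>P. measure lborel {l S..u S})"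
    by (intro measure_UNION_le assms(1)) auto
  also have "\<dots> = (\<Sum>S\<in>P. u S - l S)" by (intro sum.cong) (simp_all add: assms(2))
  finally show False using assms(3) ab by simp
qed

text \<open>The winding number is 1 inside the circle and 0 outside, so the residue theorem can be
  read off for each circle separately.\<close>

lemma circle_integral_residues:
  fixes f :: "complex \<Rightarrow> complex"
  assumes Q: "finite Q" and f: "f holomorphic_on UNIV - Q" and r: "r > 0"
    and off: "Q \<inter> sphere c r = {}"
  shows "(f has_contour_integral 2 * pi * \<i> * (\<Sum>q\<in>Q \<inter> ball c r. residue f q)) (circlepath c r)"
proof -
  have im: "path_image (circlepath c r) \<subseteq> UNIV - Q" using off r by auto
  have "f contour_integrable_on circlepath c r"
    using im by (intro contour_integrable_continuous_circlepath)
      (meson f holomorphic_on_imp_continuous_on continuous_on_subset)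
  moreover have "contour_integral (circlepath c r) f =
      2 * pi * \<i> * (\<Sum>q\<in>Q. winding_number (circlepath c r) q * residue f q)"
    using Residue_theorem[of UNIV Q f "circlepath c r"] Q f im connected_UNIV by simp
  moreover have "(\<Sum>q\<in>Q. winding_number (circlepath c r) q * residue f q) = (\<Sum>q\<in>Q \<inter> ball c r. residue f q)"
  proof -
    have "winding_number (circlepath c r) q = (if q \<in> ball c r then 1 else 0)" if "q \<in> Q" for q
    proof (cases "q \<in> ball c r")
      case True
      then show ?thesis by (simp add: winding_number_circlepath dist_norm norm_minus_commute)
    next
      case False
      then have "q \<notin> cball c r" using off that by auto
      then have "winding_number (circlepath c r) q = 0"
        by (intro winding_number_zero_outside[of _ "cball c r"]) (use r in \<open>auto simp: valid_path_imp_path\<close>)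
      then show ?thesis using False by simp
    qed
    then have "(\<Sum>q\<in>Q. winding_number (circlepath c r) q * residue f q) =
       (\<Sum>q\<in>Q. if q \<in> ball c r then residue f q else 0)"
      by (intro sum.cong) auto
    then show ?thesis using Q by (simp add: sum.inter_restrict)
  qed
  ultimately show ?thesis by (metis has_contour_integral_integral)
qed

text \<open>Cauchy's formula writes \<open>2 * pi * \<i> * f w\<close> as an integral over an outer
  circle minus integrals over the boundaries of the merged discs inside it. For \<open>w = x\<close>
  and \<open>w = y\<close> the outer integrals differ by at most \<open>pi * M\<close>, and for each
  of the two points the disc integrals contribute at most \<open>pi * M / 2\<close>; together this
  is \<open>2 * pi * M\<close>. Merging makes the boundary circles avoid all the original open
  discs, so that \<open>M\<close> bounds \<open>f\<close> on them.\<close>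

lemma holomorphic_variation_bound:
  fixes a :: "'i \<Rightarrow> complex" and \<rho> e :: "'i \<Rightarrow> real"
  assumes I: "finite I" and \<rho>: "\<And>i. i \<in> I \<Longrightarrow> 0 < \<rho> i" "\<And>i. i \<in> I \<Longrightarrow> \<rho> i \<le> e i"
    and e: "sum e I \<le> 1/8"
    and near: "\<And>i w. i \<in> I \<Longrightarrow> w \<in> {x, y} \<Longrightarrow> \<rho> i \<le> e i * cmod (a i - w)"
    and xy: "cmod x \<le> 1/4" "cmod y \<le> 1/4"
    and f: "f holomorphic_on UNIV - a ` I"
    and M: "\<And>z. cmod z \<le> 3 \<Longrightarrow> (\<And>i. i \<in> I \<Longrightarrow> z \<notin> ball (a i) (\<rho> i)) \<Longrightarrow> cmod (f z) \<le> M"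
  shows "cmod (f x - f y) \<le> M"
proof -
  obtain P p where part: "partition_on I P"
    and cov: "\<And>S. S \<in> P \<Longrightarrow> (\<Union>i\<in>S. cball (a i) (\<rho> i)) \<subseteq> cball (p S) (sum \<rho> S)"
    and disj: "\<And>S T. S \<in> P \<Longrightarrow> T \<in> P \<Longrightarrow> S \<noteq> T \<Longrightarrow> cball (p S) (sum \<rho> S) \<inter> cball (p T) (sum \<rho> T) = {}"
    by (rule merge_cballs[of I \<rho> a]) (use I \<rho>(1) in auto)
  define rad where "rad S = sum \<rho> S" for S
  note cov = cov[folded rad_def] and disj = disj[folded rad_def]
  have finP: "finite P" using finite_elements[OF I part] .
  have subI: "S \<subseteq> I" if "S \<in> P" for S
    using partition_onD1[OF part] that by blast
  have finS: "finite S" if "S \<in> P" for S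
    using subI[OF that] I finite_subset by blast
  have e0: "0 \<le> e i" if "i \<in> I" for i using \<rho>[OF that] by linarith
  have pos: "rad S > 0" if "S \<in> P" for S
    using subI[OF that] partition_onD3[OF part] that \<rho>(1) finS[OF that] unfolding rad_def
    by (intro sum_pos) auto
  have eS: "0 \<le> sum e S" "sum e S \<le> 1/8" if "S \<in> P" for S
    using sum_mono2[OF I subI[OF that], of e] e0 e subI[OF that] by (auto intro!: sum_nonneg)
  have sumP: "(\<Sum>S\<in>P. sum h S) = sum h I" for h :: "'i \<Rightarrow> real"
    using partition_onD1[OF part] partition_onD2[OF part] finS
      sum.Union_disjoint[of P h] by (simp add: pairwise_def disjnt_def)
  have "(\<Sum>S\<in>P. (cmod (p S) + rad S) - (cmod (p S) - rad S)) = 2 * sum \<rho> I"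
    using sumP[of "\<lambda>i. 2 * \<rho> i"] unfolding rad_def by (simp add: sum_distrib_left sum.distrib flip: mult_2)
  also have "sum \<rho> I \<le> sum e I" by (intro sum_mono \<rho>(2))
  finally have sum1: "(\<Sum>S\<in>P. (cmod (p S) + rad S) - (cmod (p S) - rad S)) < 3 - 2"
    using e by simp
  have le: "cmod (p S) - rad S \<le> cmod (p S) + rad S" if "S \<in> P" for S
    using pos[OF that] by linarith
  \<comment> \<open>The radial shadows have total length \<open>2 * sum \<rho> I\<close>, at most
    1/4, so some radius in the interval from 2 to 3 meets none of them.\<close>
  obtain R where R: "2 \<le> R" "R \<le> 3"
    and Roff: "\<And>S. S \<in> P \<Longrightarrow> R < cmod (p S) - rad S \<or> cmod (p S) + rad S < R"
    using radius_avoiding_intervals[OF finP le sum1] by (metis atLeastAtMost_iff)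
  \<comment> \<open>The hypothesis \<open>near\<close> survives merging: summed over the block it
    gives \<open>rad S \<le> sum e S * (2 * rad S + cmod (z - w))\<close>, and since
    \<open>sum e S \<le> 1/8\<close> the term with \<open>rad S\<close> is absorbed on the
    left.\<close>
  have key: "rad S \<le> 2 * sum e S * cmod (z - w)"
    if S: "S \<in> P" and z: "z \<in> cball (p S) (rad S)" and w: "w \<in> {x, y}" for S z w
  proof -
    have "\<rho> i \<le> e i * (2 * rad S + cmod (z - w))" if "i \<in> S" for i
    proof -
      have "i \<in> I" using subI[OF S] that by blast
      have "a i \<in> cball (p S) (rad S)" using cov[OF S] that \<rho>(1)[OF \<open>i \<in> I\<close>] by force
      then have "dist (a i) z \<le> 2 * rad S"
        using z dist_triangle[of "a i" z "p S"] by (auto simp: dist_commute)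
      then have "cmod (a i - w) \<le> 2 * rad S + cmod (z - w)"
        using norm_triangle_ineq[of "a i - z" "z - w"] by (simp add: dist_norm)
      then have "e i * cmod (a i - w) \<le> e i * (2 * rad S + cmod (z - w))"
        using e0[OF \<open>i \<in> I\<close>] by (rule mult_left_mono)
      then show ?thesis using near[OF \<open>i \<in> I\<close> w] by linarith
    qed
    then have "rad S \<le> sum e S * (2 * rad S + cmod (z - w))"
      unfolding sum_distrib_right rad_def by (intro sum_mono) auto
    moreover have "sum e S * (2 * rad S) \<le> 1/8 * (2 * rad S)"
      using eS[OF S] pos[OF S] by (intro mult_right_mono) auto
    ultimately have "3/4 * rad S \<le> sum e S * cmod (z - w)" by (simp add: distrib_left)
    moreover have "0 \<le> sum e S * cmod (z - w)" using eS[OF S] by simp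
    ultimately show ?thesis by linarith
  qed
  have wout: "w \<notin> cball (p S) (rad S)" if "S \<in> P" "w \<in> {x, y}" for S w
    using key[OF that(1) _ that(2), of w] pos[OF that(1)] by auto
  have bsub: "ball (a i) (\<rho> i) \<subseteq> ball (p S) (rad S)" if "S \<in> P" "i \<in> S" for S i
    using interior_mono[of "cball (a i) (\<rho> i)" "cball (p S) (rad S)"] cov[OF that(1)] that(2)
    by (auto simp: interior_cball)
  have ain: "a i \<in> ball (p S) (rad S)" if "S \<in> P" "i \<in> S" for S i
    using bsub[OF that] \<rho>(1) subI that by (meson centre_in_ball subsetD)
  have exS: "\<exists>S\<in>P. i \<in> S" if "i \<in> I" for i using partition_onD1[OF part] that by blast
  \<comment> \<open>The merged discs inside the circle of radius \<open>R\<close>; all the others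
    lie entirely outside it.\<close>
  define P' where "P' = {S \<in> P. cmod (p S) + rad S < R}"
  have P'P: "P' \<subseteq> P" "finite P'" using finP unfolding P'_def by auto
  have in_small: "cmod z < R" if "S \<in> P'" "z \<in> cball (p S) (rad S)" for S z
    using that norm_triangle_ineq[of "p S" "z - p S"] unfolding P'_def
    by (auto simp: dist_norm norm_minus_commute)
  have out_big: "R < cmod z" if "S \<in> P" "S \<notin> P'" "z \<in> cball (p S) (rad S)" for S z
    using that Roff[OF that(1)] norm_triangle_ineq[of "z" "p S - z"] unfolding P'_def
    by (auto simp: dist_norm norm_minus_commute)
  have sphere_R: "z \<notin> cball (p S) (rad S)" if "cmod z = R" "S \<in> P" for z S
    using in_small[of S z] out_big[of S z] that by (cases "S \<in> P'") auto
  have M_outer: "cmod (f z) \<le> M" if "cmod z = R" for z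
  proof (rule M)
    show "cmod z \<le> 3" using that R by simp
    show "z \<notin> ball (a i) (\<rho> i)" if "i \<in> I" for i
      using exS[OF that] bsub sphere_R[OF \<open>cmod z = R\<close>] ball_subset_cball by blast
  qed
  have M_inner: "cmod (f z) \<le> M" if S: "S \<in> P'" and z: "cmod (z - p S) = rad S" for S z
  proof (rule M)
    have zS: "z \<in> cball (p S) (rad S)" "z \<notin> ball (p S) (rad S)"
      using z by (auto simp: dist_norm norm_minus_commute)
    show "cmod z \<le> 3" using in_small[OF S zS(1)] R by simp
    show "z \<notin> ball (a i) (\<rho> i)" if i: "i \<in> I" for i
    proof -
      obtain T where T: "T \<in> P" "i \<in> T" using exS[OF i] by blast
      show ?thesis
      proof (cases "T = S")
        case True
        then show ?thesis using bsub[OF T] zS by blast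
      next
        case False
        then have "z \<notin> cball (p T) (rad T)" using disj[of S T] S P'P T zS by blast
        then show ?thesis using bsub[OF T] ball_subset_cball by blast
      qed
    qed
  qed
  have M0: "0 \<le> M" using M_outer[of "of_real R"] R norm_ge_zero[of "f (of_real R)"] by (simp del: norm_ge_zero)
  have opn: "open (UNIV - a ` I)" using I by (intro open_Diff finite_imp_closed) auto
  have formula: "\<exists>O' J. ((\<lambda>z. f z / (z - w)) has_contour_integral O') (circlepath 0 R) \<and>
      (\<forall>S\<in>P'. cmod (J S) \<le> 4 * pi * M * sum e S) \<and> 2 * pi * \<i> * f w = O' - (\<Sum>S\<in>P'. J S)"
    if w: "w \<in> {x, y}" for w
  proof -
    let ?g = "\<lambda>z. f z / (z - w)"
    let ?Q = "insert w (a ` I)"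
    have wQ: "w \<notin> a ` I"
    proof
      assume "w \<in> a ` I"
      then obtain i where "i \<in> I" "a i = w" by blast
      then show False using near[OF \<open>i \<in> I\<close> w] \<rho>(1)[OF \<open>i \<in> I\<close>] by simp
    qed
    have g: "?g holomorphic_on UNIV - ?Q"
      by (intro holomorphic_intros holomorphic_on_subset[OF f]) auto
    have resw: "residue ?g w = f w" using wQ by (intro residue_simple[OF opn _ f]) auto
    have wR: "cmod w < R" using w xy R by auto
    have off0: "?Q \<inter> sphere 0 R = {}"
      using wR exS ain sphere_R ball_subset_cball by fastforce
    have "?Q \<inter> ball 0 R = insert w (\<Union>S\<in>P'. ?Q \<inter> ball (p S) (rad S))" (is "?A = ?B")
    proof
      show "?A \<subseteq> ?B"
      proof
        fix q assume q: "q \<in> ?A"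
        show "q \<in> ?B"
        proof (cases "q = w")
          case False
          then obtain i where i: "i \<in> I" "q = a i" using q by blast
          then obtain S where S: "S \<in> P" "i \<in> S" using exS by blast
          have "S \<in> P'" using out_big[OF S(1), of q] ain[OF S] i q by force
          then show ?thesis using ain[OF S] i by blast
        qed auto
      qed
      show "?B \<subseteq> ?A" using in_small wR ball_subset_cball by fastforce
    qed
    moreover have "w \<notin> (\<Union>S\<in>P'. ?Q \<inter> ball (p S) (rad S))"
      using wout[OF _ w] P'P ball_subset_cball by blast
    moreover have "(\<Sum>q\<in>(\<Union>S\<in>P'. ?Q \<inter> ball (p S) (rad S)). residue ?g q) =
        (\<Sum>S\<in>P'. \<Sum>q\<in>?Q \<inter> ball (p S) (rad S). residue ?g q)"
    proof (rule sum.UNION_disjoint)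
      show "\<forall>S\<in>P'. \<forall>T\<in>P'. S \<noteq> T \<longrightarrow> ?Q \<inter> ball (p S) (rad S) \<inter> (?Q \<inter> ball (p T) (rad T)) = {}"
        using disj P'P ball_subset_cball by blast
    qed (use I P'P in auto)
    ultimately have res: "(\<Sum>q\<in>?Q \<inter> ball 0 R. residue ?g q) =
        f w + (\<Sum>S\<in>P'. \<Sum>q\<in>?Q \<inter> ball (p S) (rad S). residue ?g q)"
      using I P'P resw by simp
    define O' where "O' = 2 * pi * \<i> * (\<Sum>q\<in>?Q \<inter> ball 0 R. residue ?g q)"
    define J where "J S = 2 * pi * \<i> * (\<Sum>q\<in>?Q \<inter> ball (p S) (rad S). residue ?g q)" for S
    have O: "(?g has_contour_integral O') (circlepath 0 R)"
      unfolding O'_def using R I by (intro circle_integral_residues g off0) auto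
    have "cmod (J S) \<le> 4 * pi * M * sum e S" if S: "S \<in> P'" for S
    proof -
      have SP: "S \<in> P" using S P'P by blast
      have offS: "?Q \<inter> sphere (p S) (rad S) = {}"
      proof -
        have "w \<notin> sphere (p S) (rad S)" using wout[OF SP w] sphere_cball by blast
        moreover have "a i \<notin> sphere (p S) (rad S)" if i: "i \<in> I" for i
        proof -
          obtain T where T: "T \<in> P" "i \<in> T" using exS[OF i] by blast
          show ?thesis
          proof (cases "T = S")
            case True
            then show ?thesis using ain[OF T] by auto
          next
            case False
            then show ?thesis using ain[OF T] disj[OF T(1) SP] ball_subset_cball sphere_cball by blast
          qed
        qed
        ultimately show ?thesis by blast
      qed
      have "(?g has_contour_integral J S) (circlepath (p S) (rad S))"
        unfolding J_def using I by (intro circle_integral_residues g offS pos SP) auto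
      \<comment> \<open>On this circle \<open>key\<close> bounds \<open>1 / cmod (z - w)\<close> by
        \<open>2 * sum e S / rad S\<close>; the radius cancels against the length of the
        circle.\<close>
      then have "cmod (J S) \<le> (M * (2 * sum e S / rad S)) * (2 * pi * rad S)"
      proof (rule has_contour_integral_bound_circlepath)
        show "0 \<le> M * (2 * sum e S / rad S)" using M0 eS[OF SP] pos[OF SP] by simp
        show "0 < rad S" by (rule pos[OF SP])
        show "cmod (f z / (z - w)) \<le> M * (2 * sum e S / rad S)" if z: "cmod (z - p S) = rad S" for z
        proof -
          have "rad S \<le> 2 * sum e S * cmod (z - w)"
            using z by (intro key[OF SP _ w]) (simp add: dist_norm norm_minus_commute)
          moreover have "cmod (z - w) > 0" using wout[OF SP w] z by (auto simp: dist_norm norm_minus_commute)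
          ultimately have "1 / cmod (z - w) \<le> 2 * sum e S / rad S"
            using pos[OF SP] by (simp add: field_simps)
          then have "cmod (f z) * (1 / cmod (z - w)) \<le> M * (2 * sum e S / rad S)"
            using M_inner[OF S z] M0 by (intro mult_mono) auto
          then show ?thesis by (simp add: norm_divide)
        qed
      qed
      also have "\<dots> = 4 * pi * M * sum e S" using pos[OF SP] by (simp add: field_simps)
      finally show ?thesis .
    qed
    moreover have "2 * pi * \<i> * f w = O' - (\<Sum>S\<in>P'. J S)"
      unfolding O'_def J_def res by (simp add: algebra_simps sum_distrib_left)
    ultimately show ?thesis using O by blast
  qed
  obtain O1 J1 where 1: "((\<lambda>z. f z / (z - x)) has_contour_integral O1) (circlepath 0 R)"
      "\<forall>S\<in>P'. cmod (J1 S) \<le> 4 * pi * M * sum e S" "2 * pi * \<i> * f x = O1 - (\<Sum>S\<in>P'. J1 S)"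
    using formula[of x] by blast
  obtain O2 J2 where 2: "((\<lambda>z. f z / (z - y)) has_contour_integral O2) (circlepath 0 R)"
      "\<forall>S\<in>P'. cmod (J2 S) \<le> 4 * pi * M * sum e S" "2 * pi * \<i> * f y = O2 - (\<Sum>S\<in>P'. J2 S)"
    using formula[of y] by blast
  have J: "cmod (\<Sum>S\<in>P'. J S) \<le> pi * M / 2" if "\<forall>S\<in>P'. cmod (J S) \<le> 4 * pi * M * sum e S" for J
  proof -
    have "cmod (\<Sum>S\<in>P'. J S) \<le> (\<Sum>S\<in>P'. 4 * pi * M * sum e S)"
      using that by (intro sum_norm_le) auto
    also have "\<dots> \<le> (\<Sum>S\<in>P. 4 * pi * M * sum e S)"
      using P'P finP eS M0 by (intro sum_mono2) auto
    also have "\<dots> = 4 * pi * M * sum e I" using sumP[of e] by (simp flip: sum_distrib_left)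
    also have "\<dots> \<le> 4 * pi * M * (1/8)" using e M0 by (intro mult_left_mono) auto
    finally show ?thesis by (simp add: mult.commute)
  qed
  \<comment> \<open>The two Cauchy kernels differ by \<open>(x - y) / ((z - x) * (z - y))\<close>.
    Here \<open>cmod (x - y) \<le> 1/2\<close>, and the denominator has modulus at least
    \<open>(R - 1/4) * (R - 1/4)\<close>, hence at least \<open>R\<close> because
    \<open>R \<ge> 2\<close>.\<close>
  have "cmod (O1 - O2) \<le> (M / (2 * R)) * (2 * pi * R)"
  proof (rule has_contour_integral_bound_circlepath[OF has_contour_integral_diff[OF 1(1) 2(1)]])
    show "0 \<le> M / (2 * R)" "0 < R" using M0 R by auto
    fix z assume "cmod (z - 0) = R"
    then have z: "cmod z = R" by simp
    have zx: "cmod (z - x) \<ge> R - 1/4" "cmod (z - y) \<ge> R - 1/4"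
      using xy z norm_triangle_ineq2[of z x] norm_triangle_ineq2[of z y] by linarith+
    then have nz: "z - x \<noteq> 0" "z - y \<noteq> 0" using R by auto
    have "f z / (z - x) - f z / (z - y) = f z * (x - y) / ((z - x) * (z - y))"
      using nz by (simp add: divide_simps) (simp add: algebra_simps)
    then have eq: "cmod (f z / (z - x) - f z / (z - y)) = cmod (f z) * cmod (x - y) / (cmod (z - x) * cmod (z - y))"
      by (simp add: norm_mult norm_divide)
    have "cmod (x - y) \<le> 1/2" using xy norm_triangle_ineq4[of x y] by linarith
    then have n: "cmod (f z) * cmod (x - y) \<le> M * (1/2)"
      using M_outer[OF z] M0 by (intro mult_mono) auto
    have "2 * R \<le> R * R" using R by (intro mult_right_mono) auto
    moreover have "(R - 1/4) * (R - 1/4) = R * R - R / 2 + 1 / 16" by (simp add: algebra_simps)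
    ultimately have "R \<le> (R - 1/4) * (R - 1/4)" using R by linarith
    also have "\<dots> \<le> cmod (z - x) * cmod (z - y)" using zx R by (intro mult_mono) auto
    finally have d: "R \<le> cmod (z - x) * cmod (z - y)" .
    have "cmod (f z) * cmod (x - y) / (cmod (z - x) * cmod (z - y)) \<le> (M * (1/2)) / R"
      using n d R M0 by (intro frac_le) auto
    then show "cmod (f z / (z - x) - f z / (z - y)) \<le> M / (2 * R)" unfolding eq by simp
  qed
  then have O: "cmod (O1 - O2) \<le> pi * M" using R by (simp add: field_simps)
  have "2 * pi * \<i> * (f x - f y) = (O1 - O2) - ((\<Sum>S\<in>P'. J1 S) - (\<Sum>S\<in>P'. J2 S))"
    using 1(3) 2(3) by (simp add: algebra_simps)
  then have "cmod (2 * pi * \<i> * (f x - f y)) \<le> cmod (O1 - O2) + (cmod (\<Sum>S\<in>P'. J1 S) + cmod (\<Sum>S\<in>P'. J2 S))"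
    by (metis add_left_mono norm_triangle_ineq4 order_trans)
  also have "\<dots> \<le> pi * M + (pi * M / 2 + pi * M / 2)"
    using O J[OF 1(2)] J[OF 2(2)] by linarith
  finally have "2 * pi * cmod (f x - f y) \<le> 2 * pi * M" by (simp add: norm_mult)
  then show ?thesis by simp
qed

section \<open>Cutoff functions for an annulus\<close>

text \<open>The increments of the partial products are uniformly summable. Where
  \<open>\<phi> (Suc k)\<close> is close to 1 the product hardly changes; elsewhere, by
  \<open>cover\<close>, the earlier factor \<open>\<phi> k\<close> has already made it tiny. The
  tolerance \<open>\<tau> k\<close> has to beat the product of the bounds \<open>D\<close> up to
  index \<open>Suc k\<close>, since both cases compare it with the other factors.\<close>

lemma uniform_infinite_product:
  fixes \<phi> :: "nat \<Rightarrow> 'a \<Rightarrow> complex" and D \<tau> :: "nat \<Rightarrow> real"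
  assumes D: "\<And>k. D k \<ge> 1" "\<And>k x. x \<in> S \<Longrightarrow> cmod (\<phi> k x) \<le> D k"
    and \<tau>: "\<And>k. 0 \<le> \<tau> k" "\<And>k. 2 * \<tau> k * (\<Prod>i\<le>Suc k. D i) \<le> \<theta> / 2 ^ k"
    and inner: "\<And>k x. x \<in> S \<Longrightarrow> x \<in> I k \<Longrightarrow> cmod (\<phi> k x - 1) \<le> \<tau> k"
    and outer: "\<And>k x. x \<in> S \<Longrightarrow> x \<in> E k \<Longrightarrow> cmod (\<phi> k x) \<le> \<tau> k"
    and cover: "\<And>k x. x \<in> S \<Longrightarrow> x \<in> I (Suc k) \<or> x \<in> E k"
  shows "\<exists>F. uniform_limit S (\<lambda>k x. \<Prod>i<k. \<phi> i x) F sequentially \<and>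
    (\<forall>x\<in>S. (\<forall>k. x \<in> E k) \<longrightarrow> F x = 0) \<and> (\<forall>x\<in>S. x \<in> I 0 \<longrightarrow> cmod (F x - 1) \<le> 4 * \<theta>) \<and>
    (\<forall>x\<in>S. cmod (F x) \<le> 2 + D 0 + 4 * \<theta>)"
proof -
  define f where "f k x = (\<Prod>i<k. \<phi> i x)" for k x
  define P where "P k = (\<Prod>i<k. D i)" for k
  have P1: "1 \<le> P k" for k unfolding P_def by (intro prod_ge_1 D)
  have Pm: "P k \<le> P (Suc k)" for k
    using mult_left_mono[OF D(1)[of k], of "P k"] P1[of k] unfolding P_def by simp
  have fP: "cmod (f k x) \<le> P k" if "x \<in> S" for k x
    unfolding f_def P_def prod_norm[symmetric]
    by (intro prod_mono) (auto simp: D(2)[OF that])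
  have \<tau>P: "2 * \<tau> k * P (Suc (Suc k)) \<le> \<theta> / 2 ^ k" for k
    using \<tau>(2)[of k] unfolding P_def by (simp only: lessThan_Suc_atMost)
  have \<tau>P': "2 * (\<tau> k * P k) \<le> \<theta> / 2 ^ k" for k
  proof -
    have "\<tau> k * P k \<le> \<tau> k * P (Suc (Suc k))"
      using Pm[of k] Pm[of "Suc k"] \<tau>(1)[of k] by (intro mult_left_mono) auto
    then show ?thesis using \<tau>P[of k] by simp
  qed
  have \<theta>0: "0 \<le> \<theta>"
  proof -
    have "0 \<le> 2 * (\<tau> 0 * P 0)" using \<tau>(1)[of 0] P1[of 0] by simp
    also have "\<dots> \<le> \<theta>" using \<tau>P'[of 0] by simp
    finally show ?thesis .
  qed
  define M where "M k = 2 * \<theta> * (1 / 2) ^ k" for k :: nat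
  define g where "g k x = f (Suc k) x - f k x" for k x
  have geq: "g k x = f k x * (\<phi> k x - 1)" for k x
    unfolding g_def f_def by (simp add: algebra_simps)
  have gI: "cmod (g k x) \<le> M k" if x: "x \<in> S" "x \<in> I k" for k x
  proof -
    have "cmod (g k x) \<le> P k * \<tau> k"
      unfolding geq norm_mult using fP[OF x(1), of k] inner[OF x] P1[of k] by (intro mult_mono) auto
    also have "\<dots> \<le> 2 * (\<tau> k * P k)" using P1[of k] \<tau>(1)[of k] by (simp add: mult.commute)
    also have "\<dots> \<le> \<theta> / 2 ^ k" by (rule \<tau>P')
    also have "\<dots> \<le> M k" unfolding M_def using \<theta>0 by (simp add: field_simps)
    finally show ?thesis .
  qed
  have gS: "cmod (g (Suc k) x) \<le> M (Suc k)" if x: "x \<in> S" for k x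
  proof (cases "x \<in> I (Suc k)")
    case False
    then have xE: "x \<in> E k" using cover[OF x] by blast
    have "cmod (\<phi> (Suc k) x - 1) \<le> 2 * D (Suc k)"
      using norm_triangle_ineq4[of "\<phi> (Suc k) x" 1] D(2)[OF x, of "Suc k"] D(1)[of "Suc k"] by simp
    moreover have "cmod (f (Suc k) x) \<le> P k * \<tau> k"
      using fP[OF x, of k] outer[OF x xE] P1[of k] unfolding f_def
      by (simp add: norm_mult mult_mono)
    ultimately have "cmod (g (Suc k) x) \<le> (P k * \<tau> k) * (2 * D (Suc k))"
      unfolding geq norm_mult using P1[of k] \<tau>(1)[of k] by (intro mult_mono) auto
    also have "\<dots> = 2 * \<tau> k * (P k * D (Suc k))" by simp
    also have "\<dots> \<le> 2 * \<tau> k * P (Suc (Suc k))"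
    proof (intro mult_left_mono)
      show "P k * D (Suc k) \<le> P (Suc (Suc k))"
        using mult_right_mono[OF Pm[of k], of "D (Suc k)"] D(1)[of "Suc k"] unfolding P_def by simp
    qed (use \<tau> in auto)
    also have "\<dots> \<le> \<theta> / 2 ^ k" by (rule \<tau>P)
    also have "\<dots> = M (Suc k)" unfolding M_def by (simp add: field_simps)
    finally show ?thesis .
  qed (use gI x in blast)
  \<comment> \<open>The factor of index 0 has no predecessor to make the product small, so its
    increment gets only a crude bound, which becomes the extra term in \<open>M'\<close>.\<close>
  have g0: "cmod (g 0 x) \<le> D 0 + 1" if x: "x \<in> S" for x
    using norm_triangle_ineq4[of "\<phi> 0 x" 1] D(2)[OF x, of 0] unfolding g_def f_def by simp
  define M' where "M' k = M k + (if k = 0 then D 0 + 1 else 0)" for k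
  have M: "M sums (4 * \<theta>)"
    using sums_mult[OF geometric_sums[of "1/2 :: real"], of "2 * \<theta>"] unfolding M_def by simp
  have M': "M' sums (4 * \<theta> + (D 0 + 1))"
    unfolding M'_def using sums_add[OF M sums_single[of 0 "\<lambda>_. D 0 + 1"]] by simp
  have M0: "0 \<le> M k" for k unfolding M_def using \<theta>0 by simp
  have gM': "cmod (g k x) \<le> M' k" if "x \<in> S" for k x
    using g0[OF that] gS[OF that] M0[of k] unfolding M'_def by (cases k) (auto intro: add_increasing)
  define F where "F x = 1 + (\<Sum>k. g k x)" for x
  have summ: "summable (\<lambda>k. g k x)" if "x \<in> S" for x
    by (rule summable_comparison_test'[OF sums_summable[OF M'], of 0]) (rule gM'[OF that])
  have tele: "f k x = 1 + (\<Sum>i<k. g i x)" for k x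
    unfolding g_def by (subst sum_lessThan_telescope) (simp add: f_def)
  have "uniform_limit S (\<lambda>k x. \<Sum>i<k. g i x) (\<lambda>x. \<Sum>i. g i x) sequentially"
    using gM' sums_summable[OF M'] by (intro Weierstrass_m_test) auto
  then have lim: "uniform_limit S f F sequentially"
    unfolding F_def[abs_def] tele[abs_def] by (intro uniform_limit_intros)
  show ?thesis
  proof (intro exI[of _ F] conjI ballI impI)
    show "uniform_limit S (\<lambda>k x. \<Prod>i<k. \<phi> i x) F sequentially"
      using lim unfolding f_def[abs_def] .
    show "F x = 0" if x: "x \<in> S" "\<forall>k. x \<in> E k" for x
    proof -
      have "cmod (f (Suc k) x) \<le> \<theta> * (1 / 2) ^ k" for k
      proof -
        have "cmod (f (Suc k) x) \<le> P k * \<tau> k"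
          using fP[OF x(1), of k] outer[OF x(1), of k] x(2) P1[of k] unfolding f_def
          by (simp add: norm_mult mult_mono)
        also have "\<dots> \<le> 2 * (\<tau> k * P k)" using P1[of k] \<tau>(1)[of k] by (simp add: mult.commute)
        also have "\<dots> \<le> \<theta> / 2 ^ k" by (rule \<tau>P')
        finally show ?thesis by (simp add: field_simps)
      qed
      then have ev: "\<forall>\<^sub>F k in sequentially. cmod (f (Suc k) x) \<le> \<theta> * (1 / 2) ^ k"
        by (intro always_eventually allI)
      have "(\<lambda>k. \<theta> * (1 / 2) ^ k) \<longlonglongrightarrow> 0"
        using tendsto_mult_left[OF LIMSEQ_power_zero[of "1/2 :: real"], of \<theta>] by simp
      then have "(\<lambda>k. f (Suc k) x) \<longlonglongrightarrow> 0"
        by (rule Lim_null_comparison[OF ev])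
      moreover have "(\<lambda>k. f (Suc k) x) \<longlonglongrightarrow> F x"
        using tendsto_uniform_limitI[OF lim x(1)] by (rule LIMSEQ_Suc)
      ultimately show ?thesis using LIMSEQ_unique by blast
    qed
    show "cmod (F x - 1) \<le> 4 * \<theta>" if x: "x \<in> S" "x \<in> I 0" for x
    proof -
      have "cmod (g k x) \<le> M k" for k using gI[OF x(1)] x(2) gS[OF x(1)] by (cases k) auto
      then have "cmod (\<Sum>k. g k x) \<le> (\<Sum>k. M k)"
        using sums_summable[OF M] by (intro norm_suminf_le)
      then show ?thesis unfolding F_def using sums_unique[OF M] by simp
    qed
    show "cmod (F x) \<le> 2 + D 0 + 4 * \<theta>" if x: "x \<in> S" for x
    proof -
      have "cmod (\<Sum>k. g k x) \<le> (\<Sum>k. M' k)"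
        using gM'[OF x] sums_summable[OF M'] by (intro norm_suminf_le)
      then show ?thesis unfolding F_def using sums_unique[OF M']
        norm_triangle_ineq[of 1 "\<Sum>k. g k x"] by simp
    qed
  qed
qed

definition circle_fun :: "complex \<Rightarrow> real \<Rightarrow> nat \<Rightarrow> complex \<Rightarrow> complex" where
  "circle_fun c r N z = inverse (1 - ((z - c) / of_real r) ^ N)"

text \<open>The powers \<open>(w / r) ^ N\<close> tend to 0 uniformly on
  \<open>cmod w \<le> a\<close> and to infinity uniformly on \<open>cmod w \<ge> b\<close>.\<close>

lemma circle_fun_dichotomy:
  assumes "0 < a" "a < r" "r < b" "0 < \<tau>" "\<tau> \<le> 1"
  shows "\<exists>N\<ge>1. \<forall>w. (cmod w \<le> a \<longrightarrow> cmod (circle_fun 0 r N w - 1) \<le> \<tau>) \<and>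
                    (b \<le> cmod w \<longrightarrow> cmod (circle_fun 0 r N w) \<le> \<tau>)"
proof -
  define q where "q = max (a / r) (r / b)"
  have q: "0 < q" "q < 1" "a / r \<le> q" "r / b \<le> q" using assms unfolding q_def by (auto simp: less_max_iff_disj)
  obtain N where N: "q ^ N < \<tau> / 2"
    using real_arch_pow_inv[of "\<tau> / 2" q] q assms by auto
  have "N \<noteq> 0" using N assms by (intro notI) simp
  have "cmod (circle_fun 0 r N w - 1) \<le> \<tau>" if w: "cmod w \<le> a" for w
  proof -
    define u where "u = (w / of_real r) ^ N"
    have "cmod u = (cmod w / r) ^ N" unfolding u_def using assms by (simp add: norm_power norm_divide)
    also have "\<dots> \<le> q ^ N"
    proof (rule power_mono)
      have "cmod w / r \<le> a / r" using w assms by (simp add: divide_right_mono)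
      then show "cmod w / r \<le> q" using q by linarith
    qed (use assms in auto)
    finally have u: "cmod u \<le> \<tau> / 2" using N by linarith
    then have u1: "cmod (1 - u) \<ge> 1 / 2" using norm_triangle_ineq2[of 1 u] assms by simp
    then have "1 - u \<noteq> 0" by auto
    then have "inverse (1 - u) - 1 = u / (1 - u)" by (simp add: field_simps)
    then have "cmod (inverse (1 - u) - 1) = cmod u / cmod (1 - u)" by (simp add: norm_divide)
    also have "\<dots> \<le> (\<tau> / 2) / (1 / 2)" using u u1 assms by (intro frac_le) auto
    finally show ?thesis unfolding circle_fun_def u_def by simp
  qed
  moreover have "cmod (circle_fun 0 r N w) \<le> \<tau>" if w: "b \<le> cmod w" for w
  proof -
    define u where "u = (w / of_real r) ^ N"
    have "2 / \<tau> \<le> 1 / q ^ N" using N q assms by (simp add: field_simps)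
    also have "\<dots> = (1 / q) ^ N" by (simp add: power_divide)
    also have "\<dots> \<le> (cmod w / r) ^ N"
    proof (rule power_mono)
      have "1 / q \<le> b / r" using q assms by (simp add: field_simps)
      also have "\<dots> \<le> cmod w / r" using w assms by (simp add: divide_right_mono)
      finally show "1 / q \<le> cmod w / r" .
    qed (use q in auto)
    also have "\<dots> = cmod u" unfolding u_def using assms by (simp add: norm_power norm_divide)
    finally have u: "2 / \<tau> \<le> cmod u" .
    have "1 \<le> 1 / \<tau>" using assms by simp
    then have u1: "1 / \<tau> \<le> cmod (1 - u)"
      using u norm_triangle_ineq2[of u 1] by (simp add: norm_minus_commute)
    then have "inverse (cmod (1 - u)) \<le> inverse (1 / \<tau>)"
      using assms by (intro le_imp_inverse_le) auto
    then show ?thesis unfolding circle_fun_def u_def by (simp add: norm_inverse)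
  qed
  ultimately show ?thesis using \<open>N \<noteq> 0\<close> by (intro exI[of _ N]) auto
qed

text \<open>For \<open>True\<close> the radii increase from 7/4 towards 2, for \<open>False\<close>
  they decrease from 5/4 towards 1. The limits are the boundaries beyond which the outward and the
  inward product vanish.\<close>

definition annulus_radius :: "bool \<Rightarrow> nat \<Rightarrow> real" where
  "annulus_radius b k = (if b then 2 - 1 / (4 * 2 ^ k) else 1 + 1 / (4 * 2 ^ k))"

lemma annulus_radius_bounds: "1 \<le> annulus_radius b k" "annulus_radius b k \<le> 2"
proof -
  have "1 / (4 * 2 ^ k :: real) \<le> 1 / 4" by (intro divide_left_mono) auto
  moreover have "0 \<le> 1 / (4 * 2 ^ k :: real)" by simp
  ultimately show "1 \<le> annulus_radius b k" "annulus_radius b k \<le> 2"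
    unfolding annulus_radius_def by (simp_all only: split: if_splits) linarith+
qed

text \<open>The annulus is normalised to radii 1 and 2. The set \<open>S\<close> is quantified after
  \<open>N\<close> and \<open>C\<close> because the compact set of the construction is itself cut
  out with the numbers \<open>N\<close>.\<close>

definition annulus_cutoff :: "(nat \<Rightarrow> real) \<Rightarrow> (bool \<Rightarrow> nat \<Rightarrow> nat) \<Rightarrow> real \<Rightarrow> bool" where
  "annulus_cutoff \<delta> N C \<longleftrightarrow> C > 0 \<and> (\<forall>b k. N b k \<ge> 1) \<and>
     (\<forall>S. (\<forall>w\<in>S. \<forall>b k. \<delta> k \<le> cmod (1 - (w / of_real (annulus_radius b k)) ^ N b k)) \<longrightarrow>
       (\<exists>H \<in> ualg S {circle_fun 0 (annulus_radius b k) (N b k) | b k. True}.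
         \<forall>w\<in>S. cmod (H w) \<le> C \<and> (cmod w \<le> 1 \<longrightarrow> H w = 1) \<and> (2 \<le> cmod w \<longrightarrow> H w = 0)))"

text \<open>Outward and inward products give \<open>f = 0\<close> outside and \<open>g = 0\<close> inside the annulus, with
  \<open>h = (1 - f) (1 - g)\<close> of norm at most \<open>1/2\<close>. Then \<open>1 - h = f + g - f g\<close> is invertible and
  \<open>f (1 - g) / (1 - h)\<close> is the required function. The numbers \<open>N\<close> and \<open>C\<close> depend on \<open>\<delta>\<close> only, so
  that an annulus may be chosen small compared with its bound \<open>C\<close>.\<close>

lemma annulus_cutoff_exists:
  fixes \<delta> :: "nat \<Rightarrow> real"
  assumes \<delta>: "\<And>k. 0 < \<delta> k" "\<And>k. \<delta> k \<le> 1"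
  shows "\<exists>N C. annulus_cutoff \<delta> N C"
proof -
  define r where "r = annulus_radius"
  \<comment> \<open>Bounds both \<open>circle_fun\<close> and 1 minus it where the denominator has
    modulus at least \<open>\<delta> k\<close>.\<close>
  define D where "D k = 1 + 1 / \<delta> k" for k
  have D1: "D k \<ge> 1" for k unfolding D_def using \<delta>(1)[of k] by simp
  \<comment> \<open>Chosen so that \<open>4 * \<theta> * (4 + D 0) = 1/2\<close>, the bound for
    \<open>(1 - f) * (1 - g)\<close> in which one factor is small and the other is at most
    \<open>4 + D 0\<close>.\<close>
  define \<theta> where "\<theta> = 1 / (8 * (4 + D 0))"
  have \<theta>: "0 < \<theta>" "\<theta> \<le> 1 / 4" "4 * \<theta> * (4 + D 0) = 1 / 2"
    unfolding \<theta>_def using D1[of 0] by (simp_all add: field_simps)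
  define \<tau> where "\<tau> k = \<theta> / 2 ^ k / (2 * (\<Prod>i\<le>Suc k. D i))" for k
  have prD: "1 \<le> (\<Prod>i\<le>k. D i)" for k by (intro prod_ge_1 D1)
  have \<tau>0: "0 < \<tau> k" for k unfolding \<tau>_def using \<theta> prD[of "Suc k"] by (intro divide_pos_pos) auto
  have \<tau>2: "2 * \<tau> k * (\<Prod>i\<le>Suc k. D i) = \<theta> / 2 ^ k" for k
  proof -
    have "(\<Prod>i\<le>Suc k. D i) \<noteq> 0" using prD[of "Suc k"] by linarith
    then show ?thesis unfolding \<tau>_def by (simp del: prod.atMost_Suc prod_zero_iff)
  qed
  have \<tau>1: "\<tau> k \<le> 1" for k
  proof -
    have "2 * \<tau> k * 1 \<le> 2 * \<tau> k * (\<Prod>i\<le>Suc k. D i)"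
      using prD[of "Suc k"] \<tau>0[of k] by (intro mult_left_mono) auto
    also have "\<dots> = \<theta> / 2 ^ k" by (rule \<tau>2)
    also have "\<dots> \<le> \<theta> / 1" using \<theta> by (intro divide_left_mono) auto
    finally show ?thesis using \<theta> by simp
  qed
  define mid where "mid b k = (r b k + r b (Suc k)) / 2" for b k
  \<comment> \<open>Midpoints of consecutive radii serve as thresholds, so that two successive
    factors share one and the covering condition of the product lemma holds. The initial values 13/8
    and 11/8 overlap: everywhere at least one of \<open>f\<close>, \<open>g\<close> is near
    1.\<close>
  define lo where "lo b k = (if b then (case k of 0 \<Rightarrow> 13/8 | Suc j \<Rightarrow> mid b j) else mid b k)" for b k
  define hi where "hi b k = (if b then mid b k else (case k of 0 \<Rightarrow> 11/8 | Suc j \<Rightarrow> mid b j))" for b k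
  have mid1: "1 \<le> mid b k" "mid b k \<le> 2" for b k
    using annulus_radius_bounds[of b k] annulus_radius_bounds[of b "Suc k"] unfolding mid_def r_def by auto
  have lohi: "0 < lo b k" "lo b k < r b k" "r b k < hi b k" for b k
    using mid1[of b k] mid1[of b "k - 1"]
    by (auto simp: lo_def hi_def mid_def r_def annulus_radius_def field_simps split: nat.splits
        intro!: add_pos_pos mult_pos_pos)
  have "\<exists>N\<ge>1. \<forall>w. (cmod w \<le> lo b k \<longrightarrow> cmod (circle_fun 0 (r b k) N w - 1) \<le> \<tau> k) \<and>
                    (hi b k \<le> cmod w \<longrightarrow> cmod (circle_fun 0 (r b k) N w) \<le> \<tau> k)" for b k
    by (intro circle_fun_dichotomy lohi \<tau>0 \<tau>1)
  then obtain N where N: "\<And>b k. N b k \<ge> 1"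
     "\<And>b k w. cmod w \<le> lo b k \<Longrightarrow> cmod (circle_fun 0 (r b k) (N b k) w - 1) \<le> \<tau> k"
     "\<And>b k w. hi b k \<le> cmod w \<Longrightarrow> cmod (circle_fun 0 (r b k) (N b k) w) \<le> \<tau> k"
    by metis
  define C where "C = 2 * ((3 + D 0) * (4 + D 0))"
  show ?thesis
    unfolding annulus_cutoff_def
  proof (intro exI[of _ N] exI[of _ C] conjI allI impI)
    show "N b k \<ge> 1" for b k by (rule N)
    show "C > 0" unfolding C_def using D1[of 0] by simp
    fix S assume S': "\<forall>w\<in>S. \<forall>b k. \<delta> k \<le> cmod (1 - (w / of_real (annulus_radius b k)) ^ N b k)"
    then have S: "\<And>w b k. w \<in> S \<Longrightarrow> \<delta> k \<le> cmod (1 - (w / of_real (annulus_radius b k)) ^ N b k)" by blast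
    let ?G = "{circle_fun 0 (annulus_radius b k) (N b k) | b k. True}"
    let ?\<phi> = "\<lambda>b k. circle_fun 0 (r b k) (N b k)"
    have bd: "cmod (?\<phi> b k w) \<le> 1 / \<delta> k" if "w \<in> S" for b k w
    proof -
      have "inverse (cmod (1 - (w / of_real (annulus_radius b k)) ^ N b k)) \<le> inverse (\<delta> k)"
        using S[OF that] \<delta>(1) by (intro le_imp_inverse_le) auto
      then show ?thesis unfolding circle_fun_def r_def by (simp add: inverse_eq_divide norm_divide)
    qed
    have bg: "bounded_gens S ?G"
      unfolding bounded_gens_def using bd unfolding r_def by blast
    have mem: "?\<phi> b k \<in> alg ?G" for b k unfolding r_def by (intro alg_gen) blast
    have "\<exists>F. uniform_limit S (\<lambda>k x. \<Prod>i<k. ?\<phi> True i x) F sequentially \<and>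
      (\<forall>x\<in>S. (\<forall>k. x \<in> (\<lambda>k. {w. hi True k \<le> cmod w}) k) \<longrightarrow> F x = 0) \<and> (\<forall>x\<in>S. x \<in> (\<lambda>k. {w. cmod w \<le> lo True k}) 0 \<longrightarrow> cmod (F x - 1) \<le> 4 * \<theta>) \<and>
      (\<forall>x\<in>S. cmod (F x) \<le> 2 + D 0 + 4 * \<theta>)"
    proof (rule uniform_infinite_product[of D S "?\<phi> True" \<tau> \<theta>
              "\<lambda>k. {w. cmod w \<le> lo True k}" "\<lambda>k. {w. hi True k \<le> cmod w}"])
      show "cmod (?\<phi> True k x) \<le> D k" if "x \<in> S" for k x
        using bd[OF that, of True k] unfolding D_def by linarith
      show "x \<in> {w. cmod w \<le> lo True (Suc k)} \<or> x \<in> {w. hi True k \<le> cmod w}" for k x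
        unfolding lo_def hi_def by auto
    qed (use D1 \<tau>0 \<tau>2 N in \<open>auto simp: less_imp_le\<close>)
    then obtain f where f: "uniform_limit S (\<lambda>k x. \<Prod>i<k. ?\<phi> True i x) f sequentially"
      "\<And>x. x \<in> S \<Longrightarrow> (\<forall>k. hi True k \<le> cmod x) \<Longrightarrow> f x = 0"
      "\<And>x. x \<in> S \<Longrightarrow> cmod x \<le> lo True 0 \<Longrightarrow> cmod (f x - 1) \<le> 4 * \<theta>"
      "\<And>x. x \<in> S \<Longrightarrow> cmod (f x) \<le> 2 + D 0 + 4 * \<theta>"
      by (simp only: mem_Collect_eq) blast
    \<comment> \<open>For the inward product the factors are \<open>1 - \<phi>\<close>, and inside
      and outside exchange roles.\<close>
    have "\<exists>F. uniform_limit S (\<lambda>k x. \<Prod>i<k. 1 - ?\<phi> False i x) F sequentially \<and>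
      (\<forall>x\<in>S. (\<forall>k. x \<in> (\<lambda>k. {w. cmod w \<le> lo False k}) k) \<longrightarrow> F x = 0) \<and> (\<forall>x\<in>S. x \<in> (\<lambda>k. {w. hi False k \<le> cmod w}) 0 \<longrightarrow> cmod (F x - 1) \<le> 4 * \<theta>) \<and>
      (\<forall>x\<in>S. cmod (F x) \<le> 2 + D 0 + 4 * \<theta>)"
    proof (rule uniform_infinite_product[of D S "\<lambda>k w. 1 - ?\<phi> False k w" \<tau> \<theta>
              "\<lambda>k. {w. hi False k \<le> cmod w}" "\<lambda>k. {w. cmod w \<le> lo False k}"])
      show "cmod (1 - ?\<phi> False k x) \<le> D k" if "x \<in> S" for k x
        using bd[OF that, of False k] norm_triangle_ineq4[of 1 "?\<phi> False k x"] unfolding D_def by simp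
      show "x \<in> {w. hi False (Suc k) \<le> cmod w} \<or> x \<in> {w. cmod w \<le> lo False k}" for k x
        unfolding lo_def hi_def by auto
    qed (use D1 \<tau>0 \<tau>2 N in \<open>auto simp: less_imp_le norm_minus_commute\<close>)
    then obtain g where g: "uniform_limit S (\<lambda>k x. \<Prod>i<k. 1 - ?\<phi> False i x) g sequentially"
      "\<And>x. x \<in> S \<Longrightarrow> (\<forall>k. cmod x \<le> lo False k) \<Longrightarrow> g x = 0"
      "\<And>x. x \<in> S \<Longrightarrow> hi False 0 \<le> cmod x \<Longrightarrow> cmod (g x - 1) \<le> 4 * \<theta>"
      "\<And>x. x \<in> S \<Longrightarrow> cmod (g x) \<le> 2 + D 0 + 4 * \<theta>"
      by (simp only: mem_Collect_eq) blast
    have fU: "f \<in> ualg S ?G"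
      by (rule ualg_limit[OF _ f(1)]) (intro alg_imp_ualg alg_prod mem)
    have gU: "g \<in> ualg S ?G" by (rule ualg_limit[OF _ g(1)])
        (intro ualg_prod ualg_diff alg_imp_ualg mem bg alg.const)
    define h where "h x = (1 - f x) * (1 - g x)" for x
    have fg: "cmod (1 - f x) \<le> 4 + D 0" "cmod (1 - g x) \<le> 4 + D 0" "cmod (f x) \<le> 3 + D 0" if "x \<in> S" for x
      using f(4)[OF that] g(4)[OF that] norm_triangle_ineq4[of 1 "f x"] norm_triangle_ineq4[of 1 "g x"] \<theta>
      by auto
    have h: "cmod (h x) \<le> 1 / 2" if x: "x \<in> S" for x
    proof (cases "cmod x \<le> 13/8")
      case True
      then have "cmod (1 - f x) \<le> 4 * \<theta>" using f(3)[OF x] by (simp add: lo_def norm_minus_commute)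
      then have "cmod (h x) \<le> 4 * \<theta> * (4 + D 0)"
        unfolding h_def norm_mult using fg[OF x] \<theta> by (intro mult_mono) auto
      then show ?thesis using \<theta> by simp
    next
      case False
      then have "cmod (1 - g x) \<le> 4 * \<theta>" using g(3)[OF x] by (simp add: hi_def norm_minus_commute)
      then have "cmod (h x) \<le> (4 + D 0) * (4 * \<theta>)"
        unfolding h_def norm_mult using fg[OF x] D1[of 0] by (intro mult_mono) auto
      then show ?thesis using \<theta> by (simp add: mult.commute)
    qed
    define H where "H x = f x * (1 - g x) * inverse (1 - h x)" for x
    have hU: "h \<in> ualg S ?G" unfolding h_def[abs_def] by (intro ualg_mult ualg_diff ualg_const fU gU bg)
    have "H \<in> ualg S ?G" unfolding H_def[abs_def]
      by (intro ualg_mult ualg_diff ualg_const fU gU bg ualg_inverse_one_minus[OF hU bg, of "1/2"]) (use h in auto)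
    moreover have "cmod (H x) \<le> C" if x: "x \<in> S" for x
    proof -
      have "1 / 2 \<le> cmod (1 - h x)" using h[OF x] norm_triangle_ineq2[of 1 "h x"] by simp
      then have "inverse (cmod (1 - h x)) \<le> inverse (1 / 2)" by (intro le_imp_inverse_le) auto
      then have "cmod (inverse (1 - h x)) \<le> 2" by (simp add: norm_inverse)
      then have "cmod (H x) \<le> ((3 + D 0) * (4 + D 0)) * 2"
        unfolding H_def norm_mult using fg[OF x] D1[of 0] by (intro mult_mono mult_nonneg_nonneg) auto
      then show ?thesis unfolding C_def by simp
    qed
    moreover have "H x = 1" if x: "x \<in> S" "cmod x \<le> 1" for x
    proof -
      \<comment> \<open>Since \<open>g x = 0\<close>, \<open>1 - h x\<close> equals
        \<open>f x\<close>, so \<open>H x\<close> is \<open>f x\<close> divided by itself.\<close>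
      have "g x = 0" using g(2)[OF x(1)] x(2) mid1(1)[of False] unfolding lo_def
        by (auto intro: order_trans)
      moreover from this have "f x \<noteq> 0" using h[OF x(1)] unfolding h_def by auto
      ultimately show ?thesis unfolding H_def h_def by simp
    qed
    moreover have "H x = 0" if x: "x \<in> S" "2 \<le> cmod x" for x
    proof -
      have "f x = 0" using f(2)[OF x(1)] x(2) mid1(2)[of True] unfolding hi_def
        by (auto intro: order_trans)
      then show ?thesis unfolding H_def by simp
    qed
    ultimately show "\<exists>H \<in> ualg S ?G.
         \<forall>w\<in>S. cmod (H w) \<le> C \<and> (cmod w \<le> 1 \<longrightarrow> H w = 1) \<and> (2 \<le> cmod w \<longrightarrow> H w = 0)"
      by blast
  qed
qed

section \<open>Removing neighbourhoods of roots of unity on circles\<close>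

lemma circle_fun_holomorphic:
  assumes "r > 0" "\<And>z. z \<in> S \<Longrightarrow> ((z - c) / of_real r) ^ N \<noteq> 1"
  shows "circle_fun c r N holomorphic_on S"
  unfolding circle_fun_def[abs_def] using assms by (intro holomorphic_intros) auto

lemma alg_holomorphic_on:
  assumes "f \<in> alg G" and "\<And>s. s \<in> G \<Longrightarrow> s holomorphic_on S"
  shows "f holomorphic_on S"
  using assms by (induction rule: alg.induct) (auto intro: holomorphic_intros)

lemma bounded_gens_compact:
  fixes S :: "'a::topological_space set"
  assumes "compact S" "\<And>s. s \<in> G \<Longrightarrow> continuous_on S s"
  shows "bounded_gens S G"
  unfolding bounded_gens_def
proof
  fix s assume "s \<in> G"
  then have "bounded (s ` S)"
    using assms compact_continuous_image compact_imp_bounded by blast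
  then show "\<exists>C. \<forall>x\<in>S. cmod (s x) \<le> C" unfolding bounded_iff by blast
qed

lemma norm_diff_via:
  fixes a b c d :: "'a::real_normed_vector"
  shows "norm (a - b) \<le> norm (a - c) + norm (c - d) + norm (b - d)"
  using norm_triangle_ineq4[of "(a - c) + (c - d)" "b - d"] norm_triangle_ineq[of "a - c" "c - d"] by simp

text \<open>The quantity \<open>8 * \<delta> j * r j\<close> is the total radius of the discs
  covering the holes on circle \<open>j\<close>. It has to fit into the budget \<open>e j\<close>,
  both absolutely and relative to the distance from each point of \<open>F\<close>.\<close>

locale circle_data =
  fixes c :: "'j \<Rightarrow> complex" and r \<delta> e :: "'j \<Rightarrow> real" and N :: "'j \<Rightarrow> nat" and F :: "complex set"
  assumes r: "\<And>j. 0 < r j" and N: "\<And>j. 1 \<le> N j" and \<delta>: "\<And>j. 0 < \<delta> j" "\<And>j. \<delta> j \<le> 1/2"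
    and cost: "\<And>j. 8 * \<delta> j * r j \<le> e j"
    and dist_cost: "\<And>j x z. x \<in> F \<Longrightarrow> cmod (z - c j) = r j \<Longrightarrow> 8 * \<delta> j * r j \<le> e j * cmod (z - x)"
    and total: "\<And>A. finite A \<Longrightarrow> sum e A \<le> 1/8"
    and F: "\<And>x. x \<in> F \<Longrightarrow> cmod x \<le> 1/4"
begin

abbreviation u :: "'j \<Rightarrow> complex \<Rightarrow> complex" where "u j z \<equiv> ((z - c j) / of_real (r j)) ^ N j"

abbreviation \<phi> :: "'j \<Rightarrow> complex \<Rightarrow> complex" where "\<phi> j \<equiv> circle_fun (c j) (r j) (N j)"

text \<open>Cutting with the denominators themselves, rather than with discs, bounds each generator
  by \<open>1 / \<delta> j\<close> at once; the discs are recovered through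
  \<open>far_from_roots\<close>.\<close>

definition K :: "complex set" where
  "K = {z. cmod z \<le> 3 \<and> (\<forall>j. \<delta> j \<le> cmod (1 - u j z))}"

definition gens :: "(complex \<Rightarrow> complex) set" where
  "gens = insert (\<lambda>z. z) (range \<phi>)"

lemma closed_far: "closed {z. \<delta> j \<le> cmod (1 - u j z)}"
  using r[of j] by (intro closed_Collect_le continuous_intros) auto

lemma compact_K: "compact K"
proof -
  have "K = cball 0 3 \<inter> (\<Inter>j. {z. \<delta> j \<le> cmod (1 - u j z)})"
    unfolding K_def by auto
  moreover have "compact \<dots>" by (intro compact_Int_closed closed_INT closed_far ballI) auto
  ultimately show ?thesis by simp
qed

lemma gens_continuous: "s \<in> gens \<Longrightarrow> continuous_on K s"
proof -
  have "continuous_on K (\<phi> j)" for j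
  proof (intro holomorphic_on_imp_continuous_on circle_fun_holomorphic r)
    fix z assume "z \<in> K"
    then have "\<delta> j \<le> cmod (1 - u j z)" unfolding K_def by blast
    then show "u j z \<noteq> 1" using \<delta>(1)[of j] by auto
  qed
  then show "s \<in> gens \<Longrightarrow> continuous_on K s" unfolding gens_def by (auto intro: continuous_intros)
qed

lemma bounded_gens_K: "bounded_gens K gens"
  by (rule bounded_gens_compact[OF compact_K gens_continuous])

text \<open>Contrapositive of \<open>near_root_of_unity\<close>, rescaled to circle
  \<open>j\<close>.\<close>

lemma far_from_roots:
  assumes "\<And>\<xi>. \<xi> ^ N j = 1 \<Longrightarrow> 8 * \<delta> j * r j / N j \<le> cmod (z - (c j + of_real (r j) * \<xi>))"
  shows "\<delta> j \<le> cmod (1 - u j z)"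
proof (rule ccontr)
  assume "\<not> ?thesis"
  then obtain \<xi> where \<xi>: "\<xi> ^ N j = 1" "cmod ((z - c j) / of_real (r j) - \<xi>) < 8 * \<delta> j / N j"
    using near_root_of_unity[of "N j" "\<delta> j" "(z - c j) / of_real (r j)"] N[of j] \<delta>(2)[of j] by (auto simp: not_le)
  have "z - (c j + of_real (r j) * \<xi>) = of_real (r j) * ((z - c j) / of_real (r j) - \<xi>)"
    using r[of j] by (simp add: field_simps)
  then have "cmod (z - (c j + of_real (r j) * \<xi>)) = r j * cmod ((z - c j) / of_real (r j) - \<xi>)"
    using r[of j] by (simp only: norm_mult norm_of_real abs_of_pos)
  also have "\<dots> < r j * (8 * \<delta> j / N j)" using \<xi>(2) r[of j] by (rule mult_strict_left_mono)
  finally show False using assms[OF \<xi>(1)] by (simp add: mult_ac)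
qed

lemma root_modulus:
  assumes "\<xi> ^ N j = 1"
  shows "cmod ((c j + of_real (r j) * \<xi>) - c j) = r j"
proof -
  have "cmod \<xi> ^ N j = 1" using assms by (metis norm_one norm_power)
  then have "cmod \<xi> = 1"
    using N[of j] power_eq_imp_eq_base[of "cmod \<xi>" "N j" 1] by simp
  then show ?thesis using r[of j] by (simp add: norm_mult)
qed

lemma F_subset_K: "F \<subseteq> K"
proof
  fix x assume x: "x \<in> F"
  have "\<delta> j \<le> cmod (1 - u j x)" for j
  proof (rule far_from_roots)
    fix \<xi> :: complex assume \<xi>: "\<xi> ^ N j = 1"
    let ?a = "c j + of_real (r j) * \<xi>"
    have "8 * \<delta> j * r j / N j \<le> 8 * \<delta> j * r j / 1"
      using N[of j] \<delta>(1)[of j] r[of j] by (intro divide_left_mono) auto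
    also have "\<dots> \<le> e j * cmod (?a - x)"
      using dist_cost[OF x root_modulus[OF \<xi>]] by simp
    also have "\<dots> \<le> 1 * cmod (?a - x)"
      using total[of "{j}"] by (intro mult_right_mono) auto
    finally show "8 * \<delta> j * r j / N j \<le> cmod (x - ?a)" by (simp add: norm_minus_commute)
  qed
  then show "x \<in> K" using F[OF x] unfolding K_def by auto
qed

text \<open>Only finitely many circles occur in \<open>f\<close>, but the bound is known on
  \<open>K\<close>, where all of them have been cut. The set where \<open>f\<close> has modulus at
  least \<open>M\<close> is compact and misses \<open>K\<close>, so by the finite intersection
  property finitely many circles already exclude it. This is why the bound is strict. The discs of
  those circles are then fed into \<open>holomorphic_variation_bound\<close>.\<close>

lemma alg_variation:
  assumes f: "f \<in> alg gens" and xy: "x \<in> F" "y \<in> F" and M: "\<And>z. z \<in> K \<Longrightarrow> cmod (f z) < M"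
  shows "cmod (f x - f y) \<le> M"
proof -
  let ?P = "\<lambda>j z. \<delta> j \<le> cmod (1 - u j z)"
  obtain G' where G': "finite G'" "G' \<subseteq> gens" "f \<in> alg G'" using alg_finite_gens[OF f] by blast
  have "finite (G' - {\<lambda>z. z})" "G' - {\<lambda>z. z} \<subseteq> range \<phi>"
    using G' unfolding gens_def by auto
  then obtain A where A: "finite A" "G' - {\<lambda>z. z} = \<phi> ` A"
    using finite_subset_image by (metis (no_types, lifting))
  have fA: "f \<in> alg (insert (\<lambda>z. z) (\<phi> ` A))"
    using A(2) G'(3) alg_mono[of G' "insert (\<lambda>z. z) (\<phi> ` A)"] by blast
  have fhol: "f holomorphic_on S" if "\<And>j z. j \<in> A \<Longrightarrow> z \<in> S \<Longrightarrow> u j z \<noteq> 1" for S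
    by (rule alg_holomorphic_on[OF fA]) (use that r in \<open>auto intro!: circle_fun_holomorphic holomorphic_intros\<close>)
  define KA where "KA B = {z. cmod z \<le> 3 \<and> (\<forall>j\<in>B. ?P j z)}" for B
  have "KA B = cball 0 3 \<inter> (\<Inter>j\<in>B. {z. ?P j z})" for B unfolding KA_def by auto
  then have KAc: "compact (KA B)" for B
    by (simp add: compact_Int_closed closed_INT closed_far)
  have fcont: "continuous_on (KA A) f"
  proof (intro holomorphic_on_imp_continuous_on fhol)
    show "u j z \<noteq> 1" if "j \<in> A" "z \<in> KA A" for j z
      using that \<delta>(1)[of j] unfolding KA_def by auto
  qed
  have "\<exists>A'. finite A' \<and> KA A \<inter> {z \<in> KA A. M \<le> cmod (f z)} \<inter> (\<Inter>j\<in>A'. {z. ?P j z}) = {}"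
  proof (rule ccontr)
    assume neg: "\<not> ?thesis"
    have "closed {z \<in> KA A. M \<le> cmod (f z)}"
      by (intro continuous_on_closed_Collect_le continuous_intros fcont compact_imp_closed KAc)
    then have "compact (KA A \<inter> {z \<in> KA A. M \<le> cmod (f z)})"
      by (intro compact_Int_closed KAc)
    then have "KA A \<inter> {z \<in> KA A. M \<le> cmod (f z)} \<inter> (\<Inter>j\<in>UNIV. {z. ?P j z}) \<noteq> {}"
    proof (rule compact_imp_fip_image)
      show "closed {z. ?P j z}" for j by (rule closed_far)
      show "KA A \<inter> {z \<in> KA A. M \<le> cmod (f z)} \<inter> (\<Inter>j\<in>A'. {z. ?P j z}) \<noteq> {}" if "finite A'" for A'
        using exI[of "\<lambda>A'. finite A' \<and> KA A \<inter> {z \<in> KA A. M \<le> cmod (f z)} \<inter> (\<Inter>j\<in>A'. {z. ?P j z}) = {}" A'] neg that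
        by argo
    qed
    then obtain z where "z \<in> KA A" "M \<le> cmod (f z)" "\<And>j. ?P j z" by blast
    then show False using M[of z] unfolding KA_def K_def by auto
  qed
  then obtain A' where A': "finite A'" "KA A \<inter> {z \<in> KA A. M \<le> cmod (f z)} \<inter> (\<Inter>j\<in>A'. {z. ?P j z}) = {}"
    by blast
  define B where "B = A \<union> A'"
  have B: "finite B" "A \<subseteq> B" using A A' unfolding B_def by auto
  have fM: "cmod (f z) \<le> M" if "z \<in> KA B" for z
    using that A'(2) unfolding KA_def B_def by (force simp: not_le)
  \<comment> \<open>One disc for each root. The budget \<open>e j / N j\<close> per disc adds up to
    \<open>e j\<close> over the \<open>N j\<close> roots.\<close>
  define I where "I = (SIGMA j:B. {\<xi>::complex. \<xi> ^ N j = 1})"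
  have finroots: "finite {\<xi>::complex. \<xi> ^ N j = 1}" for j
    using N[of j] by (intro finite_roots_unity) auto
  have NN: "0 < real (N j)" for j using N[of j] by auto
  show ?thesis
  proof (rule holomorphic_variation_bound[where f = f and x = x and y = y and I = I and a = "\<lambda>(j, \<xi>). c j + of_real (r j) * \<xi>"
        and \<rho> = "\<lambda>(j, \<xi>). 8 * \<delta> j * r j / N j" and e = "\<lambda>(j, \<xi>). e j / N j"])
    show "finite I" unfolding I_def using B finroots by auto
    show "0 < (case i of (j, \<xi>) \<Rightarrow> 8 * \<delta> j * r j / N j)" for i
      using \<delta>(1) r NN by (cases i) auto
    show "(case i of (j, \<xi>) \<Rightarrow> 8 * \<delta> j * r j / N j) \<le> (case i of (j, \<xi>) \<Rightarrow> e j / N j)" for i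
      using cost NN by (cases i) (auto intro!: divide_right_mono)
    have "(\<Sum>i\<in>I. case i of (j, \<xi>) \<Rightarrow> e j / N j) = (\<Sum>j\<in>B. \<Sum>\<xi> | (\<xi>::complex) ^ N j = 1. e j / N j)"
      unfolding I_def using B finroots by (subst sum.Sigma) auto
    also have "\<dots> = (\<Sum>j\<in>B. e j)"
      using card_complex_roots_unity[OF N] NN by (intro sum.cong) auto
    also have "\<dots> \<le> 1/8" by (rule total[OF B(1)])
    finally show "(\<Sum>i\<in>I. case i of (j, \<xi>) \<Rightarrow> e j / N j) \<le> 1/8" .
    show "(case i of (j, \<xi>) \<Rightarrow> 8 * \<delta> j * r j / N j) \<le>
        (case i of (j, \<xi>) \<Rightarrow> e j / N j) * cmod ((case i of (j, \<xi>) \<Rightarrow> c j + of_real (r j) * \<xi>) - w)"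
      if iw: "i \<in> I" "w \<in> {x, y}" for i w
    proof (cases i)
      case (Pair j \<xi>)
      then have "\<xi> ^ N j = 1" using iw unfolding I_def by auto
      then have "8 * \<delta> j * r j \<le> e j * cmod (c j + of_real (r j) * \<xi> - w)"
        using iw xy by (intro dist_cost root_modulus) auto
      then have "8 * \<delta> j * r j / N j \<le> e j * cmod (c j + of_real (r j) * \<xi> - w) / N j"
        using NN by (intro divide_right_mono) (auto simp: less_imp_le)
      then show ?thesis unfolding Pair by simp
    qed
    show "cmod x \<le> 1/4" "cmod y \<le> 1/4" using F xy by auto
    show "f holomorphic_on UNIV - (\<lambda>(j, \<xi>). c j + of_real (r j) * \<xi>) ` I"
    proof (rule fhol)
      fix j z assume jz: "j \<in> A" "z \<in> UNIV - (\<lambda>(j, \<xi>). c j + of_real (r j) * \<xi>) ` I"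
      show "u j z \<noteq> 1"
      proof
        assume "u j z = 1"
        then have "(j, (z - c j) / of_real (r j)) \<in> I" unfolding I_def using jz B by auto
        moreover have "z = c j + of_real (r j) * ((z - c j) / of_real (r j))" using r[of j] by simp
        ultimately show False using jz by (metis (mono_tags, lifting) DiffE case_prod_conv image_eqI)
      qed
    qed
    show "cmod (f z) \<le> M" if z: "cmod z \<le> 3"
      "\<And>i. i \<in> I \<Longrightarrow> z \<notin> ball (case i of (j, \<xi>) \<Rightarrow> c j + of_real (r j) * \<xi>) (case i of (j, \<xi>) \<Rightarrow> 8 * \<delta> j * r j / N j)" for z
    proof (rule fM)
      have "?P j z" if "j \<in> B" for j
      proof (rule far_from_roots)
        fix \<xi> :: complex assume "\<xi> ^ N j = 1"
        then have "(j, \<xi>) \<in> I" unfolding I_def using that by auto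
        from z(2)[OF this] show "8 * \<delta> j * r j / N j \<le> cmod (z - (c j + of_real (r j) * \<xi>))"
          by (simp add: dist_norm norm_minus_commute)
      qed
      then show "z \<in> KA B" using z(1) unfolding KA_def by auto
    qed
  qed
qed

lemma ualg_variation:
  assumes f: "f \<in> ualg K gens" and xy: "x \<in> F" "y \<in> F" and M: "\<And>z. z \<in> K \<Longrightarrow> cmod (f z) \<le> M"
  shows "cmod (f x - f y) \<le> M"
proof (rule field_le_epsilon)
  fix \<epsilon> :: real assume "\<epsilon> > 0"
  then obtain g where g: "g \<in> alg gens" "\<forall>z\<in>K. cmod (f z - g z) < \<epsilon> / 3"
    using ualgD[OF f, of "\<epsilon> / 3"] by auto
  have "cmod (g z) < M + \<epsilon> / 3" if "z \<in> K" for z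
    using norm_triangle_ineq4[of "f z" "f z - g z"] M[OF that] g(2) that by fastforce
  then have "cmod (g x - g y) \<le> M + \<epsilon> / 3" using xy by (intro alg_variation[OF g(1)])
  moreover have "cmod (f x - g x) < \<epsilon> / 3" "cmod (f y - g y) < \<epsilon> / 3"
    using g(2) xy F_subset_K by auto
  ultimately show "cmod (f x - f y) \<le> M + \<epsilon>"
    using norm_diff_via[of "f x" "f y" "g x" "g y"] by linarith
qed

end

section \<open>The planar base algebra\<close>

abbreviation const_near :: "'a::topological_space set \<Rightarrow> 'a \<Rightarrow> ('a \<Rightarrow> complex) \<Rightarrow> complex \<Rightarrow> bool" where
  "const_near X x f c \<equiv> \<exists>V. open V \<and> x \<in> V \<and> (\<forall>v\<in>V \<inter> X. f v = c)"

text \<open>For an algebra \<open>U\<close> this is the closure of the ideal of functions vanishing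
  near \<open>x\<close>. Strong regularity at \<open>x\<close> says that \<open>f - f x\<close>
  belongs to it for every \<open>f\<close> in \<open>U\<close>.\<close>

definition zero_closure ::
    "'a::topological_space set \<Rightarrow> ('a \<Rightarrow> complex) set \<Rightarrow> 'a \<Rightarrow> ('a \<Rightarrow> complex) set" where
  "zero_closure X U x = {f. \<forall>e>0. \<exists>g\<in>U.
     const_near X x g 0 \<and> (\<forall>y\<in>X. cmod (f y - g y) < e)}"

lemma zero_closureI:
  "(\<And>e. e > 0 \<Longrightarrow> \<exists>g\<in>U. const_near X x g 0 \<and> (\<forall>y\<in>X. cmod (f y - g y) < e))
    \<Longrightarrow> f \<in> zero_closure X U x"
  unfolding zero_closure_def by blast

lemma zero_closureE:
  assumes "f \<in> zero_closure X U x" "e > 0"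
  obtains g V where "g \<in> U" "open V" "x \<in> V" "\<And>y. y \<in> V \<Longrightarrow> y \<in> X \<Longrightarrow> g y = 0"
    "\<And>y. y \<in> X \<Longrightarrow> cmod (f y - g y) < e"
proof -
  have "\<exists>g\<in>U. const_near X x g 0 \<and> (\<forall>y\<in>X. cmod (f y - g y) < e)"
    using assms unfolding zero_closure_def by simp
  then obtain g where g: "g \<in> U" "const_near X x g 0" "\<forall>y\<in>X. cmod (f y - g y) < e"
    by (elim bexE conjE)
  then obtain V where "open V" "x \<in> V" "\<forall>y\<in>V \<inter> X. g y = 0" by auto
  then show thesis using that[of g V] g by auto
qed

lemma zero_closure_near:
  assumes "f \<in> U" "open V" "x \<in> V" "\<And>y. y \<in> V \<Longrightarrow> y \<in> X \<Longrightarrow> f y = 0"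
  shows "f \<in> zero_closure X U x"
  by (rule zero_closureI, rule bexI[OF _ assms(1)]) (use assms in auto)

lemma zero_closure_add:
  assumes "f \<in> zero_closure X (ualg X G) x" "g \<in> zero_closure X (ualg X G) x"
  shows "(\<lambda>y. f y + g y) \<in> zero_closure X (ualg X G) x"
proof (rule zero_closureI)
  fix e :: real assume "e > 0"
  then have e2: "e / 2 > 0" by simp
  obtain f' V where f': "f' \<in> ualg X G" "open V" "x \<in> V" "\<And>y. y \<in> V \<Longrightarrow> y \<in> X \<Longrightarrow> f' y = 0"
    "\<And>y. y \<in> X \<Longrightarrow> cmod (f y - f' y) < e / 2" by (rule zero_closureE[OF assms(1) e2]) blast
  obtain g' W where g': "g' \<in> ualg X G" "open W" "x \<in> W" "\<And>y. y \<in> W \<Longrightarrow> y \<in> X \<Longrightarrow> g' y = 0"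
    "\<And>y. y \<in> X \<Longrightarrow> cmod (g y - g' y) < e / 2" by (rule zero_closureE[OF assms(2) e2]) blast
  have "cmod (f y + g y - (f' y + g' y)) < e" if "y \<in> X" for y
    using norm_diff_triangle_ineq[of "f y" "g y" "f' y" "g' y"] f'(5)[OF that] g'(5)[OF that] by simp
  then show "\<exists>h\<in>ualg X G. const_near X x h 0 \<and>
      (\<forall>y\<in>X. cmod (f y + g y - h y) < e)"
    using f' g' by (intro bexI[OF _ ualg_add[OF f'(1) g'(1)]] conjI exI[of _ "V \<inter> W"]) auto
qed

lemma zero_closure_mult:
  assumes bg: "bounded_gens X G" and h: "h \<in> ualg X G"
    and f: "f \<in> zero_closure X (ualg X G) x"
  shows "(\<lambda>y. h y * f y) \<in> zero_closure X (ualg X G) x"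
proof (rule zero_closureI)
  fix e :: real assume e: "e > 0"
  obtain C where C: "C > 0" "\<forall>y\<in>X. cmod (h y) \<le> C" using ualg_bounded[OF h bg] by blast
  obtain g V where g: "g \<in> ualg X G" "open V" "x \<in> V" "\<And>y. y \<in> V \<Longrightarrow> y \<in> X \<Longrightarrow> g y = 0"
    "\<And>y. y \<in> X \<Longrightarrow> cmod (f y - g y) < e / C"
    by (rule zero_closureE[OF f divide_pos_pos[OF e C(1)]]) blast
  have "cmod (h y * f y - h y * g y) < e" if "y \<in> X" for y
  proof -
    have "cmod (h y * f y - h y * g y) = cmod (h y) * cmod (f y - g y)"
      by (simp add: norm_mult flip: right_diff_distrib)
    also have "\<dots> \<le> C * cmod (f y - g y)" using C that by (intro mult_right_mono) auto
    also have "\<dots> < C * (e / C)" using g(5)[OF that] C(1) by (intro mult_strict_left_mono) auto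
    finally show ?thesis using C(1) by simp
  qed
  then show "\<exists>k\<in>ualg X G. const_near X x k 0 \<and>
      (\<forall>y\<in>X. cmod (h y * f y - k y) < e)"
    using g by (intro bexI[OF _ ualg_mult[OF h g(1) bg]] conjI exI[of _ V]) auto
qed

lemma zero_closure_closed:
  assumes "\<And>e. e > 0 \<Longrightarrow> \<exists>g\<in>zero_closure X U x. \<forall>y\<in>X. cmod (f y - g y) < e"
  shows "f \<in> zero_closure X U x"
proof (rule zero_closureI)
  fix e :: real assume "e > 0"
  then have e2: "e / 2 > 0" by simp
  obtain g where g: "g \<in> zero_closure X U x" "\<forall>y\<in>X. cmod (f y - g y) < e / 2"
    using assms[OF e2] by blast
  obtain h V where h: "h \<in> U" "open V" "x \<in> V" "\<And>y. y \<in> V \<Longrightarrow> y \<in> X \<Longrightarrow> h y = 0"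
    "\<And>y. y \<in> X \<Longrightarrow> cmod (g y - h y) < e / 2" by (rule zero_closureE[OF g(1) e2]) blast
  have "cmod (f y - h y) < e" if "y \<in> X" for y
    using norm_diff_triangle_less[of "f y" "g y" "e / 2" "h y" "e / 2"] g(2) h(5) that by simp
  then show "\<exists>h\<in>U. const_near X x h 0 \<and> (\<forall>y\<in>X. cmod (f y - h y) < e)"
    using h by (intro bexI[OF _ h(1)] conjI exI[of _ V]) auto
qed

text \<open>The step for products is the identity
  \<open>s y * f y - s x * f x = s y * (f y - f x) + f x * (s y - s x)\<close>.\<close>

lemma zero_closure_alg:
  assumes bg: "bounded_gens X G" and f: "f \<in> alg G'" and sub: "G' \<subseteq> ualg X G"
    and gen: "\<And>s. s \<in> G' \<Longrightarrow> (\<lambda>y. s y - s x) \<in> zero_closure X (ualg X G) x"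
  shows "(\<lambda>y. f y - f x) \<in> zero_closure X (ualg X G) x"
  using f
proof (induction rule: alg.induct)
  case (const c)
  show ?case by (rule zero_closure_near[of _ _ UNIV]) (auto intro: ualg_const)
next
  case (add f g)
  have "(\<lambda>y. (f y + g y) - (f x + g x)) = (\<lambda>y. (f y - f x) + (g y - g x))" by auto
  then show ?case using zero_closure_add[OF add.IH] by simp
next
  case (gen_mult s f)
  have "(\<lambda>y. s y * (f y - f x)) \<in> zero_closure X (ualg X G) x"
    using sub gen_mult by (intro zero_closure_mult[OF bg]) auto
  moreover have "(\<lambda>y. f x * (s y - s x)) \<in> zero_closure X (ualg X G) x"
    by (intro zero_closure_mult[OF bg] ualg_const gen gen_mult)
  ultimately have "(\<lambda>y. s y * (f y - f x) + f x * (s y - s x)) \<in> zero_closure X (ualg X G) x"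
    by (rule zero_closure_add)
  moreover have "(\<lambda>y. s y * (f y - f x) + f x * (s y - s x)) = (\<lambda>y. s y * f y - s x * f x)"
    by (auto simp: algebra_simps)
  ultimately show ?case by simp
qed

text \<open>Strong regularity at a point therefore has to be checked on generators only.\<close>

lemma zero_closure_ualg:
  assumes bg: "bounded_gens X G" and f: "f \<in> ualg X G" and x: "x \<in> X"
    and gen: "\<And>s. s \<in> G \<Longrightarrow> (\<lambda>y. s y - s x) \<in> zero_closure X (ualg X G) x"
  shows "(\<lambda>y. f y - f x) \<in> zero_closure X (ualg X G) x"
proof (rule zero_closure_closed)
  fix e :: real assume "e > 0"
  then obtain g where g: "g \<in> alg G" "\<forall>y\<in>X. cmod (f y - g y) < e / 2" using ualgD[OF f, of "e / 2"] by auto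
  have "cmod ((f y - f x) - (g y - g x)) < e" if "y \<in> X" for y
  proof -
    have "cmod ((f y - f x) - (g y - g x)) = cmod ((f y - g y) - (f x - g x))"
      by (simp add: algebra_simps)
    also have "\<dots> \<le> cmod (f y - g y) + cmod (f x - g x)" by (rule norm_triangle_ineq4)
    also have "\<dots> < e / 2 + e / 2" using g(2) x that by (intro add_strict_mono) auto
    finally show ?thesis by simp
  qed
  then show "\<exists>g\<in>zero_closure X (ualg X G) x. \<forall>y\<in>X. cmod ((f y - f x) - g y) < e"
    using zero_closure_alg[OF bg g(1) _ gen] ualg_gen by (intro bexI[of _ "\<lambda>y. g y - g x"]) auto
qed

text \<open>Everything that the root extension uses of the planar algebra. The functions
  \<open>H i\<close> are those to be rooted. Bumps at points of \<open>F\<close> are listed apart,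
  in \<open>F_bump\<close>: they do not vanish near \<open>F\<close>, receive no roots and carry no
  norm bound.\<close>

locale base_algebra =
  fixes K :: "complex set" and G :: "(complex \<Rightarrow> complex) set" and F :: "complex set"
    and H :: "nat \<Rightarrow> complex \<Rightarrow> complex"
  assumes compact_K: "compact K" and F_sub: "F \<subseteq> K" and finite_F: "finite F"
    and gens_cont: "\<And>s. s \<in> G \<Longrightarrow> continuous_on K s" and id_gen: "(\<lambda>z. z) \<in> G"
    and variation: "\<And>f x y M. f \<in> ualg K G \<Longrightarrow> x \<in> F \<Longrightarrow> y \<in> F \<Longrightarrow> (\<And>z. z \<in> K \<Longrightarrow> cmod (f z) \<le> M) \<Longrightarrow>
        cmod (f x - f y) \<le> M"
    and H_mem: "\<And>i. H i \<in> ualg K G"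
    and H_F: "\<And>i x. x \<in> F \<Longrightarrow> \<exists>r>0. \<forall>z\<in>K. cmod (z - x) < r \<longrightarrow> H i z = 0"
    and H_bump: "\<And>y \<rho>. y \<in> K - F \<Longrightarrow> \<rho> > 0 \<Longrightarrow> \<exists>i. \<exists>r>0. \<forall>z\<in>K.
        (cmod (z - y) < r \<longrightarrow> H i z = 1) \<and> (\<rho> \<le> cmod (z - y) \<longrightarrow> H i z = 0)"
    and F_bump: "\<And>x \<rho>. x \<in> F \<Longrightarrow> \<rho> > 0 \<Longrightarrow> \<exists>h\<in>ualg K G. \<exists>r>0. \<forall>z\<in>K.
        (cmod (z - x) < r \<longrightarrow> h z = 1) \<and> (\<rho> \<le> cmod (z - x) \<longrightarrow> h z = 0)"
    and F_regular: "\<And>f x. x \<in> F \<Longrightarrow> f \<in> ualg K G \<Longrightarrow>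
        (\<lambda>z. f z - f x) \<in> zero_closure K (ualg K G) x"

section \<open>Choice of the annuli and construction of the planar algebra\<close>

lemma dyadic_sum_le_2: "(\<Sum>k<m. (1/2 :: real) ^ k) \<le> 2"
  using geometric_sum[of "1/2 :: real" m] by simp

text \<open>Annuli of odd index are centred at the points of \<open>F\<close> and shrink to them; those of even index
  stay away from \<open>F\<close> and lie densely off \<open>F\<close>.\<close>

locale annuli =
  fixes F :: "complex set" and xs :: "nat \<Rightarrow> complex" and c :: "nat \<Rightarrow> complex"
    and s m \<eta> C :: "nat \<Rightarrow> real" and N :: "nat \<Rightarrow> bool \<Rightarrow> nat \<Rightarrow> nat"
  assumes F_small: "\<And>x. x \<in> F \<Longrightarrow> cmod x \<le> 1/4"
    and s_pos: "\<And>p. 0 < s p" and m_pos: "\<And>p. 0 < m p" and m_le_1: "\<And>p. m p \<le> 1"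
    and \<eta>_pos: "\<And>p. 0 < \<eta> p" and \<eta>_le_half: "\<And>p. \<eta> p \<le> 1/2"
    and \<eta>_small: "\<And>p. 2048 * 2 ^ p * \<eta> p * s p \<le> m p"
    and far: "\<And>p x z. x \<in> F \<Longrightarrow> s p \<le> cmod (z - c p) \<Longrightarrow> cmod (z - c p) \<le> 2 * s p \<Longrightarrow> m p \<le> cmod (z - x)"
    and cut: "\<And>p. annulus_cutoff (\<lambda>k. \<eta> p / 2 ^ k) (N p) (C p)"
    and odd_c: "\<And>q. c (Suc (2 * q)) = xs q"
    and odd_C: "\<And>q. s (Suc (2 * q)) * C (Suc (2 * q)) \<le> (1/2) ^ q"
    and odd_s: "\<And>q. s (Suc (2 * q)) \<le> (1/2) ^ q"
    and even_far: "\<And>q x. x \<in> F \<Longrightarrow> 2 * s (2 * q) < cmod (x - c (2 * q))"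
    and even_dense: "\<And>y \<rho>. y \<notin> F \<Longrightarrow> \<rho> > 0 \<Longrightarrow> \<exists>q. cmod (y - c (2 * q)) < s (2 * q) \<and> 4 * s (2 * q) < \<rho>"

text \<open>The two kinds of annuli choose their parameters in opposite orders. For even index the
  scale \<open>s\<close> is prescribed by density and \<open>\<eta>\<close> is shrunk until the
  holes are cheap; the resulting \<open>C\<close> is irrelevant. For odd index \<open>\<eta>\<close>
  comes first and determines \<open>C\<close>, and only then is \<open>s\<close> made small. With
  \<open>m = s\<close> the cost condition is scale invariant, so shrinking \<open>s\<close> does not
  disturb it.\<close>

lemma annuli_exist:
  fixes F :: "complex set" and xs :: "nat \<Rightarrow> complex"
  assumes F: "finite F" "F \<noteq> {}" "\<And>x. x \<in> F \<Longrightarrow> cmod x \<le> 1/4" and xs: "range xs \<subseteq> F"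
  shows "\<exists>c s m \<eta> C N. annuli F xs c s m \<eta> C N"
proof -
  obtain D :: "complex set" where D: "countable D" "\<And>S. open S \<Longrightarrow> S \<noteq> {} \<Longrightarrow> \<exists>d\<in>D. d \<in> S"
    using countable_dense_exists by blast
  \<comment> \<open>Pairs of a centre and an index \<open>k\<close> giving radius
    \<open>1 / Suc k\<close>, such that the disc of twice that radius misses \<open>F\<close>. There
    are countably many, and they accumulate at every point off \<open>F\<close>.\<close>
  define T where "T = {(d, k::nat). d \<in> D \<and> (\<forall>x\<in>F. 2 * (1 / Suc k) < cmod (x - d))}"
  have "T \<subseteq> D \<times> UNIV" unfolding T_def by auto
  then have "countable T" using D(1) by (meson countable_SIGMA countableI_type countable_subset)
  have near: "\<exists>(d, k)\<in>T. cmod (y - d) < 1 / Suc k \<and> 4 * (1 / Suc k) < \<rho>" if y: "y \<notin> F" "\<rho> > 0" for y \<rho>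
  proof -
    obtain t where t: "t > 0" "\<And>x. x \<in> F \<Longrightarrow> t \<le> cmod (x - y)"
    proof -
      have "open (- F)" using F(1) finite_imp_closed by blast
      then obtain t where "t > 0" "ball y t \<subseteq> - F" using y(1) openE by (metis ComplI)
      then have "t \<le> cmod (x - y)" if "x \<in> F" for x
        using that by (force simp: dist_norm norm_minus_commute not_less)
      then show ?thesis using that \<open>t > 0\<close> by blast
    qed
    obtain k where k: "1 / Suc k < min (t / 3) (\<rho> / 4)"
      using nat_approx_posE[of "min (t / 3) (\<rho> / 4)"] t y by auto
    obtain d where d: "d \<in> D" "d \<in> ball y (1 / Suc k)"
      using D(2)[of "ball y (1 / Suc k)"] by auto
    have yd: "cmod (y - d) < 1 / Suc k" using d by (simp add: dist_norm)
    have "2 * (1 / Suc k) < cmod (x - d)" if "x \<in> F" for x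
      using norm_triangle_ineq4[of "x - d" "y - d"] t(2)[OF that] yd k by simp
    then show ?thesis using d yd k unfolding T_def by (intro bexI[of _ "(d, k)"]) auto
  qed
  have "infinite (UNIV :: complex set)" by (rule infinite_UNIV_char_0)
  then obtain y0 where "y0 \<notin> F" using F(1) ex_new_if_finite by blast
  then have "T \<noteq> {}" using near[of y0 1] by auto
  define en where "en = from_nat_into T"
  have en: "en q \<in> T" "\<And>t. t \<in> T \<Longrightarrow> \<exists>q. en q = t" for q
    unfolding en_def using \<open>T \<noteq> {}\<close> \<open>countable T\<close> from_nat_into from_nat_into_surj by metis+
  obtain \<sigma> where \<sigma>: "\<sigma> > 0" "\<And>x y. x \<in> F \<Longrightarrow> y \<in> F \<Longrightarrow> x \<noteq> y \<Longrightarrow> \<sigma> \<le> cmod (x - y)"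
  proof -
    let ?A = "(\<lambda>(x, y). cmod (x - y)) ` {(x, y). x \<in> F \<and> y \<in> F \<and> x \<noteq> y}"
    have fin: "finite ?A" by (rule finite_imageI, rule finite_subset[of _ "F \<times> F"]) (use F in auto)
    show thesis
    proof (rule that[of "Min (insert 1 ?A)"])
      show "Min (insert 1 ?A) > 0" using fin by auto
      show "Min (insert 1 ?A) \<le> cmod (x - y)" if "x \<in> F" "y \<in> F" "x \<noteq> y" for x y
        using that fin by (intro Min_le) auto
    qed
  qed
  define good where "good p c s m \<eta> N C \<longleftrightarrow> 0 < s \<and> 0 < m \<and> m \<le> 1 \<and> 0 < \<eta> \<and> \<eta> \<le> 1/2 \<and>
      2048 * 2 ^ p * \<eta> * s \<le> m \<and>
      (\<forall>x z. x \<in> F \<longrightarrow> s \<le> cmod (z - c) \<longrightarrow> cmod (z - c) \<le> 2 * s \<longrightarrow> m \<le> cmod (z - x)) \<and>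
      annulus_cutoff (\<lambda>k. \<eta> / 2 ^ k) N C" for p :: nat and c :: complex and s m \<eta> :: real and N C
  have cut: "\<exists>N C. annulus_cutoff (\<lambda>k. \<eta> / 2 ^ k) N C" if "0 < \<eta>" "\<eta> \<le> 1/2" for \<eta>
  proof (rule annulus_cutoff_exists)
    show "\<eta> / 2 ^ k \<le> 1" for k :: nat
    proof -
      have "\<eta> / 2 ^ k \<le> \<eta> / 1" using that by (intro divide_left_mono) auto
      then show ?thesis using that by linarith
    qed
  qed (use that in auto)
  have even: "\<exists>m \<eta> N C. good (2 * q) (fst (en q)) (1 / Suc (snd (en q))) m \<eta> N C" for q
  proof -
    obtain d k where dk: "en q = (d, k)" by fastforce
    define s :: real where "s = 1 / Suc k"
    have s: "s > 0" unfolding s_def by simp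
    have far: "2 * s < cmod (x - d)" if "x \<in> F" for x
      using en(1)[of q] that unfolding dk T_def s_def by auto
    define m where "m = Min (insert 1 ((\<lambda>x. cmod (x - d) - 2 * s) ` F))"
    have m: "0 < m" "m \<le> 1" "\<And>x. x \<in> F \<Longrightarrow> m \<le> cmod (x - d) - 2 * s"
      unfolding m_def using F(1) far by auto
    define \<eta> where "\<eta> = min (1/2) (m / (2048 * 2 ^ (2 * q) * s))"
    have \<eta>: "0 < \<eta>" "\<eta> \<le> 1/2" unfolding \<eta>_def using m s by auto
    have "\<eta> \<le> m / (2048 * 2 ^ (2 * q) * s)" unfolding \<eta>_def by simp
    then have \<eta>m: "2048 * 2 ^ (2 * q) * \<eta> * s \<le> m" using s by (simp add: field_simps)
    obtain N C where "annulus_cutoff (\<lambda>k. \<eta> / 2 ^ k) N C" using cut[OF \<eta>] by blast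
    moreover have "m \<le> cmod (z - x)" if "x \<in> F" "cmod (z - d) \<le> 2 * s" for x z
      using m(3)[OF that(1)] that(2) norm_triangle_ineq4[of "z - d" "z - x"] by simp
    ultimately have "good (2 * q) d s m \<eta> N C" unfolding good_def using s m \<eta> \<eta>m by blast
    then show ?thesis unfolding dk s_def by auto
  qed
  have odd: "\<exists>s m \<eta> N C. good (Suc (2 * q)) (xs q) s m \<eta> N C \<and> s * C \<le> (1/2) ^ q \<and> s \<le> (1/2) ^ q" for q
  proof -
    define \<eta> :: real where "\<eta> = 1 / (2048 * 2 ^ Suc (2 * q))"
    have "(1::real) \<le> 2 ^ Suc (2 * q)" by (rule one_le_power) simp
    then have \<eta>: "0 < \<eta>" "\<eta> \<le> 1/2" unfolding \<eta>_def by (auto simp: field_simps)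
    have \<eta>1: "2048 * 2 ^ Suc (2 * q) * \<eta> = 1" unfolding \<eta>_def by simp
    obtain N C where NC: "annulus_cutoff (\<lambda>k. \<eta> / 2 ^ k) N C" using cut[OF \<eta>] by blast
    then have C: "C > 0" unfolding annulus_cutoff_def by blast
    \<comment> \<open>The bound \<open>\<sigma> / 3\<close> keeps the disc of radius
      \<open>2 * s\<close> at distance at least \<open>s\<close> from the other points of
      \<open>F\<close>; the bound with \<open>C\<close> makes \<open>s * C\<close> small.\<close>
    define s where "s = Min {1, \<sigma> / 3, (1/2) ^ q / C, (1/2) ^ q}"
    have s: "0 < s" unfolding s_def using \<sigma> C by auto
    have sle: "s \<le> 1" "s \<le> \<sigma> / 3" "s \<le> (1/2) ^ q / C" "s \<le> (1/2) ^ q"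
      unfolding s_def by (intro Min_le; simp)+
    note s = s sle
    have "s \<le> cmod (z - x)" if x: "x \<in> F" "s \<le> cmod (z - xs q)" "cmod (z - xs q) \<le> 2 * s" for x z
    proof (cases "x = xs q")
      case False
      then have "\<sigma> \<le> cmod (x - xs q)" using x xs by (intro \<sigma>) auto
      then show ?thesis using norm_triangle_ineq4[of "z - xs q" "z - x"] x(3) s(3) by simp
    qed (use x in auto)
    then have "good (Suc (2 * q)) (xs q) s s \<eta> N C"
      unfolding good_def using s \<eta> NC \<eta>1 by simp
    moreover have "s * C \<le> (1/2) ^ q" using s(4) C by (simp add: field_simps)
    ultimately show ?thesis using s(5) by blast
  qed
  have "\<exists>c s m \<eta> N C. good p c s m \<eta> N C \<and>
      (even p \<longrightarrow> c = fst (en (p div 2)) \<and> s = 1 / Suc (snd (en (p div 2)))) \<and>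
      (odd p \<longrightarrow> c = xs (p div 2) \<and> s * C \<le> (1/2) ^ (p div 2) \<and> s \<le> (1/2) ^ (p div 2))" for p
  proof (cases "even p")
    case True
    then have "p = 2 * (p div 2)" by simp
    then show ?thesis using even[of "p div 2"] True by metis
  next
    case False
    then have "p = Suc (2 * (p div 2))" by simp
    then show ?thesis using odd[of "p div 2"] False by metis
  qed
  then obtain c s m \<eta> N C where g: "\<And>p. good p (c p) (s p) (m p) (\<eta> p) (N p) (C p)"
    and ev: "\<And>p. even p \<Longrightarrow> c p = fst (en (p div 2)) \<and> s p = 1 / Suc (snd (en (p div 2)))"
    and od: "\<And>p. odd p \<Longrightarrow> c p = xs (p div 2) \<and> s p * C p \<le> (1/2) ^ (p div 2) \<and> s p \<le> (1/2) ^ (p div 2)"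
    by metis
  have "annuli F xs c s m \<eta> C N"
  proof
    show "s (Suc (2 * q)) * C (Suc (2 * q)) \<le> (1/2) ^ q" "s (Suc (2 * q)) \<le> (1/2) ^ q" for q
      using od[of "Suc (2 * q)"] by simp_all
    show "2 * s (2 * q) < cmod (x - c (2 * q))" if "x \<in> F" for q x
      using ev[of "2 * q"] en(1)[of q] that unfolding T_def by (auto simp: case_prod_beta)
    show "\<exists>q. cmod (y - c (2 * q)) < s (2 * q) \<and> 4 * s (2 * q) < \<rho>" if y: "y \<notin> F" "\<rho> > 0" for y \<rho>
    proof -
      obtain d k where dk: "(d, k) \<in> T" "cmod (y - d) < 1 / Suc k" "4 * (1 / Suc k) < \<rho>"
        using near[OF y] by auto
      obtain q where "en q = (d, k)" using en(2)[OF dk(1)] by blast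
      then show ?thesis using ev[of "2 * q"] dk by (intro exI[of _ q]) auto
    qed
  qed (use g od F in \<open>simp_all add: good_def\<close>)
  then show ?thesis by blast
qed

text \<open>\<open>G_cases\<close> records the shape of the generators, because regularity at
  \<open>F\<close> is going to be verified generator by generator.\<close>

locale annulus_algebra = annuli +
  fixes K :: "complex set" and G :: "(complex \<Rightarrow> complex) set" and H :: "nat \<Rightarrow> complex \<Rightarrow> complex"
  assumes K: "compact K" "F \<subseteq> K" and G_cont: "\<And>s. s \<in> G \<Longrightarrow> continuous_on K s" and id_G: "(\<lambda>z. z) \<in> G"
    and G_var: "\<And>f x y M. f \<in> ualg K G \<Longrightarrow> x \<in> F \<Longrightarrow> y \<in> F \<Longrightarrow> (\<And>z. z \<in> K \<Longrightarrow> cmod (f z) \<le> M) \<Longrightarrow>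
        cmod (f x - f y) \<le> M"
    and H: "\<And>p. H p \<in> ualg K G"
    "\<And>p z. z \<in> K \<Longrightarrow> cmod (H p z) \<le> C p"
    "\<And>p z. z \<in> K \<Longrightarrow> cmod (z - c p) \<le> s p \<Longrightarrow> H p z = 1"
    "\<And>p z. z \<in> K \<Longrightarrow> 2 * s p \<le> cmod (z - c p) \<Longrightarrow> H p z = 0"
    and G_cases: "\<And>g. g \<in> G \<Longrightarrow> g = (\<lambda>z. z) \<or>
      (\<exists>c r N. g = circle_fun c r N \<and> (\<forall>z\<in>K. ((z - c) / of_real r) ^ N \<noteq> 1))"

lemma (in annuli) annulus_algebra_exists: "\<exists>K G H. annulus_algebra F xs c s m \<eta> C N K G H"
proof -
  let ?c = "\<lambda>(p :: nat, b :: bool, k :: nat). c p"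
  let ?r = "\<lambda>(p, b, k). s p * annulus_radius b k"
  let ?\<delta> = "\<lambda>(p, b :: bool, k :: nat). \<eta> p / 2 ^ k"
  \<comment> \<open>Summed over all \<open>p\<close>, \<open>k\<close> and both \<open>b\<close>
    these weights give 1/16. As radii are at most \<open>2 * s p\<close>, the holes cost at most
    \<open>16 * \<eta> p * s p / 2 ^ k\<close>, which explains the factor
    \<open>2048 = 16 * 128\<close> in \<open>\<eta>_small\<close>.\<close>
  let ?e = "\<lambda>(p :: nat, b :: bool, k :: nat). (1/128) * (1/2 :: real) ^ p * (1/2) ^ k"
  let ?N = "\<lambda>(p, b, k). N p b k"
  note pos = s_pos m_pos m_le_1 \<eta>_pos \<eta>_le_half and small = \<eta>_small
  have rad0: "0 < annulus_radius b k" for b k using annulus_radius_bounds(1)[of b k] by linarith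
  have em: "8 * (\<eta> p / 2 ^ k) * (s p * annulus_radius b k) \<le> (1/128) * (1/2) ^ p * (1/2) ^ k * m p" for p b k
  proof -
    have "8 * (\<eta> p / 2 ^ k) * (s p * annulus_radius b k) \<le> 8 * (\<eta> p / 2 ^ k) * (s p * 2)"
      using annulus_radius_bounds(2)[of b k] pos(1,4)[of p] by (intro mult_left_mono) auto
    also have "\<dots> = (2048 * 2 ^ p * \<eta> p * s p) * ((1/128) * (1/2) ^ p * (1/2) ^ k)"
      by (simp add: field_simps)
    also have "\<dots> \<le> m p * ((1/128) * (1/2) ^ p * (1/2) ^ k)"
      using small by (intro mult_right_mono) auto
    finally show ?thesis by (simp add: mult_ac)
  qed
  interpret circle_data ?c ?r ?\<delta> ?e ?N F
  proof
    fix j :: "nat \<times> bool \<times> nat"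
    obtain p b k where j: "j = (p, b, k)" by (cases j)
    show "0 < ?r j" using pos rad0 unfolding j by auto
    show "1 \<le> ?N j" using cut[of p] unfolding j annulus_cutoff_def by auto
    show "0 < ?\<delta> j" using pos unfolding j by auto
    have "\<eta> p / 2 ^ k \<le> \<eta> p / 1" using pos(4)[of p] by (intro divide_left_mono) auto
    then show "?\<delta> j \<le> 1/2" using pos(5)[of p] unfolding j prod.case by linarith
    have "(1/128) * (1/2) ^ p * (1/2) ^ k * m p \<le> (1/128) * (1/2) ^ p * (1/2) ^ k * 1"
      using pos(3)[of p] by (intro mult_left_mono) auto
    with em[of p k b] have "8 * (\<eta> p / 2 ^ k) * (s p * annulus_radius b k) \<le> (1/128) * (1/2) ^ p * (1/2) ^ k"
      by linarith
    then show "8 * ?\<delta> j * ?r j \<le> ?e j" unfolding j by simp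
    show "8 * ?\<delta> j * ?r j \<le> ?e j * cmod (z - x)" if x: "x \<in> F" and z: "cmod (z - ?c j) = ?r j" for x z
    proof -
      have "m p \<le> cmod (z - x)"
        using z annulus_radius_bounds[of b k] pos(1)[of p] unfolding j by (intro far[OF x]) auto
      then have "(1/128) * (1/2) ^ p * (1/2) ^ k * m p \<le> (1/128) * (1/2) ^ p * (1/2) ^ k * cmod (z - x)"
        by (intro mult_left_mono) auto
      with em[of p k b] have "8 * (\<eta> p / 2 ^ k) * (s p * annulus_radius b k) \<le>
          (1/128) * (1/2) ^ p * (1/2) ^ k * cmod (z - x)"
        by linarith
      then show ?thesis unfolding j by simp
    qed
  next
    show "sum ?e A \<le> 1/8" if A: "finite A" for A
    proof -
      obtain n where n: "\<And>p b k. (p, b, k) \<in> A \<Longrightarrow> p < n \<and> k < n"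
      proof -
        have "finite (fst ` A \<union> (snd \<circ> snd) ` A)" using A by auto
        then obtain n where "\<forall>i\<in>fst ` A \<union> (snd \<circ> snd) ` A. i < n" using finite_nat_set_iff_bounded by blast
        then show ?thesis using that[of n] by force
      qed
      have "sum ?e A \<le> sum ?e ({..<n} \<times> (UNIV :: bool set) \<times> {..<n})"
        using n by (intro sum_mono2) auto
      also have "\<dots> = (\<Sum>p<n. \<Sum>b\<in>(UNIV :: bool set). \<Sum>k<n. (1/128) * (1/2) ^ p * (1/2) ^ k)"
        by (simp only: sum.cartesian_product)
      also have "\<dots> = 2 * ((1/128) * (\<Sum>p<n. (1/2) ^ p) * (\<Sum>k<n. (1/2) ^ k))"
        by (simp add: UNIV_bool sum_product sum_distrib_left sum_distrib_right sum.distrib mult_ac)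
      also have "\<dots> \<le> 2 * ((1/128) * 2 * 2)"
        by (intro mult_left_mono mult_mono dyadic_sum_le_2) (auto intro: sum_nonneg)
      finally show ?thesis by simp
    qed
  qed (rule F_small)
  have "\<forall>p. \<exists>H. H \<in> ualg K gens \<and> (\<forall>z\<in>K. cmod (H z) \<le> C p \<and> (cmod (z - c p) \<le> s p \<longrightarrow> H z = 1) \<and>
      (2 * s p \<le> cmod (z - c p) \<longrightarrow> H z = 0))"
  proof
    fix p
    \<comment> \<open>The coordinate in which annulus \<open>p\<close> is normalised; composition
      with it turns the normalised circle functions into members of \<open>gens\<close>.\<close>
    let ?T = "\<lambda>z. (z - c p) / of_real (s p)"
    let ?G = "{circle_fun 0 (annulus_radius b k) (N p b k) | b k. True}"
    have "\<forall>w\<in>?T ` K. \<forall>b k. \<eta> p / 2 ^ k \<le> cmod (1 - (w / of_real (annulus_radius b k)) ^ N p b k)"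
    proof (intro ballI allI)
      fix w b k assume "w \<in> ?T ` K"
      then obtain z where z: "z \<in> K" "w = ?T z" by blast
      have "?\<delta> (p, b, k) \<le> cmod (1 - ((z - ?c (p, b, k)) / of_real (?r (p, b, k))) ^ ?N (p, b, k))"
        using z(1) unfolding K_def by blast
      then show "\<eta> p / 2 ^ k \<le> cmod (1 - (w / of_real (annulus_radius b k)) ^ N p b k)"
        unfolding z(2) by simp
    qed
    then obtain h where h: "h \<in> ualg (?T ` K) ?G"
        "\<forall>w\<in>?T ` K. cmod (h w) \<le> C p \<and> (cmod w \<le> 1 \<longrightarrow> h w = 1) \<and> (2 \<le> cmod w \<longrightarrow> h w = 0)"
      using cut[of p] unfolding annulus_cutoff_def by blast
    have "(\<lambda>z. h (?T z)) \<in> ualg K ((\<lambda>g z. g (?T z)) ` ?G)" by (rule ualg_compose[OF h(1)])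
    moreover have "(\<lambda>g z. g (?T z)) ` ?G \<subseteq> gens"
    proof -
      have "(\<lambda>z. circle_fun 0 (annulus_radius b k) (N p b k) (?T z)) \<in> gens" for b k
      proof -
        have "(\<lambda>z. circle_fun 0 (annulus_radius b k) (N p b k) (?T z)) =
            circle_fun (?c (p, b, k)) (?r (p, b, k)) (?N (p, b, k))"
          unfolding circle_fun_def by (simp add: fun_eq_iff)
        then show ?thesis unfolding gens_def by (metis (no_types, lifting) insertCI rangeI)
      qed
      then show ?thesis by auto
    qed
    ultimately have mem: "(\<lambda>z. h (?T z)) \<in> ualg K gens" using ualg_mono by blast
    have Tn: "cmod (?T z) = cmod (z - c p) / s p" for z
      using pos(1)[of p] by (simp add: norm_divide)
    show "\<exists>H. H \<in> ualg K gens \<and> (\<forall>z\<in>K. cmod (H z) \<le> C p \<and> (cmod (z - c p) \<le> s p \<longrightarrow> H z = 1) \<and>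
      (2 * s p \<le> cmod (z - c p) \<longrightarrow> H z = 0))"
      using h(2) pos(1)[of p] mem by (intro exI[of _ "\<lambda>z. h (?T z)"]) (auto simp: Tn field_simps)
  qed
  from choice[OF this] obtain H where
    H: "\<forall>p. H p \<in> ualg K gens \<and> (\<forall>z\<in>K. cmod (H p z) \<le> C p \<and> (cmod (z - c p) \<le> s p \<longrightarrow> H p z = 1) \<and>
      (2 * s p \<le> cmod (z - c p) \<longrightarrow> H p z = 0))" ..
  have "annulus_algebra F xs c s m \<eta> C N K gens H"
  proof
    fix g assume g: "g \<in> gens"
    have *: "((z - ?c j) / of_real (?r j)) ^ ?N j \<noteq> 1" if "z \<in> K" for j z
    proof -
      have "?\<delta> j \<le> cmod (1 - ((z - ?c j) / of_real (?r j)) ^ ?N j)" using that unfolding K_def by blast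
      then show ?thesis using \<delta>(1)[of j] by auto
    qed
    consider "g = (\<lambda>z. z)" | j where "g = circle_fun (?c j) (?r j) (?N j)"
      using g unfolding gens_def by blast
    then show "g = (\<lambda>z. z) \<or> (\<exists>c r N. g = circle_fun c r N \<and> (\<forall>z\<in>K. ((z - c) / of_real r) ^ N \<noteq> 1))"
    proof cases
      case 2
      show ?thesis
        by (rule disjI2, rule exI[of _ "?c j"], rule exI[of _ "?r j"], rule exI[of _ "?N j"],
            rule conjI[OF 2], rule ballI, rule *)
    qed simp
  qed (use compact_K F_subset_K gens_continuous ualg_variation H in \<open>auto simp: gens_def\<close>)
  then show ?thesis by blast
qed

lemma base_algebra_exists:
  assumes "n \<ge> 1"
  shows "\<exists>K G F H. base_algebra K G F H \<and> card F = n"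
proof -
  \<comment> \<open>The sequence runs cyclically through the \<open>n\<close> points of
    \<open>F\<close>, so each point is the centre of annuli with arbitrarily large index and hence
    arbitrarily small scale.\<close>
  define xs :: "nat \<Rightarrow> complex" where "xs q = of_real (real (q mod n) / (4 * n))" for q
  define F where "F = xs ` {..<n}"
  have rng: "range xs \<subseteq> F"
  proof
    fix x assume "x \<in> range xs"
    then obtain q where "x = xs q" by blast
    then have "x = xs (q mod n)" unfolding xs_def by simp
    then show "x \<in> F" unfolding F_def using assms by auto
  qed
  have inj: "inj_on xs {..<n}"
    using assms by (intro inj_onI) (auto simp: xs_def)
  have F: "finite F" "F \<noteq> {}" "card F = n" unfolding F_def using assms card_image[OF inj] by auto
  have F4: "cmod x \<le> 1/4" if "x \<in> F" for x
  proof -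
    obtain q where q: "q < n" "x = xs q" using \<open>x \<in> F\<close> unfolding F_def by auto
    then have "cmod x = real q / (4 * n)" unfolding xs_def by (simp add: norm_divide)
    also have "\<dots> \<le> 1/4" using q(1) by (simp add: field_simps)
    finally show ?thesis .
  qed
  have often: "\<exists>q\<ge>t. xs q = x" if x: "x \<in> F" for x t
  proof -
    obtain q where q: "q < n" "x = xs q" using \<open>x \<in> F\<close> unfolding F_def by auto
    have "t * 1 \<le> t * n" using assms by (intro mult_left_mono) auto
    then have "t \<le> t * n + q" by linarith
    then show ?thesis using q by (intro exI[of _ "t * n + q"]) (auto simp: xs_def)
  qed
  obtain c s m \<eta> C N where "annuli F xs c s m \<eta> C N"
    using annuli_exist[OF F(1,2) F4 rng] by blast
  then interpret annuli F xs c s m \<eta> C N .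
  obtain K G H where "annulus_algebra F xs c s m \<eta> C N K G H"
    using annulus_algebra_exists by blast
  then interpret annulus_algebra F xs c s m \<eta> C N K G H .
  have bg: "bounded_gens K G" by (rule bounded_gens_compact[OF K(1) G_cont])
  have small: "\<exists>q. xs q = x \<and> (1/2 :: real) ^ q < \<rho>" if "x \<in> F" "\<rho> > 0" for x \<rho>
  proof -
    obtain t where t: "(1/2 :: real) ^ t < \<rho>" using real_arch_pow_inv[of \<rho> "1/2"] \<open>\<rho> > 0\<close> by auto
    obtain q where "q \<ge> t" "xs q = x" using often[OF \<open>x \<in> F\<close>] by blast
    moreover from this have "(1/2 :: real) ^ q \<le> (1/2) ^ t" by (intro power_decreasing) auto
    ultimately show ?thesis using t by (intro exI[of _ q] conjI) linarith+
  qed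
  \<comment> \<open>Only the cutoffs of even index will be rooted; those of odd index equal 1 near a
    point of \<open>F\<close>.\<close>
  have "base_algebra K G F (\<lambda>i. H (2 * i))"
  proof
    show "\<exists>r>0. \<forall>z\<in>K. cmod (z - x) < r \<longrightarrow> H (2 * i) z = 0" if x: "x \<in> F" for i x
    proof (intro exI[of _ "cmod (x - c (2 * i)) - 2 * s (2 * i)"] conjI ballI impI)
      fix z assume z: "z \<in> K" "cmod (z - x) < cmod (x - c (2 * i)) - 2 * s (2 * i)"
      show "H (2 * i) z = 0"
        using z norm_triangle_ineq4[of "z - c (2 * i)" "z - x"] by (intro H(4)) auto
    qed (use even_far[OF x, of i] in auto)
    show "\<exists>i. \<exists>r>0. \<forall>z\<in>K. (cmod (z - y) < r \<longrightarrow> H (2 * i) z = 1) \<and> (\<rho> \<le> cmod (z - y) \<longrightarrow> H (2 * i) z = 0)"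
      if y: "y \<in> K - F" and \<rho>: "\<rho> > 0" for y \<rho>
    proof -
      obtain q where q: "cmod (y - c (2 * q)) < s (2 * q)" "4 * s (2 * q) < \<rho>" using even_dense y \<rho> by blast
      show ?thesis
      proof (intro exI[of _ q] exI[of _ "s (2 * q) - cmod (y - c (2 * q))"] conjI ballI impI)
        fix z assume z: "z \<in> K"
        show "H (2 * q) z = 1" if "cmod (z - y) < s (2 * q) - cmod (y - c (2 * q))"
          using that norm_triangle_ineq[of "z - y" "y - c (2 * q)"] by (intro H(3)[OF z]) auto
        show "H (2 * q) z = 0" if "\<rho> \<le> cmod (z - y)"
          using that norm_triangle_ineq4[of "z - c (2 * q)" "y - c (2 * q)"] q s_pos[of "2 * q"]
          by (intro H(4)[OF z]) auto
      qed (use q in auto)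
    qed
    show "\<exists>h\<in>ualg K G. \<exists>r>0. \<forall>z\<in>K. (cmod (z - x) < r \<longrightarrow> h z = 1) \<and> (\<rho> \<le> cmod (z - x) \<longrightarrow> h z = 0)"
      if x: "x \<in> F" and \<rho>: "\<rho> > 0" for x \<rho>
    proof -
      obtain q where q: "xs q = x" "(1/2 :: real) ^ q < \<rho> / 2" using small[OF x, of "\<rho> / 2"] \<rho> by auto
      have "2 * s (Suc (2 * q)) \<le> \<rho>" using q(2) odd_s[of q] by simp
      then show ?thesis using H(3)[of _ "Suc (2 * q)"] H(4)[of _ "Suc (2 * q)"] odd_c[of q] q(1) s_pos
        by (intro bexI[OF _ H(1)[of "Suc (2 * q)"]] exI[of _ "s (Suc (2 * q))"]) auto
    qed
    show "(\<lambda>z. f z - f x) \<in> zero_closure K (ualg K G) x" if x: "x \<in> F" and f: "f \<in> ualg K G" for f x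
    proof (rule zero_closure_ualg[OF bg f])
      show "x \<in> K" using x K(2) by blast
      have id: "(\<lambda>z. z - x) \<in> zero_closure K (ualg K G) x"
      proof (rule zero_closureI)
        fix e :: real assume "e > 0"
        then obtain q where q: "xs q = x" "(1/2 :: real) ^ q < e / 2" using small[OF x, of "e / 2"] by auto
        let ?p = "Suc (2 * q)"
        have cp: "c ?p = x" using odd_c q(1) by simp
        \<comment> \<open>This function vanishes near \<open>x\<close>. It differs from
          \<open>z - x\<close> by \<open>(z - x) * H ?p z\<close>, which is nonzero only for
          \<open>cmod (z - x) < 2 * s ?p\<close> and so is bounded by
          \<open>2 * s ?p * C ?p\<close>.\<close>
        have mem: "(\<lambda>z. (z - x) * (1 - H ?p z)) \<in> ualg K G"
          by (intro ualg_mult ualg_diff ualg_const H(1) bg ualg_gen id_G)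
        have "cmod ((z - x) - (z - x) * (1 - H ?p z)) < e" if z: "z \<in> K" for z
        proof (cases "2 * s ?p \<le> cmod (z - x)")
          case True
          then have "H ?p z = 0" using H(4)[OF z, of ?p] cp by simp
          then show ?thesis using \<open>e > 0\<close> by simp
        next
          case False
          have "cmod ((z - x) - (z - x) * (1 - H ?p z)) = cmod (z - x) * cmod (H ?p z)"
            by (simp add: norm_mult algebra_simps flip: norm_mult)
          also have "\<dots> \<le> (2 * s ?p) * C ?p" using False H(2)[OF z, of ?p] s_pos[of ?p] by (intro mult_mono) auto
          also have "\<dots> \<le> 2 * (1/2) ^ q" using odd_C[of q] by simp
          also have "\<dots> < e" using q by simp
          finally show ?thesis .
        qed
        then show "\<exists>g\<in>ualg K G. const_near K x g 0 \<and> (\<forall>y\<in>K. cmod ((y - x) - g y) < e)"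
          using H(3)[of _ ?p] cp s_pos[of ?p]
          by (intro bexI[OF _ mem] conjI exI[of _ "ball x (s ?p)"]) (auto simp: dist_norm norm_minus_commute)
      qed
      fix g assume g: "g \<in> G"
      consider "g = (\<lambda>z. z)"
        | c r N where "g = circle_fun c r N" "\<And>z. z \<in> K \<Longrightarrow> ((z - c) / of_real r) ^ N \<noteq> 1" using G_cases[OF g] by blast
      then show "(\<lambda>z. g z - g x) \<in> zero_closure K (ualg K G) x"
      proof cases
        case 1
        then show ?thesis using id by simp
      next
        case 2
        \<comment> \<open>The generator is \<open>inverse (1 - P)\<close>, and
          \<open>g z - g x = g z * g x * (P z - P x)\<close> reduces its regularity to that of the
          polynomial \<open>P\<close>, hence of the identity.\<close>
        define P where "P z = ((1 / of_real r) * (z - c)) ^ N" for z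
        have "(\<lambda>z. z + (- c)) \<in> alg {\<lambda>z. z}"
          by (intro alg.add alg.const alg_gen) simp
        then have "P \<in> alg {\<lambda>z. z}"
          unfolding P_def[abs_def] by (intro alg_power alg_cmult) simp
        from zero_closure_alg[OF bg this]
        have "(\<lambda>z. P z - P x) \<in> zero_closure K (ualg K G) x"
          using id ualg_gen[OF id_G] by simp
        then have vc: "(\<lambda>z. (g z * g x) * (P z - P x)) \<in> zero_closure K (ualg K G) x"
          by (intro zero_closure_mult[OF bg] ualg_mult ualg_const ualg_gen g bg)
        have Pz: "1 - P z \<noteq> 0" "g z = inverse (1 - P z)" if "z \<in> K" for z
          using 2(2)[OF that] unfolding 2(1) circle_fun_def P_def by auto
        have "g z * g x * (P z - P x) = g z - g x" if "z \<in> K" for z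
        proof -
          have aux: "inverse a * inverse b * (b - a) = inverse a - inverse b" if "a \<noteq> 0" "b \<noteq> 0" for a b :: complex
            using that by (simp add: field_simps)
          show ?thesis
            using aux[OF Pz(1)[OF that] Pz(1)[OF \<open>x \<in> K\<close>]]
            unfolding Pz(2)[OF that] Pz(2)[OF \<open>x \<in> K\<close>] by simp
        qed
        then have "cmod (g z - g x - g z * g x * (P z - P x)) = 0" if "z \<in> K" for z
          using that by simp
        then show ?thesis by (intro zero_closure_closed bexI[OF _ vc]) auto
      qed
    qed
  qed (use K F H G_cont id_G G_var in auto)
  then show ?thesis using F(3) by (intro exI conjI)
qed

section \<open>The root extension\<close>

text \<open>The cubic that fixes 0 and 1 with vanishing derivative at both, so iteration contracts
  small discs about 0 and 1 to their centres.\<close>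

definition sharpen :: "complex \<Rightarrow> complex" where
  "sharpen w = 3 * w\<^sup>2 - 2 * w ^ 3"

lemma sharpen_one_minus: "sharpen (1 - w) = 1 - sharpen w"
  unfolding sharpen_def by (simp add: power2_eq_square power3_eq_cube algebra_simps)

lemma sharpen_iterate_near_0: "cmod w \<le> 1/8 \<Longrightarrow> cmod ((sharpen ^^ j) w) \<le> (1/2) ^ j / 8"
proof (induction j)
  case (Suc j)
  define u where "u = (sharpen ^^ j) w"
  have u: "cmod u \<le> (1/2) ^ j / 8" using Suc unfolding u_def by simp
  also have "\<dots> \<le> 1 / 8" by (intro divide_right_mono power_le_one) auto
  finally have u8: "cmod u \<le> 1/8" .
  have "sharpen u = u * (u * (3 - 2 * u))"
    unfolding sharpen_def by (simp add: power2_eq_square power3_eq_cube algebra_simps)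
  then have "cmod (sharpen u) = cmod u * (cmod u * cmod (3 - 2 * u))" by (simp add: norm_mult)
  also have "\<dots> \<le> cmod u * (1/8 * (3 + 2 * (1/8)))"
  proof (intro mult_left_mono mult_mono)
    show "cmod (3 - 2 * u) \<le> 3 + 2 * (1/8)"
      using norm_triangle_ineq4[of 3 "2 * u"] u8 by (simp add: norm_mult)
  qed (use u8 in auto)
  also have "\<dots> \<le> cmod u * (1/2)" by (intro mult_left_mono) auto
  also have "\<dots> \<le> ((1/2) ^ j / 8) * (1/2)" using u by (intro mult_right_mono) auto
  finally show ?case unfolding u_def by simp
qed simp

lemma sharpen_iterate_near_1:
  assumes "cmod (w - 1) \<le> 1/8"
  shows "cmod ((sharpen ^^ j) w - 1) \<le> (1/2) ^ j / 8"
proof -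
  have "(sharpen ^^ j) (1 - v) = 1 - (sharpen ^^ j) v" for v
    by (induction j arbitrary: v) (auto simp: sharpen_one_minus)
  from this[of "1 - w"] have "(sharpen ^^ j) w - 1 = - (sharpen ^^ j) (1 - w)" by simp
  then show ?thesis
    using sharpen_iterate_near_0[of "1 - w" j] assms by (simp add: norm_minus_commute)
qed

text \<open>The products of \<open>e\<close> with the iterates of \<open>sharpen\<close> at
  \<open>p\<close> converge uniformly. The factor \<open>e\<close> confines the dichotomy to the
  places where \<open>e\<close> does not vanish; elsewhere \<open>p\<close> may take any
  value.\<close>

lemma ualg_local_idempotent:
  assumes bg: "bounded_gens X G" and e: "e \<in> ualg X G" and p: "p \<in> ualg X G"
    and dich: "\<And>v. v \<in> X \<Longrightarrow> e v = 0 \<or> cmod (p v) \<le> 1/8 \<or> cmod (p v - 1) \<le> 1/8"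
  shows "(\<lambda>v. if cmod (p v - 1) \<le> 1/8 then e v else 0) \<in> ualg X G"
proof (rule ualg_closed)
  fix \<epsilon> :: real assume "\<epsilon> > 0"
  obtain C where C: "C > 0" "\<forall>v\<in>X. cmod (e v) \<le> C" using ualg_bounded[OF e bg] by blast
  obtain j where j: "(1/2 :: real) ^ j < \<epsilon> / C"
    using real_arch_pow_inv[of "\<epsilon> / C" "1/2"] \<open>\<epsilon> > 0\<close> C by auto
  have "(\<lambda>v. (sharpen ^^ i) (p v)) \<in> ualg X G" for i
  proof (induction i)
    case (Suc i)
    then show ?case unfolding sharpen_def funpow.simps comp_def
      by (intro ualg_diff ualg_cmult ualg_power bg)
  qed (simp add: p)
  then have mem: "(\<lambda>v. e v * (sharpen ^^ j) (p v)) \<in> ualg X G" by (intro ualg_mult e bg)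
  have "cmod ((if cmod (p v - 1) \<le> 1/8 then e v else 0) - e v * (sharpen ^^ j) (p v)) < \<epsilon>" if v: "v \<in> X" for v
  proof -
    let ?\<chi> = "if cmod (p v - 1) \<le> 1/8 then 1 else 0 :: complex"
    have eq: "(if cmod (p v - 1) \<le> 1/8 then e v else 0) - e v * (sharpen ^^ j) (p v) =
        e v * (?\<chi> - (sharpen ^^ j) (p v))" by (simp add: algebra_simps)
    show ?thesis
    proof (cases "e v = 0")
      case False
      then have "cmod (p v) \<le> 1/8 \<or> cmod (p v - 1) \<le> 1/8" using dich[OF v] by blast
      moreover have "\<not> cmod (p v - 1) \<le> 1/8" if "cmod (p v) \<le> 1/8"
        using that norm_triangle_ineq4[of "p v" "p v - 1"] by auto
      ultimately have "cmod (?\<chi> - (sharpen ^^ j) (p v)) \<le> (1/2) ^ j / 8"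
        using sharpen_iterate_near_0[of "p v" j] sharpen_iterate_near_1[of "p v" j]
        by (auto simp: norm_minus_commute)
      also have "\<dots> \<le> (1/2) ^ j" by simp
      finally have "cmod (e v) * cmod (?\<chi> - (sharpen ^^ j) (p v)) \<le> C * (1/2) ^ j"
        using C v by (intro mult_mono) auto
      also have "\<dots> < C * (\<epsilon> / C)" using j C by (intro mult_strict_left_mono) auto
      finally show ?thesis unfolding eq norm_mult using C by simp
    qed (use \<open>\<epsilon> > 0\<close> in simp)
  qed
  then show "\<exists>g\<in>ualg X G. \<forall>v\<in>X. cmod ((if cmod (p v - 1) \<le> 1/8 then e v else 0) - g v) < \<epsilon>"
    by (intro bexI[OF _ mem]) auto
qed

lemma continuous_on_coord: "continuous_on S (\<lambda>v :: nat \<Rightarrow> complex. v i)"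
  by (rule continuous_on_subset[OF continuous_on_product_coordinates]) simp

text \<open>Turns a property known on the fibre over \<open>y\<close> into one valid over a whole
  neighbourhood of \<open>y\<close>.\<close>

lemma compact_avoiding_fibre:
  fixes S :: "(nat \<Rightarrow> complex) set"
  assumes "compact S" "\<And>v. v \<in> S \<Longrightarrow> v 0 \<noteq> y"
  shows "\<exists>r>0. \<forall>v\<in>S. r \<le> cmod (v 0 - y)"
proof -
  have "compact ((\<lambda>v. v 0) ` S)"
    using assms(1) by (intro compact_continuous_image continuous_on_coord)
  moreover have "y \<notin> (\<lambda>v. v 0) ` S" using assms(2) by auto
  ultimately obtain d where "d > 0" "\<forall>z\<in>(\<lambda>v. v 0) ` S. d \<le> dist y z"
    using separate_point_closed[OF compact_imp_closed] by blast
  then show ?thesis by (intro exI[of _ d]) (auto simp: dist_norm norm_minus_commute)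
qed

lemma sum_root_of_unity_powers:
  fixes u :: complex
  assumes "N \<ge> 1" "u ^ N = 1"
  shows "(\<Sum>j<N. u ^ j) = (if u = 1 then of_nat N else 0)"
  using assms geometric_sum[of u N] by auto

section \<open>The space of roots and its bump functions\<close>

context base_algebra
begin

text \<open>Coordinate \<open>0\<close> of a point of \<open>X\<close> is its projection to \<open>K\<close>, and coordinate \<open>Suc k\<close> is an
  \<open>N\<close>-th root of the bump function \<open>H i\<close>, where \<open>k\<close> encodes the pair \<open>(i, N - 1)\<close>.\<close>

definition root_fun :: "nat \<Rightarrow> complex \<Rightarrow> complex" where "root_fun k = H (fst (prod_decode k))"
definition root_deg :: "nat \<Rightarrow> nat" where "root_deg k = Suc (snd (prod_decode k))"

definition X :: "(nat \<Rightarrow> complex) set" where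
  "X = {v. v 0 \<in> K \<and> (\<forall>k. v (Suc k) ^ root_deg k = root_fun k (v 0))}"

text \<open>The whole closed base algebra is pulled back, not only its generators. So
  \<open>root_fun k\<close>, a uniform limit, is itself a generator, and a full power of a root can
  be replaced by it within \<open>alg\<close>.\<close>

definition base_gens :: "((nat \<Rightarrow> complex) \<Rightarrow> complex) set" where
  "base_gens = (\<lambda>a v. a (v 0)) ` ualg K G"

definition XG :: "((nat \<Rightarrow> complex) \<Rightarrow> complex) set" where
  "XG = base_gens \<union> range (\<lambda>k v. v (Suc k))"

definition pt :: "complex \<Rightarrow> nat \<Rightarrow> complex" where "pt x i = (if i = 0 then x else 0)"

abbreviation UX :: "((nat \<Rightarrow> complex) \<Rightarrow> complex) set" where "UX \<equiv> ualg X XG"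

lemma root_deg_ge_1: "1 \<le> root_deg k" unfolding root_deg_def by simp

lemma bounded_gens_K: "bounded_gens K G" by (rule bounded_gens_compact[OF compact_K gens_cont])

lemma root_fun_mem: "root_fun k \<in> ualg K G" unfolding root_fun_def by (rule H_mem)

lemma base_continuous: "a \<in> ualg K G \<Longrightarrow> continuous_on K a"
  using ualg_continuous_on gens_cont by blast

lemma root_fun_F: "x \<in> F \<Longrightarrow> root_fun k x = 0"
  using H_F[of x "fst (prod_decode k)"] F_sub unfolding root_fun_def by force

lemma compact_X: "compact X"
proof -
  have "\<exists>C>0. \<forall>z\<in>K. cmod (root_fun k z) \<le> C" for k
    by (rule ualg_bounded[OF root_fun_mem bounded_gens_K])
  then obtain C where C: "\<And>k. C k > 0" "\<And>k z. z \<in> K \<Longrightarrow> cmod (root_fun k z) \<le> C k" by metis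
  \<comment> \<open>A root of modulus above 1 is at most as large as its own power, hence at most
    \<open>C k\<close>; the maximum with 1 covers the other case.\<close>
  define B where "B i = (case i of 0 \<Rightarrow> K | Suc k \<Rightarrow> cball 0 (max 1 (C k)))" for i
  have "compactin (product_topology (\<lambda>_. euclidean) UNIV) (PiE UNIV B)"
    unfolding compactin_PiE by (auto simp: B_def compact_K split: nat.splits)
  then have cB: "compact (PiE UNIV B)" by (simp add: euclidean_product_topology)
  have "X = PiE UNIV B \<inter> (\<Inter>k. {v \<in> PiE UNIV B. v (Suc k) ^ root_deg k - root_fun k (v 0) = 0})"
  proof
    show "X \<subseteq> PiE UNIV B \<inter> (\<Inter>k. {v \<in> PiE UNIV B. v (Suc k) ^ root_deg k - root_fun k (v 0) = 0})"
    proof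
      fix v assume v: "v \<in> X"
      have "v (Suc k) \<in> cball 0 (max 1 (C k))" for k
      proof (rule ccontr)
        assume "\<not> ?thesis"
        then have 1: "1 < cmod (v (Suc k))" "C k < cmod (v (Suc k))" by auto
        then have "cmod (v (Suc k)) ^ 1 \<le> cmod (v (Suc k)) ^ root_deg k"
          using root_deg_ge_1 by (intro power_increasing) auto
        also have "\<dots> = cmod (root_fun k (v 0))" using v unfolding X_def by (simp flip: norm_power)
        also have "\<dots> \<le> C k" using v C(2) unfolding X_def by blast
        finally show False using 1 by simp
      qed
      then have "v \<in> PiE UNIV B" using v unfolding X_def B_def by (auto split: nat.splits)
      then show "v \<in> PiE UNIV B \<inter> (\<Inter>k. {v \<in> PiE UNIV B. v (Suc k) ^ root_deg k - root_fun k (v 0) = 0})"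
        using v unfolding X_def by auto
    qed
    show "PiE UNIV B \<inter> (\<Inter>k. {v \<in> PiE UNIV B. v (Suc k) ^ root_deg k - root_fun k (v 0) = 0}) \<subseteq> X"
      unfolding X_def by (auto simp: B_def dest: PiE_mem[of _ UNIV _ 0])
  qed
  moreover have "closed {v \<in> PiE UNIV B. v (Suc k) ^ root_deg k - root_fun k (v 0) = 0}" for k
  proof (rule continuous_closed_preimage_constant)
    have "continuous_on (PiE UNIV B) (\<lambda>v. root_fun k (v 0))"
      by (rule continuous_on_compose2[OF base_continuous[OF root_fun_mem] continuous_on_coord])
        (auto simp: B_def dest: PiE_mem[of _ UNIV _ 0])
    then show "continuous_on (PiE UNIV B) (\<lambda>v. v (Suc k) ^ root_deg k - root_fun k (v 0))"
      by (intro continuous_intros continuous_on_coord)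
  qed (use cB compact_imp_closed in blast)
  ultimately show ?thesis using cB by (metis (no_types, lifting) closed_INT compact_Int_closed)
qed

lemma XG_continuous:
  assumes "s \<in> XG"
  shows "continuous_on X s"
proof -
  have "continuous_on X (\<lambda>v. a (v 0))" if "a \<in> ualg K G" for a
    by (rule continuous_on_compose2[OF base_continuous[OF that] continuous_on_coord]) (auto simp: X_def)
  then show ?thesis using assms unfolding XG_def base_gens_def by (auto intro: continuous_on_coord)
qed

lemma bounded_XG: "bounded_gens X XG" by (rule bounded_gens_compact[OF compact_X XG_continuous])

lemma base_in_XG: "a \<in> ualg K G \<Longrightarrow> (\<lambda>v. a (v 0)) \<in> UX"
  unfolding XG_def base_gens_def by (intro ualg_gen) auto

lemma coord_in_XG: "(\<lambda>v. v (Suc k)) \<in> alg XG"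
  unfolding XG_def by (intro alg_gen) auto

lemma fibre_nonempty:
  assumes "z \<in> K"
  shows "\<exists>v\<in>X. v 0 = z"
proof -
  have "\<exists>w. w ^ root_deg k = root_fun k z" for k
    using exists_complex_root[of "root_deg k" "root_fun k z"] root_deg_ge_1[of k] by (metis not_one_le_zero)
  then obtain w where "\<And>k. w k ^ root_deg k = root_fun k z" by metis
  then show ?thesis using assms
    by (intro bexI[of _ "\<lambda>i. case i of 0 \<Rightarrow> z | Suc k \<Rightarrow> w k"]) (auto simp: X_def)
qed

lemma pt_mem: "x \<in> F \<Longrightarrow> pt x \<in> X"
  using F_sub root_fun_F unfolding X_def pt_def root_deg_def by auto

lemma fibre_F:
  assumes "v \<in> X" "v 0 \<in> F"
  shows "v = pt (v 0)"
proof
  fix i show "v i = pt (v 0) i"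
  proof (cases i)
    case (Suc k)
    have "v (Suc k) ^ root_deg k = 0" using assms root_fun_F unfolding X_def by auto
    then show ?thesis using Suc unfolding pt_def by simp
  qed (simp add: pt_def)
qed

text \<open>The fibre over \<open>x\<close> is the single point \<open>pt x\<close>, so by
  compactness \<open>U\<close> contains all points of \<open>X\<close> over a neighbourhood of
  \<open>x\<close>, and a bump of the base algebra suffices.\<close>

lemma bump_at_F:
  assumes x: "x \<in> F" and U: "open U" "pt x \<in> U"
  shows "\<exists>e\<in>UX. const_near X (pt x) e 1 \<and> (\<forall>v\<in>X - U. e v = 0)"
proof -
  have "compact (X - U)" using compact_X U by (simp add: compact_diff)
  moreover have "v 0 \<noteq> x" if "v \<in> X - U" for v using that fibre_F[of v] x U by auto
  ultimately obtain r where r: "r > 0" "\<forall>v\<in>X - U. r \<le> cmod (v 0 - x)"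
    using compact_avoiding_fibre by blast
  obtain h r' where h: "h \<in> ualg K G" "r' > 0"
    "\<forall>z\<in>K. (cmod (z - x) < r' \<longrightarrow> h z = 1) \<and> (r \<le> cmod (z - x) \<longrightarrow> h z = 0)"
    using F_bump[OF x r(1)] by blast
  have "open {v :: nat \<Rightarrow> complex. cmod (v 0 - x) < r'}"
    by (intro open_Collect_less continuous_intros continuous_on_coord)
  then show ?thesis
    using h r by (intro bexI[OF _ base_in_XG[OF h(1)]] conjI exI[of _ "{v. cmod (v 0 - x) < r'}"])
      (auto simp: X_def pt_def)
qed

text \<open>Over a point off \<open>F\<close> the fibre consists of choices of roots of unity. A product of
  averages \<open>(1/N) \<Sum> (v k / x k)^j\<close> singles out a point of the fibre up to finitely many
  coordinates, and iterating \<open>sharpen\<close> turns it into an idempotent near the fibre.\<close>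

lemma bump_off_F:
  assumes x: "x \<in> X" "x 0 \<notin> F" and U: "open U" "x \<in> U" and \<epsilon>: "\<epsilon> > 0"
  shows "\<exists>e\<in>UX. const_near X x e 1 \<and> (\<forall>v\<in>X - U. e v = 0) \<and>
    (\<forall>v\<in>X. cmod (e v) \<le> 1 + \<epsilon>)"
proof -
  define y where "y = x 0"
  have yK: "y \<in> K - F" using x unfolding y_def X_def by auto
  have "openin (product_topology (\<lambda>i. euclidean) UNIV) U" using U(1) unfolding open_fun_def .
  from product_topology_open_contains_basis[OF this U(2)]
  obtain W where W: "x \<in> PiE UNIV W" "finite {i. W i \<noteq> UNIV}" "PiE UNIV W \<subseteq> U" by auto
  define S where "S = {k. W (Suc k) \<noteq> UNIV}"
  have finS: "finite S"
    using finite_vimageI[OF W(2), of Suc] unfolding S_def by (simp add: vimage_def)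
  \<comment> \<open>If \<open>x (Suc k) = 0\<close>, the whole fibre has this coordinate 0, so there
    is nothing to select and the factor is 1.\<close>
  define P where "P k w = (if x (Suc k) = 0 then 1 else
      (1 / of_nat (root_deg k)) * (\<Sum>j<root_deg k. ((1 / x (Suc k)) * w) ^ j))" for k w
  define p where "p v = (\<Prod>k\<in>S. P k (v (Suc k)))" for v :: "nat \<Rightarrow> complex"
  have pcoord: "p \<in> alg (range (\<lambda>k v. v (Suc k)))"
    unfolding p_def[abs_def]
  proof (intro alg_prod)
    fix k
    show "(\<lambda>v. P k (v (Suc k))) \<in> alg (range (\<lambda>k v. v (Suc k)))"
    proof (cases "x (Suc k) = 0")
      case True
      then show ?thesis unfolding P_def by (simp add: alg.const)
    next
      case False
      then show ?thesis unfolding P_def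
        by (simp only: if_False) (intro alg_cmult alg_sum alg_power alg_gen rangeI)
    qed
  qed
  have palg: "p \<in> alg XG" using pcoord alg_mono unfolding XG_def by blast
  have pcont: "continuous_on A p" for A
    by (rule alg_continuous_on[OF pcoord]) (auto intro: continuous_on_coord)
  have Pval: "P k (v (Suc k)) = (if v (Suc k) = x (Suc k) then 1 else 0)" if v: "v \<in> X" "v 0 = y" for v k
  proof -
    have vx: "v (Suc k) ^ root_deg k = x (Suc k) ^ root_deg k"
      using v x unfolding X_def y_def by auto
    show ?thesis
    proof (cases "x (Suc k) = 0")
      case True
      then have "v (Suc k) = 0" using vx root_deg_ge_1[of k] by (simp add: power_0_left)
      then show ?thesis using True unfolding P_def by simp
    next
      case False
      define u where "u = (1 / x (Suc k)) * v (Suc k)"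
      have "u ^ root_deg k = 1" unfolding u_def using vx False by (simp add: power_mult_distrib power_divide)
      then have "(\<Sum>j<root_deg k. u ^ j) = (if u = 1 then of_nat (root_deg k) else 0)"
        using sum_root_of_unity_powers root_deg_ge_1 by blast
      moreover have "u = 1 \<longleftrightarrow> v (Suc k) = x (Suc k)" unfolding u_def using False by (auto simp: field_simps)
      ultimately show ?thesis unfolding P_def u_def[symmetric] using False root_deg_ge_1[of k] by auto
    qed
  qed
  have px: "p x = 1" unfolding p_def using Pval[OF x(1)] by (simp add: y_def)
  have fibre: "p v = 0 \<or> p v = 1 \<and> v \<in> U" if v: "v \<in> X" "v 0 = y" for v
  proof (cases "\<forall>k\<in>S. v (Suc k) = x (Suc k)")
    case True
    have "p v = 1" unfolding p_def
    proof (intro prod.neutral ballI)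
      fix k assume "k \<in> S"
      then show "P k (v (Suc k)) = 1" using True Pval[OF v, of k] by (simp split: if_splits)
    qed
    moreover have "v i \<in> W i" for i
    proof (cases i)
      case 0
      then show ?thesis using W(1) v(2) unfolding y_def by auto
    next
      case (Suc k)
      then show ?thesis using True W(1) unfolding S_def by (cases "k \<in> S") (auto simp: S_def)
    qed
    ultimately show ?thesis using W(3) by auto
  next
    case False
    then show ?thesis using finS unfolding p_def by (auto simp: Pval[OF v])
  qed
  \<comment> \<open>The points where \<open>p\<close> is neither near 0 nor, inside
    \<open>U\<close>, near 1. None lies over \<open>y\<close>, so over a small disc about
    \<open>y\<close> the dichotomy holds.\<close>
  define Bad where "Bad = X \<inter> ({v. 1/8 \<le> cmod (p v)} \<inter> ({v. 1/8 \<le> cmod (p v - 1)} \<union> - U))"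
  have "compact Bad" unfolding Bad_def
    using U(1) by (intro compact_Int_closed compact_X closed_Int closed_Un closed_Collect_le
      continuous_intros pcont) auto
  moreover have "v 0 \<noteq> y" if "v \<in> Bad" for v using fibre[of v] that unfolding Bad_def by auto
  ultimately obtain r where r: "r > 0" "\<forall>v\<in>Bad. r \<le> cmod (v 0 - y)"
    using compact_avoiding_fibre by blast
  have good: "cmod (p v) < 1/8 \<or> cmod (p v - 1) < 1/8 \<and> v \<in> U" if "v \<in> X" "cmod (v 0 - y) < r" for v
    using r that unfolding Bad_def by force
  obtain i r' where i: "r' > 0" "\<forall>z\<in>K. (cmod (z - y) < r' \<longrightarrow> H i z = 1) \<and> (r \<le> cmod (z - y) \<longrightarrow> H i z = 0)"
    using H_bump[OF yK r(1)] by blast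
  obtain C where C: "C > 0" "\<forall>z\<in>K. cmod (H i z) \<le> C" using ualg_bounded[OF H_mem bounded_gens_K] by blast
  \<comment> \<open>With this \<open>N0\<close> the root of degree \<open>Suc N0\<close> of the bump
    \<open>H i\<close> has modulus at most \<open>1 + \<epsilon>\<close>, whatever the norm of the
    bump; the index \<open>k\<close> below selects that root.\<close>
  obtain N0 where "C < (1 + \<epsilon>) ^ N0" using real_arch_pow[of "1 + \<epsilon>" C] \<epsilon> by auto
  also have "\<dots> \<le> (1 + \<epsilon>) ^ Suc N0" using \<epsilon> by (intro power_increasing) auto
  finally have N0: "C < (1 + \<epsilon>) ^ Suc N0" .
  define k where "k = prod_encode (i, N0)"
  have k: "root_fun k = H i" "root_deg k = Suc N0" unfolding k_def root_fun_def root_deg_def by simp_all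
  have vk: "v (Suc k) ^ Suc N0 = H i (v 0)" if "v \<in> X" for v
  proof -
    have "v (Suc k) ^ root_deg k = root_fun k (v 0)" using that unfolding X_def by blast
    then show ?thesis by (simp only: k)
  qed
  have xk: "x (Suc k) ^ Suc N0 = 1" using vk[OF x(1)] i yK y_def by auto
  then have "cmod (x (Suc k)) ^ Suc N0 = 1" by (metis norm_one norm_power)
  then have xk1: "cmod (x (Suc k)) = 1" using power_eq_imp_eq_base[of "cmod (x (Suc k))" "Suc N0" 1] by simp
  then have xk0: "x (Suc k) \<noteq> 0" by auto
  define e1 where "e1 v = (1 / x (Suc k)) * v (Suc k)" for v :: "nat \<Rightarrow> complex"
  have e1U: "e1 \<in> UX" unfolding e1_def[abs_def] by (intro alg_imp_ualg alg_cmult coord_in_XG)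
  have e1le: "cmod (e1 v) \<le> 1 + \<epsilon>" if v: "v \<in> X" for v
  proof -
    have "cmod (v (Suc k)) ^ Suc N0 = cmod (H i (v 0))" unfolding vk[OF v, symmetric] by (rule norm_power[symmetric])
    also have "\<dots> \<le> C" using C(2) v unfolding X_def by blast
    also note N0
    finally have lt: "cmod (v (Suc k)) ^ Suc N0 < (1 + \<epsilon>) ^ Suc N0" .
    have "cmod (v (Suc k)) \<le> 1 + \<epsilon>"
      by (rule power_le_imp_le_base[OF less_imp_le[OF lt]]) (use \<epsilon> in simp)
    then show ?thesis unfolding e1_def by (simp add: norm_mult norm_divide xk1)
  qed
  have e10: "e1 v = 0" if "v \<in> X" "r \<le> cmod (v 0 - y)" for v
  proof -
    have "v (Suc k) ^ Suc N0 = 0" using vk[OF that(1)] i(2) that unfolding X_def by auto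
    then show ?thesis unfolding e1_def by auto
  qed
  define e where "e v = (if cmod (p v - 1) \<le> 1/8 then e1 v else 0)" for v
  have eU: "e \<in> UX"
    unfolding e_def[abs_def]
  proof (rule ualg_local_idempotent[OF bounded_XG e1U alg_imp_ualg[OF palg]])
    show "e1 v = 0 \<or> cmod (p v) \<le> 1/8 \<or> cmod (p v - 1) \<le> 1/8" if "v \<in> X" for v
      using good[OF that] e10[OF that] by (cases "cmod (v 0 - y) < r") auto
  qed
  have off: "e v = 0" if v: "v \<in> X - U" for v
  proof (cases "cmod (v 0 - y) < r")
    case True
    then have "cmod (p v) < 1/8" using good[of v] v by auto
    then show ?thesis unfolding e_def using norm_triangle_ineq4[of "p v" "p v - 1"] by auto
  qed (use e10[of v] v in \<open>auto simp: e_def\<close>)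
  \<comment> \<open>The remaining roots of 1. Staying away from them forces
    \<open>v (Suc k) = x (Suc k)\<close>, so \<open>e\<close> is exactly 1 on
    \<open>V \<inter> X\<close>.\<close>
  define R where "R = {w. w ^ Suc N0 = (1::complex)} - {x (Suc k)}"
  define V where "V = {v. cmod (v 0 - y) < r'} \<inter> {v. cmod (p v - 1) < 1/8} \<inter> (\<lambda>v. v (Suc k)) -` (- R)"
  have "finite R" unfolding R_def using finite_roots_unity[of "Suc N0"] by simp
  then have "open V" unfolding V_def
    by (intro open_Int open_Collect_less open_vimage continuous_intros continuous_on_coord pcont open_Compl finite_imp_closed)
  moreover have "x \<in> V" unfolding V_def R_def using i px y_def by auto
  moreover have "e v = 1" if v: "v \<in> V \<inter> X" for v
  proof -
    have "v (Suc k) ^ Suc N0 = 1" using vk[of v] v i(2) unfolding V_def X_def by auto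
    then have "v (Suc k) = x (Suc k)" using v unfolding V_def R_def by auto
    then show ?thesis using v xk0 unfolding e_def e1_def V_def by auto
  qed
  moreover have "cmod (e v) \<le> 1 + \<epsilon>" if "v \<in> X" for v
    using e1le[OF that] \<epsilon> unfolding e_def by auto
  ultimately show ?thesis using eU off by blast
qed

text \<open>Only generators need checking. For pulled back functions the approximation comes from
  the base; an adjoined root already vanishes near \<open>pt x\<close>, because the function it is a
  root of vanishes near \<open>x\<close>.\<close>

lemma regular_at_F:
  assumes x: "x \<in> F" and f: "f \<in> UX"
  shows "(\<lambda>v. f v - f (pt x)) \<in> zero_closure X (UX) (pt x)"
proof (rule zero_closure_ualg[OF bounded_XG f pt_mem[OF x]])
  have op: "open {v :: nat \<Rightarrow> complex. v 0 \<in> V}" if "open V" for V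
    using open_vimage[OF that continuous_on_product_coordinates[of 0]] by (simp add: vimage_def)
  fix s assume "s \<in> XG"
  then consider a where "a \<in> ualg K G" "s = (\<lambda>v. a (v 0))" | k where "s = (\<lambda>v. v (Suc k))"
    unfolding XG_def base_gens_def by blast
  then show "(\<lambda>v. s v - s (pt x)) \<in> zero_closure X (UX) (pt x)"
  proof cases
    case 1
    show ?thesis
    proof (rule zero_closureI)
      fix e :: real assume "e > 0"
      then obtain g V where g: "g \<in> ualg K G" "open V" "x \<in> V" "\<And>y. y \<in> V \<Longrightarrow> y \<in> K \<Longrightarrow> g y = 0"
        "\<And>y. y \<in> K \<Longrightarrow> cmod (a y - a x - g y) < e"
        using zero_closureE[OF F_regular[OF x 1(1)]] by blast
      show "\<exists>g\<in>UX. const_near X (pt x) g 0 \<and>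
          (\<forall>y\<in>X. cmod (s y - s (pt x) - g y) < e)"
        using g op[OF g(2)] unfolding 1(2)
        by (intro bexI[OF _ base_in_XG[OF g(1)]] conjI exI[of _ "{v. v 0 \<in> V}"]) (auto simp: pt_def X_def)
    qed
  next
    case 2
    obtain r where r: "r > 0" "\<forall>z\<in>K. cmod (z - x) < r \<longrightarrow> root_fun k z = 0"
      using H_F[OF x] unfolding root_fun_def by blast
    have z: "s v - s (pt x) = 0" if "v \<in> {v. v 0 \<in> ball x r}" "v \<in> X" for v
    proof -
      have "v (Suc k) ^ root_deg k = 0" using that r unfolding X_def by (auto simp: dist_norm norm_minus_commute)
      then show ?thesis unfolding 2 pt_def by simp
    qed
    have "(\<lambda>v. s v - s (pt x)) \<in> UX"
      unfolding 2 by (intro ualg_diff alg_imp_ualg coord_in_XG alg.const bounded_XG)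
    then show ?thesis
      by (rule zero_closure_near[OF _ op[of "ball x r"]]) (use z r in \<open>auto simp: pt_def\<close>)
  qed
qed

section \<open>Averaging over roots and the estimate at \<open>F\<close> on the extension\<close>

definition partial_gens :: "nat \<Rightarrow> ((nat \<Rightarrow> complex) \<Rightarrow> complex) set" where
  "partial_gens m = base_gens \<union> (\<lambda>k v. v (Suc k)) ` {..<m}"

lemma partial_gens_mono: "m \<le> n \<Longrightarrow> partial_gens m \<subseteq> partial_gens n"
  unfolding partial_gens_def by auto

lemma alg_XG_partial:
  assumes "f \<in> alg XG"
  shows "\<exists>m. f \<in> alg (partial_gens m)"
  using assms
proof (induction rule: alg.induct)
  case (const c)
  show ?case by (blast intro: alg.const)
next
  case (add f g)
  then obtain m n where "f \<in> alg (partial_gens m)" "g \<in> alg (partial_gens n)" by blast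
  then have "f \<in> alg (partial_gens (max m n))" "g \<in> alg (partial_gens (max m n))"
    using alg_mono[OF partial_gens_mono] by (meson max.cobounded1 max.cobounded2 subsetD)+
  then show ?case by (blast intro: alg.add)
next
  case (gen_mult s f)
  then obtain m where m: "f \<in> alg (partial_gens m)" by blast
  obtain n where n: "s \<in> partial_gens n"
    using gen_mult.hyps unfolding XG_def partial_gens_def by (auto simp: image_iff)
  have "f \<in> alg (partial_gens (max m n))" "s \<in> partial_gens (max m n)"
    using m n alg_mono[OF partial_gens_mono] partial_gens_mono by (meson max.cobounded1 max.cobounded2 subsetD)+
  then show ?case by (blast intro: alg.gen_mult)
qed

text \<open>Deck transformations of the adjunction of one root: the coordinate is multiplied by a
  root of unity and the base point is kept.\<close>

definition rotation :: "nat \<Rightarrow> nat \<Rightarrow> (nat \<Rightarrow> complex) \<Rightarrow> nat \<Rightarrow> complex" where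
  "rotation m j v = v(Suc m := exp (2 * of_real pi * \<i> * of_nat j / of_nat (root_deg m)) * v (Suc m))"

lemma rotation_mem: "v \<in> X \<Longrightarrow> rotation m j v \<in> X"
  unfolding X_def rotation_def using complex_root_unity[of "root_deg m" j] root_deg_ge_1[of m]
  by (auto simp: power_mult_distrib)

lemma rotation_pt: "rotation m j (pt x) = pt x"
  unfolding rotation_def pt_def by auto

text \<open>Averaging over the roots of one coordinate kills all powers of it except those
  which are powers of the base function of which it is a root.\<close>

lemma average_step:
  assumes "f \<in> alg (partial_gens (Suc m))"
  shows "\<exists>f'\<in>alg (partial_gens m). \<forall>v\<in>X.
    f' v = (\<Sum>j<root_deg m. f (rotation m j v) * rotation m j v (Suc m) ^ i) / of_nat (root_deg m)"
  using assms
\<comment> \<open>The exponent \<open>i\<close> accumulates the occurrences of the coordinate being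
  eliminated: each generator \<open>v (Suc m)\<close> that is peeled off raises it by one.\<close>
proof (induction arbitrary: i rule: alg.induct)
  case (const c)
  let ?N = "root_deg m"
  define u where "u = exp (2 * of_real pi * \<i> * of_nat i / of_nat ?N)"
  have rot: "rotation m j v (Suc m) ^ i = u ^ j * v (Suc m) ^ i" for j v
  proof -
    have "exp (2 * of_real pi * \<i> * of_nat j / of_nat ?N) ^ i = u ^ j"
      unfolding u_def exp_of_nat_mult[symmetric] by (simp add: mult_ac)
    then show ?thesis unfolding rotation_def by (simp add: power_mult_distrib)
  qed
  have uN: "u ^ ?N = 1" unfolding u_def using complex_root_unity root_deg_ge_1[of m] by simp
  have eq: "(\<Sum>j<?N. c * rotation m j v (Suc m) ^ i) / of_nat ?N =
      c * v (Suc m) ^ i * (if u = 1 then 1 else 0)" for v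
  proof -
    have "(\<Sum>j<?N. c * rotation m j v (Suc m) ^ i) = c * v (Suc m) ^ i * (\<Sum>j<?N. u ^ j)"
      unfolding rot sum_distrib_left by (simp add: mult_ac)
    also have "\<dots> = c * v (Suc m) ^ i * (if u = 1 then of_nat ?N else 0)"
      using sum_root_of_unity_powers[OF root_deg_ge_1 uN] by simp
    finally show ?thesis using root_deg_ge_1[of m] by auto
  qed
  show ?case
  proof (cases "u = 1")
    case True
    then have "?N dvd i" unfolding u_def using complex_root_unity_eq_1[OF root_deg_ge_1] by blast
    then obtain t where t: "i = ?N * t" by blast
    have "(\<lambda>v. c * root_fun m (v 0) ^ t) \<in> alg (partial_gens m)"
      using root_fun_mem by (intro alg_cmult alg_power alg_gen) (auto simp: partial_gens_def base_gens_def)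
    moreover have "c * root_fun m (v 0) ^ t = c * v (Suc m) ^ i" if "v \<in> X" for v
      using that unfolding t power_mult X_def by simp
    ultimately show ?thesis unfolding eq using True by (intro bexI) auto
  next
    case False
    then show ?thesis unfolding eq by (intro bexI[OF _ alg.const[of 0]]) auto
  qed
next
  case (add f g)
  obtain f' where f': "f' \<in> alg (partial_gens m)" "\<forall>v\<in>X.
    f' v = (\<Sum>j<root_deg m. f (rotation m j v) * rotation m j v (Suc m) ^ i) / of_nat (root_deg m)"
    using add.IH(1) by blast
  obtain g' where g': "g' \<in> alg (partial_gens m)" "\<forall>v\<in>X.
    g' v = (\<Sum>j<root_deg m. g (rotation m j v) * rotation m j v (Suc m) ^ i) / of_nat (root_deg m)"
    using add.IH(2) by blast
  show ?case
    using f'(2) g'(2) by (intro bexI[OF _ alg.add[OF f'(1) g'(1)]])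
      (auto simp: sum.distrib distrib_right add_divide_distrib)
next
  case (gen_mult s f)
  show ?case
  proof (cases "s \<in> partial_gens m")
    case True
    then have inv: "s (rotation m j v) = s v" for j v
      unfolding partial_gens_def base_gens_def rotation_def by auto
    obtain f' where f': "f' \<in> alg (partial_gens m)" "\<forall>v\<in>X.
      f' v = (\<Sum>j<root_deg m. f (rotation m j v) * rotation m j v (Suc m) ^ i) / of_nat (root_deg m)"
      using gen_mult.IH by blast
    show ?thesis
      using f'(2) by (intro bexI[OF _ alg.gen_mult[OF True f'(1)]])
        (auto simp: inv sum_distrib_left mult.assoc)
  next
    case False
    then have s: "s = (\<lambda>v. v (Suc m))"
      using gen_mult.hyps unfolding partial_gens_def by (auto simp: less_Suc_eq)
    obtain f' where f': "f' \<in> alg (partial_gens m)" "\<forall>v\<in>X.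
      f' v = (\<Sum>j<root_deg m. f (rotation m j v) * rotation m j v (Suc m) ^ Suc i) / of_nat (root_deg m)"
      using gen_mult.IH by blast
    show ?thesis
      using f'(2) by (intro bexI[OF _ f'(1)]) (auto simp: s mult_ac)
  qed
qed

text \<open>Averaging over one coordinate does not increase the bound \<open>M\<close> and keeps the
  values at \<open>pt x\<close> and \<open>pt y\<close>, which the rotations fix. Roots are thus
  removed one at a time until a base function is left; its bound on \<open>K\<close> follows because
  all fibres are nonempty.\<close>

lemma variation_partial:
  assumes "f \<in> alg (partial_gens m)" "\<And>v. v \<in> X \<Longrightarrow> cmod (f v) \<le> M" and xy: "x \<in> F" "y \<in> F"
  shows "cmod (f (pt x) - f (pt y)) \<le> M"
  using assms(1,2)
proof (induction m arbitrary: f)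
  case 0
  have "\<exists>a\<in>ualg K G. \<forall>v. f v = a (v 0)"
    using 0(1)
  proof (induction rule: alg.induct)
    case (const c)
    then show ?case by (intro bexI[OF _ ualg_const[of c]]) auto
  next
    case (add f g)
    then obtain a b where "a \<in> ualg K G" "b \<in> ualg K G" "\<forall>v. f v = a (v 0)" "\<forall>v. g v = b (v 0)" by blast
    then show ?case by (intro bexI[OF _ ualg_add[of a K G b]]) auto
  next
    case (gen_mult s f)
    then obtain a b where "a \<in> ualg K G" "b \<in> ualg K G" "\<forall>v. f v = a (v 0)" "\<forall>v. s v = b (v 0)"
      unfolding partial_gens_def base_gens_def by auto
    then show ?case by (intro bexI[OF _ ualg_mult[of b K G a]]) (auto simp: bounded_gens_K)
  qed
  then obtain a where a: "a \<in> ualg K G" "\<And>v. f v = a (v 0)" by blast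
  have "cmod (a z) \<le> M" if "z \<in> K" for z using fibre_nonempty[OF that] 0(2) a(2) by metis
  then show ?case using variation[OF a(1) xy] by (simp add: a(2) pt_def)
next
  case (Suc m)
  let ?N = "root_deg m"
  obtain f' where f': "f' \<in> alg (partial_gens m)" "\<forall>v\<in>X. f' v = (\<Sum>j<?N. f (rotation m j v)) / of_nat ?N"
    using average_step[OF Suc.prems(1), of 0] by auto
  have N: "0 < real ?N" using root_deg_ge_1[of m] by simp
  have "cmod (f' v) \<le> M" if v: "v \<in> X" for v
  proof -
    have "cmod (\<Sum>j<?N. f (rotation m j v)) \<le> (\<Sum>j<?N. M)"
      by (intro sum_norm_le Suc.prems(2) rotation_mem v)
    then have "cmod (\<Sum>j<?N. f (rotation m j v)) / ?N \<le> M" using N by (simp add: field_simps)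
    then show ?thesis using f'(2) v by (simp add: norm_divide)
  qed
  then have "cmod (f' (pt x) - f' (pt y)) \<le> M" by (rule Suc.IH[OF f'(1)])
  moreover have "f' (pt z) = f (pt z)" if "z \<in> F" for z
    using f'(2) pt_mem[OF that] N by (simp add: rotation_pt)
  ultimately show ?case using xy by simp
qed

lemma variation_X:
  assumes f: "f \<in> UX" and M: "\<And>v. v \<in> X \<Longrightarrow> cmod (f v) \<le> M" and xy: "x \<in> F" "y \<in> F"
  shows "cmod (f (pt x) - f (pt y)) \<le> M"
proof (rule field_le_epsilon)
  fix \<epsilon> :: real assume "\<epsilon> > 0"
  then obtain g where g: "g \<in> alg XG" "\<forall>v\<in>X. cmod (f v - g v) < \<epsilon> / 3"
    using ualgD[OF f, of "\<epsilon> / 3"] by auto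
  have "cmod (g v) \<le> M + \<epsilon> / 3" if "v \<in> X" for v
    using norm_triangle_ineq4[of "f v" "f v - g v"] M[OF that] g(2) that by fastforce
  moreover obtain m where "g \<in> alg (partial_gens m)" using alg_XG_partial[OF g(1)] by blast
  ultimately have "cmod (g (pt x) - g (pt y)) \<le> M + \<epsilon> / 3" using variation_partial xy by blast
  moreover have "cmod (f (pt x) - g (pt x)) < \<epsilon> / 3" "cmod (f (pt y) - g (pt y)) < \<epsilon> / 3"
    using g(2) xy pt_mem by auto
  ultimately show "cmod (f (pt x) - f (pt y)) \<le> M + \<epsilon>"
    using norm_diff_via[of "f (pt x)" "f (pt y)" "g (pt x)" "g (pt y)"] by linarith
qed

section \<open>Regularity, characters and separation of points off \<open>F\<close>\<close>

lemma off_F_iff: "v \<in> X \<Longrightarrow> v 0 \<in> F \<longleftrightarrow> v \<in> pt ` F"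
  using fibre_F[of v] by (auto simp: pt_def image_iff)

lemma bump:
  assumes "x \<in> X" "open U" "x \<in> U"
  shows "\<exists>e\<in>UX. const_near X x e 1 \<and> (\<forall>v\<in>X - U. e v = 0)"
proof (cases "x 0 \<in> F")
  case True
  then show ?thesis using bump_at_F[of "x 0" U] fibre_F[OF assms(1) True, symmetric] assms by simp
next
  case False
  show ?thesis
    using bump_off_F[OF assms(1) False assms(2,3) zero_less_one]
    by (elim bexE conjE) (intro bexI conjI; assumption)
qed

lemma open_near:
  assumes "f \<in> UX" "x \<in> X" "\<epsilon> > 0"
  shows "\<exists>U. open U \<and> x \<in> U \<and> (\<forall>v\<in>U \<inter> X. cmod (f v - f x) < \<epsilon>)"
proof -
  have "continuous_on X f" using assms(1) by (rule ualg_continuous_on) (rule XG_continuous)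
  then have "\<exists>U. open U \<and> U \<inter> X = f -` ball (f x) \<epsilon> \<inter> X"
    unfolding continuous_on_open_invariant by (elim allE impE) (rule open_ball)
  then obtain U where U: "open U" "U \<inter> X = f -` ball (f x) \<epsilon> \<inter> X" by blast
  have "x \<in> U" using U(2) assms(2,3) by (metis IntD1 IntI centre_in_ball vimageI2)
  moreover have "cmod (f v - f x) < \<epsilon>" if "v \<in> U \<inter> X" for v
    using that unfolding U(2) by (simp add: dist_norm norm_minus_commute)
  ultimately show ?thesis using U(1) by blast
qed

text \<open>Off \<open>F\<close>, a bump \<open>e\<close> of norm at most 2 supported where
  \<open>f - f x\<close> is small makes \<open>(f - f x) * (1 - e)\<close> the required
  approximation.\<close>

lemma regular:
  assumes x: "x \<in> X" and f: "f \<in> UX"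
  shows "(\<lambda>v. f v - f x) \<in> zero_closure X (UX) x"
proof (cases "x 0 \<in> F")
  case True
  then show ?thesis using regular_at_F[OF True f] fibre_F[OF x True, symmetric] by simp
next
  case False
  show ?thesis
  proof (rule zero_closureI)
    fix \<epsilon> :: real assume \<epsilon>: "\<epsilon> > 0"
    obtain U where U: "open U" "x \<in> U" "\<forall>v\<in>U \<inter> X. cmod (f v - f x) < \<epsilon> / 2"
      using open_near[OF f x, of "\<epsilon> / 2"] \<epsilon> by auto
    obtain e where e: "e \<in> UX" "const_near X x e 1"
      "\<forall>v\<in>X - U. e v = 0" "\<forall>v\<in>X. cmod (e v) \<le> 1 + 1"
      using bump_off_F[OF x False U(1,2) zero_less_one] by (elim bexE conjE)
    have mem: "(\<lambda>v. (f v - f x) * (1 - e v)) \<in> UX"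
      by (intro ualg_mult ualg_diff ualg_const f e(1) bounded_XG)
    have "cmod ((f v - f x) - (f v - f x) * (1 - e v)) < \<epsilon>" if v: "v \<in> X" for v
    proof (cases "v \<in> U")
      case True
      have "(f v - f x) - (f v - f x) * (1 - e v) = (f v - f x) * e v" by (simp add: algebra_simps)
      then have "cmod ((f v - f x) - (f v - f x) * (1 - e v)) = cmod (f v - f x) * cmod (e v)"
        by (simp only: norm_mult)
      also have "\<dots> \<le> cmod (f v - f x) * 2" using e(4) v by (intro mult_left_mono) auto
      also have "\<dots> < \<epsilon>" using U(3) True v by auto
      finally show ?thesis .
    qed (use e(3) v \<epsilon> in auto)
    then show "\<exists>g\<in>UX. const_near X x g 0 \<and>
        (\<forall>y\<in>X. cmod (f y - f x - g y) < \<epsilon>)"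
      using e(2) by (intro bexI[OF _ mem] conjI) auto
  qed
qed

text \<open>If near every point some function outside the kernel vanished, a finite product of these would
  vanish on \<open>X\<close>. So a character kills all functions vanishing near some point.\<close>

lemma character_is_evaluation:
  fixes \<Phi> :: "((nat \<Rightarrow> complex) \<Rightarrow> complex) \<Rightarrow> complex"
  assumes cong: "\<And>f g. f \<in> UX \<Longrightarrow> (\<And>v. v \<in> X \<Longrightarrow> f v = g v) \<Longrightarrow> \<Phi> f = \<Phi> g"
    and add: "\<And>f g. f \<in> UX \<Longrightarrow> g \<in> UX \<Longrightarrow> \<Phi> (\<lambda>v. f v + g v) = \<Phi> f + \<Phi> g"
    and mult: "\<And>f g. f \<in> UX \<Longrightarrow> g \<in> UX \<Longrightarrow> \<Phi> (\<lambda>v. f v * g v) = \<Phi> f * \<Phi> g"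
    and cmult: "\<And>f c. f \<in> UX \<Longrightarrow> \<Phi> (\<lambda>v. c * f v) = c * \<Phi> f"
    and nonzero: "\<exists>f\<in>UX. \<Phi> f \<noteq> 0"
  shows "\<exists>x\<in>X. \<forall>f\<in>UX. \<Phi> f = f x"
proof -
  obtain f0 where "f0 \<in> UX" "\<Phi> f0 \<noteq> 0" using nonzero by blast
  then have one: "\<Phi> (\<lambda>_. 1) = 1" using mult[OF ualg_const[of 1], of f0] by auto
  have const: "\<Phi> (\<lambda>_. c) = c" for c using cmult[OF ualg_const[of 1], of c] one by simp
  have diff: "\<Phi> (\<lambda>v. f v - g v) = \<Phi> f - \<Phi> g" if fg: "f \<in> UX" "g \<in> UX" for f g
    using add[OF fg(1) ualg_cmult[OF fg(2) bounded_XG, of "- 1"]] cmult[OF fg(2), of "- 1"] by simp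
  \<comment> \<open>If \<open>\<Phi> f\<close> exceeded \<open>M\<close> in modulus,
    \<open>1 - f / \<Phi> f\<close> would be invertible by the Neumann series and yet lie in the
    kernel.\<close>
  have bound: "cmod (\<Phi> f) \<le> M" if f: "f \<in> UX" and M: "\<And>v. v \<in> X \<Longrightarrow> cmod (f v) \<le> M" and "M > 0" for f M
  proof (rule ccontr)
    assume "\<not> ?thesis"
    then have lt: "M < cmod (\<Phi> f)" by simp
    define g where "g v = (1 / \<Phi> f) * f v" for v
    have g: "g \<in> UX" unfolding g_def[abs_def] by (intro ualg_cmult f bounded_XG)
    have \<Phi>g: "\<Phi> g = 1" unfolding g_def[abs_def] using cmult[OF f, of "1 / \<Phi> f"] lt \<open>M > 0\<close> by auto
    have q: "M / cmod (\<Phi> f) < 1" using lt \<open>M > 0\<close> divide_less_eq_1_pos[of "cmod (\<Phi> f)" M] by linarith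
    have gq: "cmod (g v) \<le> M / cmod (\<Phi> f)" if "v \<in> X" for v
      unfolding g_def using M[OF that] by (simp add: norm_mult norm_divide divide_right_mono)
    have h: "(\<lambda>v. inverse (1 - g v)) \<in> UX"
      by (rule ualg_inverse_one_minus[OF g bounded_XG q gq])
    have "\<Phi> (\<lambda>v. (1 - g v) * inverse (1 - g v)) = \<Phi> (\<lambda>v. 1 - g v) * \<Phi> (\<lambda>v. inverse (1 - g v))"
      by (intro mult ualg_diff ualg_const g h bounded_XG)
    also have "\<Phi> (\<lambda>v. 1 - g v) = 0" using diff[OF ualg_const[of 1] g] one \<Phi>g by simp
    also have "\<Phi> (\<lambda>v. (1 - g v) * inverse (1 - g v)) = \<Phi> (\<lambda>_. 1)"
    proof (rule cong)
      show "(\<lambda>v. (1 - g v) * inverse (1 - g v)) \<in> UX"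
        by (intro ualg_mult ualg_diff ualg_const g h bounded_XG)
      show "(1 - g v) * inverse (1 - g v) = 1" if "v \<in> X" for v
        using gq[OF that] q by (intro right_inverse) auto
    qed
    finally show False using one by simp
  qed
  have prod: "\<Phi> (\<lambda>v. \<Prod>i\<in>I. f i v) = (\<Prod>i\<in>I. \<Phi> (f i))" if "finite I" "\<And>i. f i \<in> UX"
    for I :: "(nat \<Rightarrow> complex) set" and f
    using that(1)
  proof (induction I)
    case (insert i I)
    then show ?case using mult[OF that(2)[of i] ualg_prod[of I f, OF that(2) bounded_XG]] by simp
  qed (simp add: one)
  have "\<exists>x\<in>X. \<forall>f\<in>UX. const_near X x f 0 \<longrightarrow> \<Phi> f = 0"
  proof (rule ccontr)
    assume neg: "\<not> ?thesis"
    have "\<forall>x. \<exists>f V. f \<in> UX \<and> \<Phi> f \<noteq> 0 \<and> (x \<in> X \<longrightarrow> open V \<and> x \<in> V \<and> (\<forall>v\<in>V \<inter> X. f v = 0))"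
    proof
      fix x
      show "\<exists>f V. f \<in> UX \<and> \<Phi> f \<noteq> 0 \<and> (x \<in> X \<longrightarrow> open V \<and> x \<in> V \<and> (\<forall>v\<in>V \<inter> X. f v = 0))"
      proof (cases "x \<in> X")
        case True
        then show ?thesis using neg by blast
      next
        case False
        then show ?thesis using ualg_const[of 1 X XG] one by force
      qed
    qed
    from choice[OF this] obtain f where
      "\<forall>x. \<exists>V. f x \<in> UX \<and> \<Phi> (f x) \<noteq> 0 \<and> (x \<in> X \<longrightarrow> open V \<and> x \<in> V \<and> (\<forall>v\<in>V \<inter> X. f x v = 0))" ..
    from choice[OF this] obtain V where
      fV: "\<forall>x. f x \<in> UX \<and> \<Phi> (f x) \<noteq> 0 \<and> (x \<in> X \<longrightarrow> open (V x) \<and> x \<in> V x \<and> (\<forall>v\<in>V x \<inter> X. f x v = 0))" ..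
    have "X \<subseteq> (\<Union>x\<in>X. V x)" using fV by blast
    then obtain I where I: "I \<subseteq> X" "finite I" "X \<subseteq> (\<Union>x\<in>I. V x)"
      using compactE_image[OF compact_X, of X V] fV by metis
    have "\<Phi> (\<lambda>v. \<Prod>i\<in>I. f i v) = \<Phi> (\<lambda>_. 0)"
    proof (rule cong)
      show "(\<lambda>v. \<Prod>i\<in>I. f i v) \<in> UX" using fV by (intro ualg_prod bounded_XG) auto
      fix v assume v: "v \<in> X"
      then obtain i where i: "i \<in> I" "v \<in> V i" using I by blast
      then have "f i v = 0" using fV v I(1) by blast
      then show "(\<Prod>i\<in>I. f i v) = 0" using i I(2) by auto
    qed
    then have "(\<Prod>i\<in>I. \<Phi> (f i)) = 0" using prod[OF I(2), of f] fV const[of 0] by simp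
    then show False using fV I(2) by auto
  qed
  then obtain x where x: "x \<in> X"
    and kill: "\<And>f V. f \<in> UX \<Longrightarrow> open V \<Longrightarrow> x \<in> V \<Longrightarrow> (\<forall>v\<in>V \<inter> X. f v = 0) \<Longrightarrow> \<Phi> f = 0"
    by blast
  \<comment> \<open>By regularity \<open>f - f x\<close> is a uniform limit of functions vanishing
    near \<open>x\<close>, which \<open>\<Phi>\<close> kills; \<open>bound\<close> carries this over
    to the limit.\<close>
  have "\<Phi> f = f x" if f: "f \<in> UX" for f
  proof -
    have fx: "(\<lambda>v. f v - f x) \<in> UX" by (intro ualg_diff ualg_const f bounded_XG)
    have "cmod (\<Phi> (\<lambda>v. f v - f x)) \<le> 0 + \<epsilon>" if \<epsilon>: "\<epsilon> > 0" for \<epsilon>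
    proof -
      obtain g V where g: "g \<in> UX" "open V" "x \<in> V" "\<forall>v\<in>V \<inter> X. g v = 0"
          "\<forall>v\<in>X. cmod (f v - f x - g v) < \<epsilon>"
        by (rule zero_closureE[OF regular[OF x f] \<epsilon>]) blast
      have "cmod (\<Phi> (\<lambda>v. (f v - f x) - g v)) \<le> \<epsilon>"
        using g \<epsilon> by (intro bound ualg_diff fx bounded_XG) (auto intro: less_imp_le)
      then show ?thesis using diff[OF fx g(1)] kill[OF g(1-4)] by simp
    qed
    then have "cmod (\<Phi> (\<lambda>v. f v - f x)) \<le> 0" by (rule field_le_epsilon)
    then show ?thesis using diff[OF f ualg_const[of "f x"]] const[of "f x"] by simp
  qed
  then show ?thesis using x by blast
qed

text \<open>A bump at \<open>x\<close> that is 0 at \<open>y\<close>, scaled by \<open>t\<close>,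
  has norm at most 1 and the values \<open>t\<close> and 0 at the two points. The disc automorphism
  taking \<open>w\<close> to \<open>(w - r) / (1 - r * w)\<close> sends 0 to \<open>- r\<close>, and
  it sends \<open>t\<close> to \<open>r\<close> precisely for
  \<open>t = 2 * r / (1 + r\<^sup>2)\<close>. Here \<open>t < 1\<close>, so a bump of norm at most
  \<open>1 / t\<close> is enough.\<close>

lemma separated_from_part:
  assumes x: "x \<in> X" "x 0 \<notin> F" and y: "y \<in> X" "y \<noteq> x" and r: "0 < r" "r < 1"
  shows "\<exists>f\<in>UX. (\<forall>v\<in>X. cmod (f v) \<le> 1) \<and> f x - f y = of_real (2 * r)"
proof -
  define t where "t = 2 * r / (1 + r\<^sup>2)"
  have "0 < (1 - r)\<^sup>2" using r by simp
  then have "2 * r < 1 + r\<^sup>2" by (simp add: power2_eq_square algebra_simps)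
  then have t: "0 < t" "t < 1" "t * (1 + r\<^sup>2) = 2 * r" unfolding t_def using r
    by (auto simp: divide_simps add_pos_nonneg)
  define \<epsilon> where "\<epsilon> = 1 / t - 1"
  have \<epsilon>: "\<epsilon> > 0" "t * (1 + \<epsilon>) = 1" unfolding \<epsilon>_def using t by (auto simp: field_simps)
  have "open (- {y})" by auto
  then obtain e where e: "e \<in> UX" "const_near X x e 1"
      "\<forall>v\<in>X - (- {y}). e v = 0" "\<forall>v\<in>X. cmod (e v) \<le> 1 + \<epsilon>"
    using bump_off_F[OF x, of "- {y}" \<epsilon>] y \<epsilon> by auto
  have ex: "e x = 1" "e y = 0" using e x y by auto
  define g where "g v = of_real t * e v" for v
  have g: "g \<in> UX" unfolding g_def[abs_def] by (intro ualg_cmult e bounded_XG)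
  have g1: "cmod (g v) \<le> 1" if "v \<in> X" for v
    using mult_left_mono[of "cmod (e v)" "1 + \<epsilon>" t] e(4) that t \<epsilon> unfolding g_def by (simp add: norm_mult)
  define f where "f v = (g v - of_real r) * inverse (1 - of_real r * g v)" for v
  have rg: "cmod (of_real r * g v) \<le> r" if "v \<in> X" for v
    using mult_left_mono[OF g1[OF that], of r] r by (simp add: norm_mult)
  have "f \<in> UX" unfolding f_def[abs_def]
    by (intro ualg_mult ualg_diff g ualg_const bounded_XG
        ualg_inverse_one_minus[OF ualg_cmult[OF g bounded_XG] bounded_XG r(2) rg])
  moreover have "cmod (f v) \<le> 1" if v: "v \<in> X" for v
  proof -
    let ?w = "g v"
    have "1 - r \<le> cmod (1 - of_real r * ?w)"
      using norm_triangle_ineq2[of 1 "of_real r * ?w"] rg[OF v] by simp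
    then have pos: "0 < cmod (1 - of_real r * ?w)" using r by linarith
    have "(cmod (1 - of_real r * ?w))\<^sup>2 - (cmod (?w - of_real r))\<^sup>2 = (1 - r\<^sup>2) * (1 - (cmod ?w)\<^sup>2)"
      unfolding cmod_power2 by (simp add: power2_eq_square algebra_simps)
    also have "\<dots> \<ge> 0"
      using g1[OF v] r by (intro mult_nonneg_nonneg) (auto simp: power_le_one)
    finally have "(cmod (?w - of_real r))\<^sup>2 \<le> (cmod (1 - of_real r * ?w))\<^sup>2" by simp
    then have "cmod (?w - of_real r) \<le> cmod (1 - of_real r * ?w)" using pos by (rule power2_le_imp_le[OF _ less_imp_le])
    then show ?thesis unfolding f_def using pos
      by (simp only: divide_inverse[symmetric] norm_divide divide_le_eq_1_pos)
  qed
  moreover have "f x - f y = of_real (2 * r)"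
  proof -
    have "r * t < 1" using r t mult_strict_mono[of r 1 t 1] by simp
    then have nz: "1 - r * t \<noteq> 0" by simp
    have "f x = of_real ((t - r) * inverse (1 - r * t))" unfolding f_def g_def ex by simp
    moreover have "(t - r) = r * (1 - r * t)" using t(3) by (simp add: power2_eq_square algebra_simps)
    then have "(t - r) * inverse (1 - r * t) = r" using nz by simp
    moreover have "f y = - of_real r" unfolding f_def g_def ex by simp
    ultimately show ?thesis by simp
  qed
  ultimately show ?thesis by blast
qed

end

section \<open>The uniform algebra on the root extension\<close>

lemma C_space_compact:
  assumes "compact X"
  shows "C_space (top_of_set X) = {f \<in> extensional X. continuous_on X f}"
proof -
  have "bounded (f ` X)" if "continuous_on X f" for f :: "'a \<Rightarrow> complex"
    using compact_continuous_image[OF that assms] by (rule compact_imp_bounded)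
  then show ?thesis unfolding C_space_def C_metric_def by auto
qed

lemma closure_of_C_topology:
  assumes X: "compact X" "X \<noteq> {}" and S: "S \<subseteq> C_space (top_of_set X)"
  shows "C_topology (top_of_set X) closure_of S =
    {f \<in> C_space (top_of_set X). \<forall>e>0. \<exists>g\<in>S. \<forall>x\<in>X. cmod (f x - g x) < e}" (is "?L = ?R")
proof -
  let ?m = "C_metric (top_of_set X)"
  interpret M: Metric_space "mspace ?m" "mdist ?m" by (rule Metric_space_mspace_mdist)
  have le: "mdist ?m f g \<le> a \<longleftrightarrow> (\<forall>x\<in>X. cmod (f x - g x) \<le> a)"
    if "f \<in> C_space (top_of_set X)" "g \<in> C_space (top_of_set X)" for f g a
    using that X(2) cfunspace_mdist_le[of f "top_of_set X" euclidean_metric g a]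
    unfolding C_space_def C_metric_def by (simp add: dist_norm)
  have cl: "?L = {f \<in> mspace ?m. \<forall>r>0. \<exists>g\<in>S. g \<in> M.mball f r}"
    unfolding C_topology_def mtopology_of_def by (rule M.metric_closure_of)
  show ?thesis
  proof (intro equalityI subsetI)
    fix f assume f: "f \<in> ?L"
    then have fC: "f \<in> C_space (top_of_set X)" unfolding cl C_space_def by blast
    have "\<exists>g\<in>S. \<forall>x\<in>X. cmod (f x - g x) < e" if "e > 0" for e
    proof -
      have "e / 2 > 0" using that by simp
      then obtain g where g: "g \<in> S" "g \<in> M.mball f (e / 2)" using f unfolding cl by blast
      then have "mdist ?m f g \<le> e / 2" by auto
      then have "\<forall>x\<in>X. cmod (f x - g x) \<le> e / 2" using le[OF fC] S g(1) by blast
      then show ?thesis using g(1) that by (intro bexI[of _ g]) (auto intro: le_less_trans)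
    qed
    then show "f \<in> ?R" using fC by blast
  next
    fix f assume f: "f \<in> ?R"
    then have fC: "f \<in> C_space (top_of_set X)" by blast
    have "\<exists>g\<in>S. g \<in> M.mball f e" if "e > 0" for e
    proof -
      have "e / 2 > 0" using that by simp
      then obtain g where g: "g \<in> S" "\<forall>x\<in>X. cmod (f x - g x) < e / 2" using f by blast
      then have gC: "g \<in> C_space (top_of_set X)" using S by blast
      have "\<forall>x\<in>X. cmod (f x - g x) \<le> e / 2" using g(2) by (auto intro: less_imp_le)
      then have "mdist ?m f g \<le> e / 2" using le[OF fC gC] by blast
      then show ?thesis using g(1) that fC gC unfolding C_space_def by (intro bexI[of _ g]) auto
    qed
    then show "f \<in> ?L" using fC unfolding cl C_space_def by blast
  qed
qed

context base_algebra
begin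

definition T :: "(nat \<Rightarrow> complex) topology" where "T = top_of_set X"

text \<open>Intersecting with the extensional functions picks one representative for each
  restriction to \<open>X\<close>, as \<open>C_space\<close> requires.\<close>

definition B :: "((nat \<Rightarrow> complex) \<Rightarrow> complex) set" where
  "B = extensional X \<inter> UX"

lemma topspace_T: "topspace T = X" unfolding T_def by simp

lemma restrict_mem_B: "f \<in> UX \<Longrightarrow> (\<lambda>v\<in>X. f v) \<in> B"
  unfolding B_def using ualg_cong[of f X XG] by auto

lemma B_ualg: "f \<in> B \<Longrightarrow> f \<in> UX" unfolding B_def by blast

lemma B_restrict: "f \<in> B \<Longrightarrow> (\<lambda>v\<in>X. f v) = f"
  unfolding B_def by (simp add: extensional_restrict)

lemma B_sub_C: "B \<subseteq> C_space T"
  unfolding T_def C_space_compact[OF compact_X] B_def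
  using ualg_continuous_on[of _ X XG] XG_continuous by blast

lemma C_space_T: "C_space T = {f \<in> extensional X. continuous_on X f}"
  unfolding T_def by (rule C_space_compact[OF compact_X])

lemma B_bounded: "f \<in> B \<Longrightarrow> bdd_above ((\<lambda>v. cmod (f v)) ` X)"
  using ualg_bounded[OF B_ualg bounded_XG, of f] by (meson bdd_aboveI2)

lemma sup_norm_D: "f \<in> B \<Longrightarrow> sup_norm T f \<le> M \<Longrightarrow> v \<in> X \<Longrightarrow> cmod (f v) \<le> M"
  using cSUP_upper[OF _ B_bounded[of f], of v] unfolding sup_norm_def topspace_T by fastforce

lemma sup_norm_I: "X \<noteq> {} \<Longrightarrow> (\<And>v. v \<in> X \<Longrightarrow> cmod (f v) \<le> M) \<Longrightarrow> sup_norm T f \<le> M"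
  unfolding sup_norm_def topspace_T by (rule cSUP_least)

lemma coord_separates:
  assumes "x \<in> X" "y \<in> X" "x \<noteq> y"
  shows "\<exists>f\<in>B. f x \<noteq> f y"
proof -
  obtain i where i: "x i \<noteq> y i" using assms(3) by (auto simp: fun_eq_iff)
  have "(\<lambda>v. v i) \<in> UX"
  proof (cases i)
    case 0
    then show ?thesis using base_in_XG[OF ualg_gen[OF id_gen]] by simp
  next
    case (Suc k)
    then show ?thesis using alg_imp_ualg[OF coord_in_XG] by simp
  qed
  then show ?thesis using i assms by (intro bexI[OF _ restrict_mem_B]) auto
qed

lemma uniform_algebra_B:
  assumes "X \<noteq> {}"
  shows "uniform_algebra T B"
  unfolding uniform_algebra_def topspace_T
proof (intro conjI ballI allI impI)
  show "B \<subseteq> C_space T" by (rule B_sub_C)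
  show "closedin (C_topology T) B"
  proof (rule closure_of_subset_eq[THEN iffD1], rule conjI)
    show "B \<subseteq> topspace (C_topology T)" using B_sub_C unfolding C_topology_def C_space_def by simp
    show "C_topology T closure_of B \<subseteq> B"
    proof
      fix f assume "f \<in> C_topology T closure_of B"
      then have f: "f \<in> C_space T" "\<forall>e>0. \<exists>g\<in>B. \<forall>x\<in>X. cmod (f x - g x) < e"
        using closure_of_C_topology[OF compact_X assms, of B] B_sub_C unfolding T_def by auto
      have "f \<in> UX" by (rule ualg_closed) (use f(2) B_ualg in blast)
      then show "f \<in> B" using f(1) unfolding C_space_T B_def by blast
    qed
  qed
qed (auto intro!: restrict_mem_B ualg_add ualg_mult ualg_cmult ualg_const bounded_XG coord_separates dest: B_ualg)

lemma max_ideal_space_B: "max_ideal_space T B = point_eval B ` X"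
proof (intro equalityI subsetI)
  fix \<phi> assume "\<phi> \<in> point_eval B ` X"
  then obtain x where x: "x \<in> X" "\<phi> = point_eval B x" by blast
  have 1: "(\<lambda>v\<in>X. 1) \<in> B" by (intro restrict_mem_B ualg_const)
  have eval: "\<phi> (\<lambda>v\<in>X. f v) = f x" if "f \<in> UX" for f
    using restrict_mem_B[OF that] x unfolding point_eval_def by simp
  have evB: "\<phi> f = f x" if "f \<in> B" for f using that x unfolding point_eval_def by simp
  show "\<phi> \<in> max_ideal_space T B"
    unfolding max_ideal_space_def linear_functional_def topspace_T
  proof (intro CollectI conjI ballI allI)
    show "\<phi> \<in> extensional B" using x unfolding point_eval_def by simp
    show "\<exists>f\<in>B. \<phi> f \<noteq> 0"
      using eval[OF ualg_const[of 1]] by (intro bexI[OF _ 1]) simp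
    show "\<phi> (\<lambda>v\<in>X. f v + g v) = \<phi> f + \<phi> g" if "f \<in> B" "g \<in> B" for f g
      using eval[OF ualg_add[OF B_ualg[OF that(1)] B_ualg[OF that(2)]]] evB that by simp
    show "\<phi> (\<lambda>v\<in>X. f v * g v) = \<phi> f * \<phi> g" if "f \<in> B" "g \<in> B" for f g
      using eval[OF ualg_mult[OF B_ualg[OF that(1)] B_ualg[OF that(2)] bounded_XG]] evB that by simp
    show "\<phi> (\<lambda>v\<in>X. c * f v) = c * \<phi> f" if "f \<in> B" for c f
      using eval[OF ualg_cmult[OF B_ualg[OF that] bounded_XG, of c]] evB that by simp
  qed
next
  fix \<phi> assume \<phi>: "\<phi> \<in> max_ideal_space T B"
  then have ext: "\<phi> \<in> extensional B"
    and add: "\<And>f g. f \<in> B \<Longrightarrow> g \<in> B \<Longrightarrow> \<phi> (\<lambda>v\<in>X. f v + g v) = \<phi> f + \<phi> g"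
    and cmult: "\<And>c f. f \<in> B \<Longrightarrow> \<phi> (\<lambda>v\<in>X. c * f v) = c * \<phi> f"
    and mult: "\<And>f g. f \<in> B \<Longrightarrow> g \<in> B \<Longrightarrow> \<phi> (\<lambda>v\<in>X. f v * g v) = \<phi> f * \<phi> g"
    and nz: "\<exists>f\<in>B. \<phi> f \<noteq> 0"
    unfolding max_ideal_space_def linear_functional_def topspace_T by auto
  \<comment> \<open>A character of \<open>B\<close> acts on extensional functions only; composed
    with restriction it acts on all of \<open>UX\<close>.\<close>
  define \<Phi> where "\<Phi> f = \<phi> (\<lambda>v\<in>X. f v)" for f
  have "\<exists>x\<in>X. \<forall>f\<in>UX. \<Phi> f = f x"
  proof (rule character_is_evaluation)
    show "\<Phi> f = \<Phi> g" if "\<And>v. v \<in> X \<Longrightarrow> f v = g v" for f g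
      unfolding \<Phi>_def using that by (metis restrict_ext)
    show "\<Phi> (\<lambda>v. f v + g v) = \<Phi> f + \<Phi> g" if "f \<in> UX" "g \<in> UX" for f g
      using add[OF restrict_mem_B[OF that(1)] restrict_mem_B[OF that(2)]] unfolding \<Phi>_def
      by (simp cong: restrict_cong)
    show "\<Phi> (\<lambda>v. f v * g v) = \<Phi> f * \<Phi> g" if "f \<in> UX" "g \<in> UX" for f g
      using mult[OF restrict_mem_B[OF that(1)] restrict_mem_B[OF that(2)]] unfolding \<Phi>_def
      by (simp cong: restrict_cong)
    show "\<Phi> (\<lambda>v. c * f v) = c * \<Phi> f" if "f \<in> UX" for f c
      using cmult[OF restrict_mem_B[OF that]] unfolding \<Phi>_def by (simp cong: restrict_cong)
    show "\<exists>f\<in>UX. \<Phi> f \<noteq> 0" using nz B_ualg B_restrict unfolding \<Phi>_def by metis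
  qed
  then obtain x where x: "x \<in> X" "\<And>f. f \<in> UX \<Longrightarrow> \<Phi> f = f x" by blast
  have "\<phi> f = f x" if "f \<in> B" for f using x(2)[OF B_ualg[OF that]] B_restrict[OF that] unfolding \<Phi>_def by simp
  then have "\<phi> = point_eval B x"
    using ext unfolding point_eval_def by (auto simp: extensional_def restrict_def fun_eq_iff)
  then show "\<phi> \<in> point_eval B ` X" using x(1) by blast
qed

text \<open>A bump at \<open>x\<close> supported in \<open>V\<close> defines the Gelfand-open set of
  characters on which it is nonzero. All characters being evaluations, that set consists of
  evaluations at points of \<open>V\<close>, where \<open>f\<close> vanishes.\<close>

lemma J_ideal_I:
  assumes x: "x \<in> X" and f: "f \<in> B" and V: "open V" "x \<in> V" "\<And>v. v \<in> V \<Longrightarrow> v \<in> X \<Longrightarrow> f v = 0"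
  shows "f \<in> J_ideal T B (point_eval B x)"
proof -
  obtain e where e: "e \<in> UX" "const_near X x e 1" "\<forall>v\<in>X - V. e v = 0"
    using bump[OF x V(1,2)] by (elim bexE conjE)
  have ex: "e x = 1" using e(2) x by blast
  define e' where "e' = (\<lambda>v\<in>X. e v)"
  have e': "e' \<in> B" unfolding e'_def by (rule restrict_mem_B[OF e(1)])
  define W where "W = {\<psi> \<in> max_ideal_space T B. \<psi> e' \<in> - {0}}"
  have cont: "continuous_map (gelfand_topology T B) euclidean (\<lambda>\<psi>. \<psi> e')"
    unfolding gelfand_topology_def
    by (intro continuous_map_from_subtopology continuous_map_product_projection e')
  have ms: "topspace (gelfand_topology T B) = max_ideal_space T B"
    unfolding gelfand_topology_def max_ideal_space_def by (auto simp: PiE_def)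
  have "openin (gelfand_topology T B) W"
    using openin_continuous_map_preimage[OF cont, of "- {0}"] unfolding W_def ms
    by (simp add: open_Compl)
  moreover have "point_eval B x \<in> W"
    unfolding W_def max_ideal_space_B using x e' ex by (auto simp: point_eval_def e'_def)
  moreover have "\<psi> f = 0" if \<psi>: "\<psi> \<in> W" for \<psi>
  proof -
    obtain v where v: "v \<in> X" "\<psi> = point_eval B v" "\<psi> e' \<noteq> 0"
      using \<psi> unfolding W_def max_ideal_space_B by blast
    then have "e v \<noteq> 0" using e' unfolding point_eval_def by (auto simp: e'_def)
    then have "f v = 0" using e(3) v(1) V(3) by blast
    then show ?thesis using v f unfolding point_eval_def by simp
  qed
  ultimately show ?thesis using f unfolding J_ideal_def by blast
qed

section \<open>Strong regularity, relative units and point derivations\<close>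

text \<open>The counterpart of \<open>J_ideal\<close> with neighbourhoods taken in \<open>X\<close>
  instead of the maximal ideal space; \<open>J_ideal_I\<close> passes from it to
  \<open>J_ideal\<close>.\<close>

definition J :: "(nat \<Rightarrow> complex) \<Rightarrow> ((nat \<Rightarrow> complex) \<Rightarrow> complex) set" where
  "J x = {f \<in> B. const_near X x f 0}"

lemma J_dense:
  assumes x: "x \<in> X" and f: "f \<in> B" "f x = 0"
  shows "f \<in> C_topology T closure_of J x"
proof -
  have ne: "X \<noteq> {}" using x by blast
  have "J x \<subseteq> C_space T" using B_sub_C unfolding J_def by blast
  moreover have "\<exists>g\<in>J x. \<forall>v\<in>X. cmod (f v - g v) < e" if e: "e > 0" for e
  proof -
    obtain g V where g: "g \<in> UX" "open V" "x \<in> V" "\<And>v. v \<in> V \<Longrightarrow> v \<in> X \<Longrightarrow> g v = 0"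
        "\<And>v. v \<in> X \<Longrightarrow> cmod (f v - f x - g v) < e"
      by (rule zero_closureE[OF regular[OF x B_ualg[OF f(1)]] e]) blast
    have "(\<lambda>v\<in>X. g v) \<in> J x" unfolding J_def using restrict_mem_B[OF g(1)] g by auto
    then show ?thesis using g(5) f(2) by (intro bexI) auto
  qed
  ultimately show ?thesis
    using closure_of_C_topology[OF compact_X ne, of "J x"] B_sub_C f(1) unfolding T_def by blast
qed

lemma strongly_regular_B: "strongly_regular T B"
  unfolding strongly_regular_def strongly_regular_at_def topspace_T
proof (intro ballI subsetI)
  fix x f assume x: "x \<in> X" and "f \<in> M_ideal B (point_eval B x)"
  then have "f \<in> B" "f x = 0" unfolding M_ideal_def point_eval_def by auto
  then have "f \<in> C_topology T closure_of J x" by (rule J_dense[OF x])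
  moreover have "J x \<subseteq> J_ideal T B (point_eval B x)" using J_ideal_I[OF x] unfolding J_def by blast
  ultimately show "f \<in> C_topology T closure_of J_ideal T B (point_eval B x)"
    using closure_of_mono by blast
qed

lemma bounded_relative_units_B:
  assumes x: "x \<in> X" "x 0 \<notin> F"
  shows "bounded_relative_units_at T B x"
  unfolding bounded_relative_units_at_def
\<comment> \<open>The unit is \<open>1 - e\<close> for a bump \<open>e\<close> at \<open>x\<close>
  that vanishes on the compact set and has norm at most 2, so 3 serves for every compact
  set.\<close>
proof (intro exI[of _ 3] conjI allI impI)
  fix L assume L: "compactin T L \<and> L \<subseteq> topspace T - {x}"
  then have "compact L" unfolding T_def by (simp add: compactin_subtopology)
  then have op: "open (- L)" "x \<in> - L" using L compact_imp_closed by auto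
  obtain e where e: "e \<in> UX" "const_near X x e 1"
      "\<forall>v\<in>X - (- L). e v = 0" "\<forall>v\<in>X. cmod (e v) \<le> 1 + 1"
    using bump_off_F[OF x op zero_less_one] by (elim bexE conjE)
  define f where "f = (\<lambda>v\<in>X. 1 - e v)"
  have f: "f \<in> B" unfolding f_def by (intro restrict_mem_B ualg_diff ualg_const e(1) bounded_XG)
  obtain V where V: "open V" "x \<in> V" "\<forall>v\<in>V \<inter> X. e v = 1" using e(2) by blast
  have "f \<in> J_ideal T B (point_eval B x)"
    by (rule J_ideal_I[OF x(1) f V(1,2)]) (use V(3) in \<open>simp add: f_def\<close>)
  moreover have "\<forall>y\<in>L. f y = 1" using e(3) L unfolding f_def topspace_T by auto
  moreover have "sup_norm T f \<le> 3"
  proof (rule sup_norm_I)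
    show "cmod (f v) \<le> 3" if "v \<in> X" for v
      using norm_triangle_ineq4[of 1 "e v"] e(4) that unfolding f_def by fastforce
  qed (use x in blast)
  ultimately show "\<exists>f\<in>J_ideal T B (point_eval B x). (\<forall>y\<in>L. f y = 1) \<and> sup_norm T f \<le> 3" by blast
qed simp

text \<open>If \<open>g\<close> vanishes near \<open>x\<close>, then \<open>g * e' = 0\<close> for a
  bump \<open>e'\<close> with \<open>e' x = 1\<close>; the product rule together with
  \<open>g x = 0\<close> gives \<open>\<psi> g = 0\<close>. Such \<open>g\<close> are dense among
  the functions vanishing at \<open>x\<close>, so continuity kills these too, and constants are
  killed by every derivation.\<close>

lemma no_bounded_point_derivation:
  assumes \<phi>: "\<phi> \<in> max_ideal_space T B" and \<psi>: "bounded_point_derivation T B \<phi> \<psi>"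
  shows "\<forall>f\<in>B. \<psi> f = 0"
proof
  fix f assume f: "f \<in> B"
  obtain x where x: "x \<in> X" "\<phi> = point_eval B x" using \<phi> unfolding max_ideal_space_B by blast
  have \<phi>B: "\<phi> g = g x" if "g \<in> B" for g using that x unfolding point_eval_def by simp
  have add: "\<And>f g. f \<in> B \<Longrightarrow> g \<in> B \<Longrightarrow> \<psi> (\<lambda>v\<in>X. f v + g v) = \<psi> f + \<psi> g"
    and cmult: "\<And>c f. f \<in> B \<Longrightarrow> \<psi> (\<lambda>v\<in>X. c * f v) = c * \<psi> f"
    and mult: "\<And>f g. f \<in> B \<Longrightarrow> g \<in> B \<Longrightarrow> \<psi> (\<lambda>v\<in>X. f v * g v) = \<psi> f * \<phi> g + \<phi> f * \<psi> g"
    and cont: "continuous_map (subtopology (C_topology T) B) euclidean \<psi>"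
    using \<psi> unfolding bounded_point_derivation_def point_derivation_def linear_functional_def topspace_T by auto
  have const: "(\<lambda>v\<in>X. c) \<in> B" for c by (intro restrict_mem_B ualg_const)
  have one: "\<psi> (\<lambda>v\<in>X. 1) = 0"
    using mult[OF const[of 1] const[of 1]] \<phi>B[OF const[of 1]] x by (simp cong: restrict_cong)
  have psi_const: "\<psi> (\<lambda>v\<in>X. c) = 0" for c
    using cmult[OF const[of 1], of c] one by (simp cong: restrict_cong)
  have J0: "\<psi> g = 0" if g: "g \<in> J x" for g
  proof -
    have gB: "g \<in> B" using g unfolding J_def by blast
    obtain V where V: "open V" "x \<in> V" "\<forall>v\<in>V \<inter> X. g v = 0" using g unfolding J_def by blast
    obtain e where e: "e \<in> UX" "const_near X x e 1" "\<forall>v\<in>X - V. e v = 0"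
      using bump[OF x(1) V(1,2)] by (elim bexE conjE)
    define e' where "e' = (\<lambda>v\<in>X. e v)"
    have e': "e' \<in> B" unfolding e'_def by (rule restrict_mem_B[OF e(1)])
    have ex: "e' x = 1" using e(2) x(1) unfolding e'_def by auto
    have gx: "g x = 0" using V x(1) by blast
    have "(\<lambda>v\<in>X. g v * e' v) = (\<lambda>v\<in>X. 0)"
    proof (rule restrict_ext)
      fix v assume v: "v \<in> X"
      show "g v * e' v = 0"
        using V(3) e(3) v unfolding e'_def by (cases "v \<in> V") auto
    qed
    then have "\<psi> g * \<phi> e' + \<phi> g * \<psi> e' = 0" using mult[OF gB e'] psi_const[of 0] by simp
    then show ?thesis using \<phi>B[OF e'] \<phi>B[OF gB] ex gx by simp
  qed
  define f0 where "f0 = (\<lambda>v\<in>X. f v - f x)"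
  have "f0 \<in> B" unfolding f0_def by (intro restrict_mem_B ualg_diff ualg_const B_ualg f bounded_XG)
  moreover have "f0 x = 0" unfolding f0_def using x(1) by simp
  ultimately have f0: "f0 \<in> B" "f0 x = 0" .
  have JB: "J x \<subseteq> B" unfolding J_def by blast
  \<comment> \<open>The closure is taken within \<open>B\<close> because \<open>\<psi>\<close> is
    continuous only there.\<close>
  have "f0 \<in> subtopology (C_topology T) B closure_of J x"
    using J_dense[OF x(1) f0] f0(1) closure_of_subtopology[of "C_topology T" B "J x"] JB
    by (auto simp: Int_absorb1)
  moreover have "subtopology (C_topology T) B closure_of J x \<subseteq> {g \<in> topspace (subtopology (C_topology T) B). \<psi> g \<in> {0}}"
  proof (rule closure_of_minimal)
    show "closedin (subtopology (C_topology T) B) {g \<in> topspace (subtopology (C_topology T) B). \<psi> g \<in> {0}}"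
      by (rule closedin_continuous_map_preimage[OF cont]) simp
    show "J x \<subseteq> {g \<in> topspace (subtopology (C_topology T) B). \<psi> g \<in> {0}}"
      using J0 JB B_sub_C unfolding C_topology_def C_space_def by auto
  qed
  ultimately have "\<psi> f0 = 0" by blast
  moreover have "(\<lambda>v\<in>X. f0 v + (\<lambda>v\<in>X. f x) v) = f"
  proof
    fix v
    show "(\<lambda>v\<in>X. f0 v + (\<lambda>v\<in>X. f x) v) v = f v"
      using fun_cong[OF B_restrict[OF f], of v] by (cases "v \<in> X") (auto simp: f0_def)
  qed
  ultimately show "\<psi> f = 0" using add[OF f0(1) const[of "f x"]] psi_const by simp
qed

section \<open>Gleason parts\<close>

lemma dual_norm_bdd:
  assumes "x \<in> X" "y \<in> X"
  shows "bdd_above ((\<lambda>f. cmod (point_eval B x f - point_eval B y f)) ` {f \<in> B. sup_norm T f \<le> 1})"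
proof (rule bdd_aboveI2)
  fix f assume "f \<in> {f \<in> B. sup_norm T f \<le> 1}"
  then have "f \<in> B" "cmod (f x) \<le> 1" "cmod (f y) \<le> 1" using sup_norm_D assms by auto
  then show "cmod (point_eval B x f - point_eval B y f) \<le> 2"
    using norm_triangle_ineq4[of "f x" "f y"] unfolding point_eval_def by simp
qed

lemma dual_norm_part:
  assumes "x \<in> F" "y \<in> F"
  shows "dual_norm T B (\<lambda>f. point_eval B (pt x) f - point_eval B (pt y) f) < 2"
proof -
  have ne: "X \<noteq> {}" using pt_mem[OF assms(1)] by blast
  have "dual_norm T B (\<lambda>f. point_eval B (pt x) f - point_eval B (pt y) f) \<le> 1"
    unfolding dual_norm_def
  proof (rule cSUP_least)
    have "(\<lambda>v\<in>X. 0) \<in> {f \<in> B. sup_norm T f \<le> 1}"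
      using restrict_mem_B[OF ualg_const[of 0]] sup_norm_I[OF ne, of "\<lambda>v\<in>X. 0" 1] by simp
    then show "{f \<in> B. sup_norm T f \<le> 1} \<noteq> {}" by blast
    fix f assume f: "f \<in> {f \<in> B. sup_norm T f \<le> 1}"
    then have "cmod (f (pt x) - f (pt y)) \<le> 1"
      using sup_norm_D B_ualg by (intro variation_X assms) auto
    then show "cmod (point_eval B (pt x) f - point_eval B (pt y) f) \<le> 1"
      using f unfolding point_eval_def by simp
  qed
  then show ?thesis by simp
qed

lemma dual_norm_off:
  assumes x: "x \<in> X" "x 0 \<notin> F" and y: "y \<in> X" "y \<noteq> x"
  shows "2 \<le> dual_norm T B (\<lambda>f. point_eval B y f - point_eval B x f)"
proof (rule field_le_epsilon)
  fix \<epsilon> :: real assume \<epsilon>: "\<epsilon> > 0"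
  \<comment> \<open>The maximum with 1/2 keeps \<open>r\<close> positive when
    \<open>\<epsilon>\<close> is large.\<close>
  define r where "r = max (1/2) (1 - \<epsilon> / 2)"
  have "1 - \<epsilon> / 2 \<le> r" "0 < r" "r < 1" unfolding r_def using \<epsilon> by auto
  then have r: "0 < r" "r < 1" "2 \<le> 2 * r + \<epsilon>" by linarith+
  obtain f where f: "f \<in> UX" "\<forall>v\<in>X. cmod (f v) \<le> 1" "f x - f y = of_real (2 * r)"
    using separated_from_part[OF x y r(1,2)] by blast
  define g where "g = (\<lambda>v\<in>X. f v)"
  have g: "g \<in> B" unfolding g_def by (rule restrict_mem_B[OF f(1)])
  moreover have "sup_norm T g \<le> 1" using f(2) x unfolding g_def by (intro sup_norm_I) auto
  ultimately have gm: "g \<in> {f \<in> B. sup_norm T f \<le> 1}" by blast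
  have "cmod (point_eval B y g - point_eval B x g) = cmod (f y - f x)"
    using g x y unfolding point_eval_def by (simp add: g_def)
  also have "\<dots> = 2 * r" using f(3) r by (metis abs_of_pos norm_minus_commute norm_of_real mult_pos_pos zero_less_numeral)
  finally have "2 * r \<le> dual_norm T B (\<lambda>f. point_eval B y f - point_eval B x f)"
    unfolding dual_norm_def using cSUP_upper[OF gm dual_norm_bdd[OF y(1) x(1)]] by simp
  then show "2 \<le> dual_norm T B (\<lambda>f. point_eval B y f - point_eval B x f) + \<epsilon>" using r by linarith
qed

lemma point_eval_inj: "inj_on (point_eval B) X"
proof (rule inj_onI, rule ccontr)
  fix x y assume xy: "x \<in> X" "y \<in> X" "point_eval B x = point_eval B y" "x \<noteq> y"
  then obtain f where "f \<in> B" "f x \<noteq> f y" using coord_separates by blast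
  then show False using fun_cong[OF xy(3), of f] unfolding point_eval_def by simp
qed

text \<open>The estimate on \<open>F\<close> puts all its evaluations into the class of a single
  one; \<open>dual_norm_off\<close> places every other evaluation at distance at least 2.\<close>

lemma gleason_part_F:
  assumes "F \<noteq> {}"
  shows "point_eval B ` pt ` F \<in> gleason_parts T B"
proof -
  obtain a where a: "a \<in> F" using assms by blast
  have "gleason_rel T B `` {point_eval B (pt a)} = point_eval B ` pt ` F"
  proof (intro equalityI subsetI)
    fix \<psi> assume "\<psi> \<in> gleason_rel T B `` {point_eval B (pt a)}"
    then obtain v where v: "v \<in> X" "\<psi> = point_eval B v"
      and lt: "dual_norm T B (\<lambda>f. point_eval B (pt a) f - point_eval B v f) < 2"
      unfolding gleason_rel_def max_ideal_space_B by auto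
    have "v 0 \<in> F"
    proof (rule ccontr)
      assume off: "v 0 \<notin> F"
      then have "pt a \<noteq> v" using a by (auto simp: pt_def)
      then show False using dual_norm_off[OF v(1) off pt_mem[OF a]] lt by simp
    qed
    then show "\<psi> \<in> point_eval B ` pt ` F" using off_F_iff[OF v(1)] v(2) by blast
  next
    fix \<psi> assume "\<psi> \<in> point_eval B ` pt ` F"
    then obtain x where "x \<in> F" "\<psi> = point_eval B (pt x)" by blast
    then show "\<psi> \<in> gleason_rel T B `` {point_eval B (pt a)}"
      using dual_norm_part[OF a] pt_mem a unfolding gleason_rel_def max_ideal_space_B by auto
  qed
  moreover have "point_eval B (pt a) \<in> max_ideal_space T B"
    unfolding max_ideal_space_B using pt_mem[OF a] by blast
  ultimately show ?thesis unfolding gleason_parts_def quotient_def by blast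
qed

lemma card_part: "card (point_eval B ` pt ` F) = card F"
proof -
  have "inj_on (point_eval B) (pt ` F)"
    using point_eval_inj by (rule inj_on_subset) (use pt_mem in blast)
  moreover have "inj_on pt F" by (rule inj_onI) (drule fun_cong[of _ _ 0], simp add: pt_def)
  ultimately show ?thesis by (simp add: card_image)
qed

end

theorem theorem1p5:
  fixes n :: nat
  assumes "n \<ge> 2"
  shows "\<exists>(X :: seq_space) B.
           compact_space X \<and> Hausdorff_space X \<and> metrizable_space X \<and>
           uniform_algebra X B \<and> strongly_regular X B \<and>
           (\<exists>P \<in> gleason_parts X B.
              card P = n \<and>
              (\<forall>x\<in>topspace X. point_eval B x \<notin> P \<longrightarrow> bounded_relative_units_at X B x)) \<and>
           (\<forall>\<phi>\<in>max_ideal_space X B. \<forall>\<psi>.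
              bounded_point_derivation X B \<phi> \<psi> \<longrightarrow> (\<forall>f\<in>B. \<psi> f = 0))"
proof -
  obtain K G F H where KGFH: "base_algebra K G F H" and card: "card F = n"
    using base_algebra_exists[of n] assms by auto
  interpret base_algebra K G F H by (rule KGFH)
  have F: "F \<noteq> {}" using card assms by auto
  have ne: "X \<noteq> {}" using F pt_mem by blast
  show ?thesis
  proof (rule exI[of _ T], rule exI[of _ B], intro conjI)
    show "compact_space T" unfolding T_def using compact_X by (simp add: compact_space_subtopology)
    show "Hausdorff_space T" unfolding T_def by (intro Hausdorff_space_subtopology) simp
    show "metrizable_space T" unfolding T_def by (intro metrizable_space_subtopology metrizable_space_euclidean)
    show "uniform_algebra T B" by (rule uniform_algebra_B[OF ne])
    show "strongly_regular T B" by (rule strongly_regular_B)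
    have "\<forall>x\<in>topspace T. point_eval B x \<notin> point_eval B ` pt ` F \<longrightarrow> bounded_relative_units_at T B x"
      using bounded_relative_units_B off_F_iff unfolding topspace_T by blast
    then show "\<exists>P \<in> gleason_parts T B. card P = n \<and>
        (\<forall>x\<in>topspace T. point_eval B x \<notin> P \<longrightarrow> bounded_relative_units_at T B x)"
      using gleason_part_F[OF F] card_part card by blast
    show "\<forall>\<phi>\<in>max_ideal_space T B. \<forall>\<psi>. bounded_point_derivation T B \<phi> \<psi> \<longrightarrow> (\<forall>f\<in>B. \<psi> f = 0)"
      using no_bounded_point_derivation by blast
  qed
qed

end
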